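(* Consider the SSBM in the context with $\eta\in[0,1/2)$, $k\ge2$, $n\ge10$, and suppose the aspect ratio satisfies $\sqrt\rho>1-\frac{1}{4k(2+\sqrt k)}$. Let $\delta\in(0,\frac12)$ and suppose $$p>C(k,\eta,\delta)\frac{\ln n}{n},\qquad C(k,\eta,\delta)=\left(\frac{2Ck}{\delta(1-2\eta)}\right)^2,$$ where $C<43$ is a universal constant. Then there exists a universal constant $c>0$ such that, with probability at least $1-\frac2n-n\exp(-\frac{np}{c})$, there exists an orthogonal matrix $O\in\mathbb R^{(k-1)\times(k-1)}$ with $$\|V_{k-1}(\overline{L_{sym}})-\Theta R_{k-1}O\|\le2\delta,$$ where $R_{k-1}\in\mathbb R^{k\times(k-1)}$ has as columns orthonormal eigenvectors of the $k-1$ smallest eigenvalues of the matrix $\bar C$.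
   Context: SSBM: integers $n\ge2,k\ge2$, $p\in(0,1]$, $\eta\in[0,1/2)$, partition of $[n]$ into nonempty clusters $C_1,\dots,C_k$, $|C_i|=n_i$. Independently for each unordered pair $j\ne j'$ an edge is present w.p. $p$, signed $+1$ if $j,j'$ are in the same cluster and $-1$ otherwise, then the sign is flipped independently w.p. $\eta$. $A\in\{0,\pm1\}^{n\times n}$ is the symmetric signed adjacency matrix (zero diagonal), $A^\pm$ its positive/negative parts, $\bar D=\mathrm{diag}((A^++A^-)\mathbf1)$ the signed degree matrix. $s=\min n_i/n$, $l=\max n_i/n$, aspect ratio $\rho=s/l$. $\Theta_{ji}=1/\sqrt{n_i}$ if $j\in C_i$ else 0. Symmetric Signed Laplacian $\overline{L_{sym}}=I-\bar D^{-1/2}A\bar D^{-1/2}$; $V_{k-1}(M)$ denotes an $n\times(k-1)$ matrix of orthonormal eigenvectors for the $k-1$ smallest eigenvalues of $M$; $\|\cdot\|$ spectral norm. With $\bar d=p(n-1)$ and $\bar\alpha=1+\frac{p}{\bar d}(1-2\eta)$, $\bar C=\bar\alpha I_k-\bar B$ where $\bar B_{ii}=\frac{n_ip}{\bar d}(1-2\eta)$ and $\bar B_{ii'}=-\frac{\sqrt{n_in_{i'}}p}{\bar d}(1-2\eta)$ for $i\ne i'$. *)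

theory Defs
  imports Complex_Main "Jordan_Normal_Form.Matrix"
begin

definition euclid_norm :: "real vec \<Rightarrow> real" where
  "euclid_norm x = sqrt (\<Sum>i<dim_vec x. (x $ i)^2)"

definition spec_norm :: "real mat \<Rightarrow> real" where
  "spec_norm M = Sup {euclid_norm (M *\<^sub>v x) | x.
      x \<in> carrier_vec (dim_col M) \<and> euclid_norm x = 1}"

definition orthogonal_mat :: "nat \<Rightarrow> real mat \<Rightarrow> bool" where
  "orthogonal_mat m Q \<longleftrightarrow> Q \<in> carrier_mat m m \<and> transpose_mat Q * Q = 1\<^sub>m m"

text \<open>\<open>bottom_eigvecs M m V\<close>: \<open>V\<close> is an \<open>N \<times> m\<close> matrix whose columns are orthonormal
  eigenvectors of the symmetric \<open>N \<times> N\<close> matrix \<open>M\<close> for its \<open>m\<close> smallest eigenvalues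
  (counted with multiplicity), i.e. \<open>V\<close> consists of the first \<open>m\<close> columns of an
  orthogonal eigenvector matrix \<open>U\<close> of a spectral decomposition
  \<open>M = U diag(\<lambda>) U\<^sup>T\<close> with \<open>\<lambda>\<^sub>0 \<le> \<lambda>\<^sub>1 \<le> \<dots> \<le> \<lambda>\<^sub>N\<^sub>-\<^sub>1\<close>.\<close>
definition bottom_eigvecs :: "real mat \<Rightarrow> nat \<Rightarrow> real mat \<Rightarrow> bool" where
  "bottom_eigvecs M m V \<longleftrightarrow>
     (let N = dim_row M in
      M \<in> carrier_mat N N \<and> m \<le> N \<and> V \<in> carrier_mat N m \<and>
      (\<exists>U lam. orthogonal_mat N U \<and>
         (\<forall>i j. i \<le> j \<longrightarrow> j < N \<longrightarrow> lam i \<le> (lam j :: real)) \<and>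
         M = U * mat N N (\<lambda>(i,j). if i = j then lam i else 0) * transpose_mat U \<and>
         V = mat N m (\<lambda>(i,j). U $$ (i,j))))"

text \<open>Clusters are given by a labelling \<open>cl :: nat \<Rightarrow> nat\<close>: vertex \<open>j < n\<close> lies in
  cluster \<open>C\<^sub>c\<^sub>l \<^sub>j\<close>, clusters indexed by \<open>0..<k\<close>.\<close>
definition valid_partition :: "nat \<Rightarrow> nat \<Rightarrow> (nat \<Rightarrow> nat) \<Rightarrow> bool" where
  "valid_partition n k cl \<longleftrightarrow> (\<forall>j<n. cl j < k) \<and> (\<forall>i<k. \<exists>j<n. cl j = i)"

definition csize :: "nat \<Rightarrow> (nat \<Rightarrow> nat) \<Rightarrow> nat \<Rightarrow> nat" where
  "csize n cl i = card {j. j < n \<and> cl j = i}"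

definition aspect_ratio :: "nat \<Rightarrow> nat \<Rightarrow> (nat \<Rightarrow> nat) \<Rightarrow> real" where
  "aspect_ratio n k cl =
     (real (Min (csize n cl ` {..<k})) / real n) / (real (Max (csize n cl ` {..<k})) / real n)"

definition signed_adj :: "nat \<Rightarrow> real mat set" where
  "signed_adj n = {A. A \<in> carrier_mat n n \<and>
      (\<forall>i<n. \<forall>j<n. A $$ (i,j) \<in> {-1, 0, 1} \<and> A $$ (i,j) = A $$ (j,i)) \<and>
      (\<forall>i<n. A $$ (i,i) = 0)}"

text \<open>Probability of a given entry value \<open>a\<close> for the pair \<open>{j,j'}\<close>: absent w.p. \<open>1-p\<close>;
  present with its true sign (\<open>+1\<close> inside a cluster, \<open>-1\<close> across) w.p. \<open>p(1-\<eta>)\<close>;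
  present with flipped sign w.p. \<open>p\<eta>\<close>.\<close>
definition ssbm_entry_prob :: "(nat \<Rightarrow> nat) \<Rightarrow> real \<Rightarrow> real \<Rightarrow> nat \<Rightarrow> nat \<Rightarrow> real \<Rightarrow> real" where
  "ssbm_entry_prob cl p \<eta> j j' a =
     (let s = (if cl j = cl j' then 1 else -1 :: real) in
      if a = 0 then 1 - p else if a = s then p * (1 - \<eta>) else if a = - s then p * \<eta> else 0)"

definition ssbm_weight :: "nat \<Rightarrow> (nat \<Rightarrow> nat) \<Rightarrow> real \<Rightarrow> real \<Rightarrow> real mat \<Rightarrow> real" where
  "ssbm_weight n cl p \<eta> A =
     (\<Prod>(j,j') \<in> {(j,j'). j < j' \<and> j' < n}. ssbm_entry_prob cl p \<eta> j j' (A $$ (j,j')))"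

definition ssbm_prob :: "nat \<Rightarrow> (nat \<Rightarrow> nat) \<Rightarrow> real \<Rightarrow> real \<Rightarrow> real mat set \<Rightarrow> real" where
  "ssbm_prob n cl p \<eta> E = (\<Sum>A \<in> signed_adj n \<inter> E. ssbm_weight n cl p \<eta> A)"

text \<open>Signed degree matrix \<open>D = diag((A\<^sup>+ + A\<^sup>-) 1)\<close> and symmetric signed Laplacian
  \<open>I - D\<^sup>-\<^sup>1\<^sup>/\<^sup>2 A D\<^sup>-\<^sup>1\<^sup>/\<^sup>2\<close> (with the convention \<open>0\<^sup>-\<^sup>1\<^sup>/\<^sup>2 = 0\<close> for isolated vertices).\<close>
definition signed_degree :: "real mat \<Rightarrow> nat \<Rightarrow> real" where
  "signed_degree A j = (\<Sum>j'<dim_col A. \<bar>A $$ (j,j')\<bar>)"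

definition Lsym_signed :: "real mat \<Rightarrow> real mat" where
  "Lsym_signed A = (let n = dim_row A;
      Dm = mat n n (\<lambda>(i,j). if i = j then inverse (sqrt (signed_degree A i)) else 0)
    in 1\<^sub>m n - Dm * A * Dm)"

definition Theta_mat :: "nat \<Rightarrow> nat \<Rightarrow> (nat \<Rightarrow> nat) \<Rightarrow> real mat" where
  "Theta_mat n k cl = mat n k (\<lambda>(j,i). if cl j = i then 1 / sqrt (real (csize n cl i)) else 0)"

definition Cbar_mat :: "nat \<Rightarrow> nat \<Rightarrow> (nat \<Rightarrow> nat) \<Rightarrow> real \<Rightarrow> real \<Rightarrow> real mat" where
  "Cbar_mat n k cl p \<eta> =
     (let d = p * (real n - 1);
          \<alpha> = 1 + p / d * (1 - 2 * \<eta>);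
          B = mat k k (\<lambda>(i,i'). if i = i' then real (csize n cl i) * p / d * (1 - 2 * \<eta>)
                 else - sqrt (real (csize n cl i) * real (csize n cl i')) * p / d * (1 - 2 * \<eta>))
      in \<alpha> \<cdot>\<^sub>m 1\<^sub>m k - B)"

end

theory Submission
  imports
    "HOL-Library.FuncSet"
    "HOL-Analysis.L2_Norm"
    "HOL-Analysis.Function_Topology"
    "Jordan_Normal_Form.Determinant"
    Defs
begin

text \<open>
  Let \<open>r\<^sup>2 = ln n / (n p)\<close>. Expanding \<open>E tr (A - E A)\<^sup>2\<^sup>m\<close> over closed walks, only walks that use
  every edge at least twice contribute, and these visit at most \<open>m + 1\<close> vertices; with
  \<open>m = \<lceil>ln n\<rceil>\<close> a crude count of such walks and Markov's inequality give \<open>\<parallel>A - E A\<parallel> \<le> 15 n p r\<close>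
  with probability \<open>1 - 1/n\<close>. A Chernoff bound shows that all degrees are within a factor
  \<open>1 \<plusminus> 4 r\<close> of \<open>p (n - 1)\<close> with probability \<open>1 - 1/n\<close>. On both events the Laplacian is within
  \<open>40 r\<close> of its population version \<open>\<Theta> C \<Theta>\<^sup>T + \<alpha> (1 - \<Theta> \<Theta>\<^sup>T)\<close>, where \<open>C\<close> is the matrix
  \<open>Cbar_mat\<close>. Since \<open>\<alpha> - C\<close> is a multiple of \<open>2 diag(n\<^sub>i) - \<nu> \<nu>\<^sup>T\<close> with
  \<open>\<nu>\<^sub>i = \<surd>n\<^sub>i\<close>, the population version has a spectral gap of at least \<open>(1 - 2 \<eta>) / k\<close> above its
  \<open>k - 1\<close> smallest eigenvalues. The Davis--Kahan argument then bounds the sine of the angle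
  between the two eigenspaces by \<open>\<delta>\<close>, and the polar factor of \<open>X\<^sup>T V\<close> with \<open>X = \<Theta> R\<close> aligns
  the two bases up to \<open>\<surd>2 \<delta>\<close>. The constants are \<open>C = 42\<close> and \<open>c = 1\<close>.
\<close>

section \<open>Euclidean norm and operator bounds\<close>

text \<open>The demand \<open>C < 43\<close> is numerical, so every estimate carries an explicit
  constant. The noise and the degree fluctuations enter the Laplacian error through two terms of at
  most \<open>20 r\<close> each. With \<open>g = (1 - 2 \<eta>) / k\<close> as gap, an error of
  \<open>\<delta> g / 2\<close> keeps the sine below \<delta>. The hypothesis on \<open>p\<close>
  says \<open>r < \<delta> g / (2 C)\<close>, so \<open>40 r\<close> fits when
  \<open>C = 42\<close>. Eigenvalues enter only through the decompositions that
  \<open>bottom_eigvecs\<close> provides. All else is done with norms and quadratic forms: the step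
  from trace to operator norm rests on log-convexity of \<open>|W\<^sup>j x|\<close>, min-max
  estimates on a nonzero solution of an underdetermined system, the polar factor on compactness
  instead of singular values, and Davis--Kahan on a self-bounding inequality for a supremum.
  Probability is kept to finite weighted sums over signed adjacency matrices, where independence is
  the expansion of a product of sums.\<close>

lemma euclid_norm_eq_L2_set: "euclid_norm x = L2_set (\<lambda>i. x $ i) {..<dim_vec x}"
  by (simp add: euclid_norm_def L2_set_def)

lemma euclid_norm_nonneg [simp]: "0 \<le> euclid_norm x"
  by (simp add: euclid_norm_eq_L2_set L2_set_nonneg)

lemma euclid_norm_sq: "(euclid_norm x)\<^sup>2 = x \<bullet> x"
  by (simp add: euclid_norm_def scalar_prod_def sum_nonneg power2_eq_square lessThan_atLeast0)

lemma abs_scalar_prod_le: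
  assumes "x \<in> carrier_vec n" "y \<in> carrier_vec n"
  shows "\<bar>x \<bullet> y\<bar> \<le> euclid_norm x * euclid_norm y"
proof -
  have "\<bar>x \<bullet> y\<bar> \<le> (\<Sum>i<n. \<bar>x $ i\<bar> * \<bar>y $ i\<bar>)"
    using assms by (simp add: scalar_prod_def lessThan_atLeast0 flip: abs_mult)
  also have "\<dots> \<le> euclid_norm x * euclid_norm y"
    unfolding euclid_norm_eq_L2_set using L2_set_mult_ineq[of "\<lambda>i. x $ i" "\<lambda>i. y $ i" "{..<n}"] assms by simp
  finally show ?thesis .
qed

lemma euclid_norm_triangle:
  assumes "x \<in> carrier_vec n" "y \<in> carrier_vec n"
  shows "euclid_norm (x + y) \<le> euclid_norm x + euclid_norm y"
  unfolding euclid_norm_eq_L2_set using L2_set_triangle_ineq[of "\<lambda>i. x $ i" "\<lambda>i. y $ i" "{..<n}"] assms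
  by (auto simp: L2_set_def)

lemma euclid_norm_smult: "euclid_norm (c \<cdot>\<^sub>v x) = \<bar>c\<bar> * euclid_norm x"
  by (simp add: euclid_norm_def power_mult_distrib real_sqrt_mult flip: sum_distrib_left)

lemma euclid_norm_eq_0_iff: "x \<in> carrier_vec n \<Longrightarrow> euclid_norm x = 0 \<longleftrightarrow> x = 0\<^sub>v n"
  by (auto simp: euclid_norm_def sum_nonneg_eq_0_iff)

text \<open>The homogeneous form of a spectral norm bound. It avoids the supremum in
  \<open>spec_norm\<close>, which needs a nonempty unit sphere, and combines directly with the
  triangle inequality; \<open>spec_norm\<close> returns only for the final estimate.\<close>

definition op_bound :: "real mat \<Rightarrow> real \<Rightarrow> bool" where
  "op_bound M c \<longleftrightarrow> (\<forall>x \<in> carrier_vec (dim_col M). euclid_norm (M *\<^sub>v x) \<le> c * euclid_norm x)"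

lemma pow_mat_comm:
  assumes "(W :: real mat) \<in> carrier_mat n n"
  shows "W ^\<^sub>m j * W = W * W ^\<^sub>m j"
proof (induction j)
  case (Suc j)
  have "W ^\<^sub>m j * W * W = W * W ^\<^sub>m j * W" using Suc by simp
  also have "\<dots> = W * (W ^\<^sub>m j * W)"
    by (rule assoc_mult_mat[OF assms pow_carrier_mat[OF assms] assms])
  finally show ?case by simp
qed (use assms in auto)

lemma pow_mat_plus:
  assumes "(W :: real mat) \<in> carrier_mat n n"
  shows "W ^\<^sub>m (i + j) = W ^\<^sub>m i * W ^\<^sub>m j"
proof (induction j)
  case (Suc j)
  then show ?case
    using assoc_mult_mat[OF pow_carrier_mat[OF assms] pow_carrier_mat[OF assms] assms, of i j] by simp
qed (use assms in auto)

lemma pow_mat_symmetric: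
  assumes "(W :: real mat) \<in> carrier_mat n n" "transpose_mat W = W"
  shows "transpose_mat (W ^\<^sub>m j) = W ^\<^sub>m j"
proof (induction j)
  case (Suc j)
  then show ?case
    using transpose_mult[OF pow_carrier_mat[OF assms(1)] assms(1), of j] pow_mat_comm[OF assms(1), of j] assms(2)
    by simp
qed (use assms in auto)

text \<open>The trace is the squared Frobenius norm of \<open>M\<close>; Cauchy--Schwarz in each row
  gives the bound.\<close>

lemma euclid_norm_mult_mat_vec_le_trace:
  assumes M: "M \<in> carrier_mat n n" and x: "x \<in> carrier_vec n"
  shows "(euclid_norm (M *\<^sub>v x))\<^sup>2 \<le> (\<Sum>i<n. (M * transpose_mat M) $$ (i, i)) * (euclid_norm x)\<^sup>2"
proof -
  have "(euclid_norm (M *\<^sub>v x))\<^sup>2 = (\<Sum>i<n. (row M i \<bullet> x)\<^sup>2)"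
    using M by (simp add: euclid_norm_def sum_nonneg)
  also have "\<dots> \<le> (\<Sum>i<n. (euclid_norm (row M i))\<^sup>2 * (euclid_norm x)\<^sup>2)"
  proof (rule sum_mono)
    fix i assume "i \<in> {..<n}"
    then have "row M i \<in> carrier_vec n" using M by auto
    from power_mono[OF abs_scalar_prod_le[OF this x], of 2]
    show "(row M i \<bullet> x)\<^sup>2 \<le> (euclid_norm (row M i))\<^sup>2 * (euclid_norm x)\<^sup>2"
      by (simp add: power_mult_distrib)
  qed
  also have "\<dots> = (\<Sum>i<n. (M * transpose_mat M) $$ (i, i)) * (euclid_norm x)\<^sup>2"
    using M by (simp add: euclid_norm_sq sum_distrib_right)
  finally show ?thesis .
qed

text \<open>By symmetry and Cauchy--Schwarz the sequence \<open>a j\<close>, the squared norm of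
  \<open>W^j x\<close>, is log-convex. So \<open>a 1 / a 0\<close> is at most the geometric mean of
  the first \<open>m\<close> ratios, whose \<open>m\<close>-th power is \<open>a m / a 0\<close>.
  The trace of \<open>W^(2 m)\<close> is the squared Frobenius norm of \<open>W^m\<close> and bounds
  that quotient.\<close>

lemma op_bound_of_trace_power:
  assumes W: "W \<in> carrier_mat n n" and sym: "transpose_mat W = W" and "0 < m" "0 \<le> \<theta>"
    and tr: "(\<Sum>i<n. (W ^\<^sub>m (2 * m)) $$ (i, i)) \<le> \<theta> ^ (2 * m)"
  shows "op_bound W \<theta>"
  unfolding op_bound_def
proof
  fix x :: "real vec" assume "x \<in> carrier_vec (dim_col W)"
  then have x: "x \<in> carrier_vec n" using W by simp
  define a where "a j = (euclid_norm (W ^\<^sub>m j *\<^sub>v x))\<^sup>2" for j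
  have pw: "W ^\<^sub>m j *\<^sub>v x \<in> carrier_vec n" for j by (rule mult_mat_vec_carrier[OF pow_carrier_mat[OF W] x])
  have Suc: "W ^\<^sub>m Suc j *\<^sub>v x = W *\<^sub>v (W ^\<^sub>m j *\<^sub>v x)" for j
    using assoc_mult_mat_vec[OF W pow_carrier_mat[OF W] x, of j] pow_mat_comm[OF W, of j] by simp
  have a0: "0 \<le> a j" for j by (simp add: a_def)
  have logconv: "(a (Suc j))\<^sup>2 \<le> a j * a (Suc (Suc j))" for j
  proof -
    have "a (Suc j) = (W *\<^sub>v (W ^\<^sub>m j *\<^sub>v x)) \<bullet> (W ^\<^sub>m Suc j *\<^sub>v x)"
      by (simp add: a_def euclid_norm_sq Suc del: pow_mat.simps)
    also have "\<dots> = (W ^\<^sub>m j *\<^sub>v x) \<bullet> (W ^\<^sub>m Suc (Suc j) *\<^sub>v x)"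
      using transpose_vec_mult_scalar[OF W pw pw, of j "Suc j"] sym Suc[of "Suc j"] by simp
    finally have eq: "a (Suc j) = (W ^\<^sub>m j *\<^sub>v x) \<bullet> (W ^\<^sub>m Suc (Suc j) *\<^sub>v x)" .
    have "\<bar>a (Suc j)\<bar> \<le> euclid_norm (W ^\<^sub>m j *\<^sub>v x) * euclid_norm (W ^\<^sub>m Suc (Suc j) *\<^sub>v x)"
      unfolding eq by (rule abs_scalar_prod_le[OF pw pw])
    from power_mono[OF this, of 2] show ?thesis by (simp add: a_def power_mult_distrib del: pow_mat.simps)
  qed
  \<comment> \<open>The ratios \<open>a (Suc j) / a j\<close> are nondecreasing. The
    cross-multiplied form also covers vanishing terms, since \<open>a j = 0\<close> forces
    \<open>a (Suc j) = 0\<close>.\<close>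
  have step: "a 1 * a j \<le> a 0 * a (Suc j)" for j
  proof (induction j)
    case (Suc j)
    show ?case
    proof (cases "a j = 0")
      case True
      then have "a (Suc j) = 0" using logconv[of j] by simp
      then show ?thesis using a0 by simp
    next
      case False
      then have pos: "a j > 0" using a0[of j] by simp
      have "a j * (a 1 * a (Suc j)) = (a 1 * a j) * a (Suc j)" by simp
      also have "\<dots> \<le> a 0 * (a (Suc j))\<^sup>2"
        using mult_right_mono[OF Suc a0[of "Suc j"]] by (simp add: power2_eq_square mult_ac)
      also have "\<dots> \<le> a 0 * (a j * a (Suc (Suc j)))" by (intro mult_left_mono logconv a0)
      finally show ?thesis using pos by (simp add: mult_ac)
    qed
  qed simp
  have "a 1 ^ j * a 0 \<le> a 0 ^ j * a j" for j
  proof (induction j)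
    case (Suc j)
    have "a 1 ^ Suc j * a 0 \<le> a 1 * (a 0 ^ j * a j)" using mult_left_mono[OF Suc a0[of 1]] by (simp add: mult_ac)
    also have "\<dots> \<le> a 0 ^ j * (a 0 * a (Suc j))" using mult_left_mono[OF step[of j], of "a 0 ^ j"] a0 by (simp add: mult_ac)
    finally show ?case by (simp add: mult_ac)
  qed simp
  from this[of m] have "a 1 ^ m * a 0 \<le> a 0 ^ m * (\<theta> ^ (2 * m) * a 0)"
  proof (rule order_trans)
    have "a m \<le> (\<Sum>i<n. (W ^\<^sub>m m * transpose_mat (W ^\<^sub>m m)) $$ (i, i)) * (euclid_norm x)\<^sup>2"
      unfolding a_def by (rule euclid_norm_mult_mat_vec_le_trace[OF pow_carrier_mat[OF W] x])
    also have "W ^\<^sub>m m * transpose_mat (W ^\<^sub>m m) = W ^\<^sub>m (2 * m)"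
      by (simp add: pow_mat_symmetric[OF W sym] mult_2 pow_mat_plus[OF W])
    also have "(\<Sum>i<n. (W ^\<^sub>m (2 * m)) $$ (i, i)) * (euclid_norm x)\<^sup>2 \<le> \<theta> ^ (2 * m) * (euclid_norm x)\<^sup>2"
      using tr by (rule mult_right_mono) simp
    also have "(euclid_norm x)\<^sup>2 = a 0" using W x by (simp add: a_def)
    finally show "a 0 ^ m * a m \<le> a 0 ^ m * (\<theta> ^ (2 * m) * a 0)" using a0 by (simp add: mult_left_mono)
  qed
  then have *: "a 1 ^ m * a 0 \<le> (\<theta>\<^sup>2 * a 0) ^ m * a 0" 
    by (simp only: power_mult_distrib power_mult[symmetric] mult_ac)
  have "a 1 \<le> \<theta>\<^sup>2 * a 0"
  proof (cases "a 0 = 0")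
    case True
    then show ?thesis using logconv[of 0] by simp
  next
    case False
    then have "a 1 ^ m \<le> (\<theta>\<^sup>2 * a 0) ^ m" using * a0[of 0] by simp
    then show ?thesis using \<open>0 < m\<close> a0 by (simp add: power_mono_iff)
  qed
  then have "(euclid_norm (W *\<^sub>v x))\<^sup>2 \<le> (\<theta> * euclid_norm x)\<^sup>2"
    using W x by (simp add: a_def power_mult_distrib)
  then show "euclid_norm (W *\<^sub>v x) \<le> \<theta> * euclid_norm x"
    by (rule power2_le_imp_le) (use \<open>0 \<le> \<theta>\<close> in simp)
qed

section \<open>Orthogonal polar factors\<close>

definition frob :: "nat \<Rightarrow> real mat \<Rightarrow> real mat \<Rightarrow> real" where
  "frob m A B = (\<Sum>i<m. \<Sum>j<m. A $$ (i, j) * B $$ (i, j))"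

lemma frob_mult_left:
  assumes "A \<in> carrier_mat m m" "B \<in> carrier_mat m m" "C \<in> carrier_mat m m"
  shows "frob m (A * B) C = frob m B (transpose_mat A * C)"
proof -
  have "frob m (A * B) C = (\<Sum>i<m. \<Sum>j<m. \<Sum>l<m. A $$ (i, l) * B $$ (l, j) * C $$ (i, j))"
    using assms by (simp add: frob_def scalar_prod_def sum_distrib_right lessThan_atLeast0)
  also have "\<dots> = (\<Sum>i<m. \<Sum>l<m. \<Sum>j<m. A $$ (i, l) * B $$ (l, j) * C $$ (i, j))"
    by (intro sum.cong[OF refl] sum.swap)
  also have "\<dots> = (\<Sum>l<m. \<Sum>i<m. \<Sum>j<m. A $$ (i, l) * B $$ (l, j) * C $$ (i, j))"
    by (rule sum.swap)
  also have "\<dots> = (\<Sum>l<m. \<Sum>j<m. \<Sum>i<m. A $$ (i, l) * B $$ (l, j) * C $$ (i, j))"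
    by (intro sum.cong[OF refl] sum.swap)
  also have "\<dots> = frob m B (transpose_mat A * C)"
    using assms by (simp add: frob_def scalar_prod_def sum_distrib_left lessThan_atLeast0 mult_ac)
  finally show ?thesis .
qed

lemma orthogonal_matD:
  assumes "orthogonal_mat m Q"
  shows "Q \<in> carrier_mat m m" "transpose_mat Q * Q = 1\<^sub>m m" "Q * transpose_mat Q = 1\<^sub>m m"
  using assms mat_mult_left_right_inverse[of "transpose_mat Q" m Q] by (auto simp: orthogonal_mat_def)

text \<open>Orthogonality as finitely many polynomial equations: closedness in the compactness
  argument and the computations for reflections and rotations start from here.\<close>

lemma orthogonal_mat_iff_entries:
  "orthogonal_mat m Q \<longleftrightarrow> Q \<in> carrier_mat m m \<and>
    (\<forall>i<m. \<forall>j<m. (\<Sum>l<m. Q $$ (l, i) * Q $$ (l, j)) = (if i = j then 1 else 0))"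
proof -
  have "transpose_mat Q * Q = 1\<^sub>m m \<longleftrightarrow>
      (\<forall>i<m. \<forall>j<m. (\<Sum>l<m. Q $$ (l, i) * Q $$ (l, j)) = (if i = j then 1 else 0))"
    if "Q \<in> carrier_mat m m"
    using that by (auto simp: mat_eq_iff scalar_prod_def lessThan_atLeast0)
  then show ?thesis by (auto simp: orthogonal_mat_def)
qed

lemma orthogonal_mat_mult:
  assumes "orthogonal_mat m P" "orthogonal_mat m Q"
  shows "orthogonal_mat m (P * Q)"
proof -
  note P = orthogonal_matD[OF assms(1)] and Q = orthogonal_matD[OF assms(2)]
  have "transpose_mat (P * Q) * (P * Q) = transpose_mat Q * (transpose_mat P * P) * Q"
    using P(1) Q(1) by (simp add: transpose_mult[OF P(1) Q(1)] assoc_mult_mat[of _ m m _ m _ m])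
  then show ?thesis using P Q by (simp add: orthogonal_mat_def)
qed

text \<open>The orthogonal matrices form a closed subset of a cube, and the objective is linear.
  Matrices are encoded as functions on all index pairs with the product topology, where the cube is
  compact by Tychonoff's theorem.\<close>

lemma exists_frob_maximal_orthogonal:
  "\<exists>Q. orthogonal_mat m Q \<and> (\<forall>Q'. orthogonal_mat m Q' \<longrightarrow> frob m Q' M \<le> frob m Q M)"
proof -
  define orth where "orth = (\<lambda>q :: nat \<times> nat \<Rightarrow> real.
    \<forall>i<m. \<forall>j<m. (\<Sum>l<m. q (l, i) * q (l, j)) = (if i = j then 1 else 0))"
  define F where "F = (\<lambda>q :: nat \<times> nat \<Rightarrow> real. \<Sum>i<m. \<Sum>j<m. q (i, j) * M $$ (i, j))"
  define K where "K = PiE UNIV (\<lambda>_ :: nat \<times> nat. {-1..1::real}) \<inter> Collect orth"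
  \<comment> \<open>Coordinates outside the \<open>m\<close> by \<open>m\<close> block must lie in
    the cube as well; 0 is a default there, which neither \<open>orth\<close> nor \<open>F\<close>
    reads.\<close>
  define g where "g = (\<lambda>(Q :: real mat) (i, j). if i < m \<and> j < m then Q $$ (i, j) else 0)"
  have "compactin (product_topology (\<lambda>_ :: nat \<times> nat. euclidean) UNIV) (PiE UNIV (\<lambda>_. {-1..1::real}))"
    by (simp add: compactin_PiE)
  then have "compact (PiE UNIV (\<lambda>_ :: nat \<times> nat. {-1..1::real}))"
    unfolding euclidean_product_topology by simp
  moreover have "closed (Collect orth)"
    unfolding orth_def by (intro closed_Collect_all closed_Collect_imp open_Collect_const closed_Collect_eq
        continuous_intros continuous_on_product_coordinates)
  ultimately have "compact K" unfolding K_def by (rule compact_Int_closed)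
  have gK: "g Q \<in> K" "F (g Q) = frob m Q M" if Q: "orthogonal_mat m Q" for Q
  proof -
    have o: "(\<Sum>l<m. Q $$ (l, i) * Q $$ (l, j)) = (if i = j then 1 else 0)" if "i < m" "j < m" for i j
      using Q that by (simp add: orthogonal_mat_iff_entries)
    have "\<bar>Q $$ (i, j)\<bar> \<le> 1" if "i < m" "j < m" for i j
    proof -
      have "(Q $$ (i, j))\<^sup>2 \<le> (\<Sum>l<m. (Q $$ (l, j))\<^sup>2)"
        using that by (intro member_le_sum) auto
      also have "\<dots> = 1" using o[of j j] that by (simp add: power2_eq_square)
      finally show ?thesis by (simp add: abs_le_square_iff[of _ 1, simplified])
    qed
    then show "g Q \<in> K" using o by (auto simp: K_def g_def orth_def abs_le_iff minus_le_iff)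
    show "F (g Q) = frob m Q M" by (simp add: F_def g_def frob_def)
  qed
  have one: "orthogonal_mat m (1\<^sub>m m)" by (simp add: orthogonal_mat_def)
  have "\<exists>q\<in>K. \<forall>y\<in>K. F y \<le> F q"
  proof (rule continuous_attains_sup[OF \<open>compact K\<close>])
    show "K \<noteq> {}" using gK(1)[OF one] by auto
    show "continuous_on K F" unfolding F_def
      by (intro continuous_intros continuous_on_subset[OF continuous_on_product_coordinates]) auto
  qed
  then obtain q where q: "q \<in> K" "\<And>y. y \<in> K \<Longrightarrow> F y \<le> F q" by auto
  define Q where "Q = mat m m q"
  have "orthogonal_mat m Q" using q(1) by (simp add: orthogonal_mat_iff_entries Q_def K_def orth_def)
  moreover have "frob m Q M = F q" by (simp add: frob_def F_def Q_def)
  ultimately show ?thesis using q(2) gK by metis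
qed

section \<open>Reflections and rotations as competitors\<close>

definition householder :: "nat \<Rightarrow> real vec \<Rightarrow> real mat" where
  "householder m u = mat m m (\<lambda>(i, j). (if i = j then 1 else 0) - 2 * (u $ i * u $ j))"

lemma orthogonal_householder:
  assumes u: "u \<in> carrier_vec m" and "u \<bullet> u = 1"
  shows "orthogonal_mat m (householder m u)"
  unfolding orthogonal_mat_iff_entries
proof (intro conjI allI impI)
  show "householder m u \<in> carrier_mat m m" by (simp add: householder_def)
  fix i j assume ij: "i < m" "j < m"
  have uu: "(\<Sum>l<m. u $ l * u $ l) = 1"
    using assms by (simp add: scalar_prod_def lessThan_atLeast0)
  have "(\<Sum>l<m. householder m u $$ (l, i) * householder m u $$ (l, j))
    = (\<Sum>l<m. (if l = i then (if l = j then 1 else 0) else 0) - 2 * (if l = i then u $ l * u $ j else 0)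
        - 2 * (if l = j then u $ l * u $ i else 0) + 4 * (u $ i * u $ j) * (u $ l * u $ l))"
    using ij by (intro sum.cong) (auto simp: householder_def algebra_simps)
  also have "\<dots> = (if i = j then 1 else 0) - 2 * (u $ i * u $ j) - 2 * (u $ j * u $ i)
        + 4 * (u $ i * u $ j) * (\<Sum>l<m. u $ l * u $ l)"
    using ij by (simp add: sum.distrib sum_subtractf flip: sum_distrib_left)
  finally show "(\<Sum>l<m. householder m u $$ (l, i) * householder m u $$ (l, j)) = (if i = j then 1 else 0)"
    by (simp add: uu)
qed

text \<open>The reflection changes the trace of \<open>S\<close> by
  \<open>- 2 (u \<bullet> S u)\<close>, so optimality of the identity forces this form to be
  nonnegative.\<close>

lemma frob_householder:
  assumes "u \<in> carrier_vec m" "S \<in> carrier_mat m m"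
  shows "frob m (householder m u) S = frob m (1\<^sub>m m) S - 2 * (u \<bullet> (S *\<^sub>v u))"
proof -
  have "u \<bullet> (S *\<^sub>v u) = (\<Sum>i<m. \<Sum>j<m. u $ i * u $ j * S $$ (i, j))"
    using assms by (simp add: scalar_prod_def sum_distrib_left lessThan_atLeast0 mult_ac)
  moreover have "frob m (householder m u) S =
      (\<Sum>i<m. \<Sum>j<m. 1\<^sub>m m $$ (i, j) * S $$ (i, j) - 2 * (u $ i * u $ j * S $$ (i, j)))"
    unfolding frob_def by (intro sum.cong) (auto simp: householder_def algebra_simps)
  ultimately show ?thesis
    by (simp only: sum_subtractf frob_def) (simp only: sum_distrib_left[symmetric])
qed

definition givens :: "nat \<Rightarrow> nat \<Rightarrow> nat \<Rightarrow> real \<Rightarrow> real \<Rightarrow> real mat" where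
  "givens m a b c s = mat m m (\<lambda>(i, j).
    if i = a then (if j = a then c else if j = b then s else 0)
    else if i = b then (if j = a then - s else if j = b then c else 0)
    else if i = j then 1 else 0)"

lemma sum_split_two:
  fixes f :: "nat \<Rightarrow> real"
  assumes "a < m" "b < m" "a \<noteq> b"
  shows "(\<Sum>l<m. f l) = f a + f b + (\<Sum>l\<in>{..<m} - {a, b}. f l)"
proof -
  have "(\<Sum>l<m. f l) = f a + (\<Sum>l\<in>{..<m} - {a}. f l)" using assms by (simp add: sum.remove)
  also have "(\<Sum>l\<in>{..<m} - {a}. f l) = f b + (\<Sum>l\<in>{..<m} - {a} - {b}. f l)"
    using assms by (intro sum.remove) auto
  also have "{..<m} - {a} - {b} = {..<m} - {a, b}" by auto
  finally show ?thesis by simp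
qed

lemma orthogonal_givens:
  assumes ab: "a < m" "b < m" "a \<noteq> b" and cs: "c\<^sup>2 + s\<^sup>2 = 1"
  shows "orthogonal_mat m (givens m a b c s)"
  unfolding orthogonal_mat_iff_entries
proof (intro conjI allI impI)
  let ?G = "givens m a b c s"
  show "?G \<in> carrier_mat m m" by (simp add: givens_def)
  fix i j assume ij: "i < m" "j < m"
  have "(\<Sum>l\<in>{..<m} - {a, b}. ?G $$ (l, i) * ?G $$ (l, j))
    = (\<Sum>l\<in>{..<m} - {a, b}. if l = i then (if i = j then 1 else 0) else 0)"
    using ij by (intro sum.cong) (auto simp: givens_def)
  also have "\<dots> = (if i \<noteq> a \<and> i \<noteq> b \<and> i = j then 1 else 0)"
    using ij by simp
  finally have rest: "(\<Sum>l\<in>{..<m} - {a, b}. ?G $$ (l, i) * ?G $$ (l, j)) = (if i \<noteq> a \<and> i \<noteq> b \<and> i = j then 1 else 0)" .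
  show "(\<Sum>l<m. ?G $$ (l, i) * ?G $$ (l, j)) = (if i = j then 1 else 0)"
    unfolding sum_split_two[OF ab] rest
    using ab ij cs
    by (cases "i = a"; cases "i = b"; cases "j = a"; cases "j = b") (simp_all add: givens_def power2_eq_square)
qed

text \<open>Only the four entries in the plane of \<open>a\<close> and \<open>b\<close> change. Near
  the identity the term in \<open>s\<close> is of first order and the term in \<open>c - 1\<close>
  of second order, so optimality of the identity kills the antisymmetric part of
  \<open>S\<close>.\<close>

lemma frob_givens:
  assumes ab: "a < m" "b < m" "a \<noteq> b"
  shows "frob m (givens m a b c s) S - frob m (1\<^sub>m m) S =
    (c - 1) * (S $$ (a, a) + S $$ (b, b)) + s * (S $$ (a, b) - S $$ (b, a))"
proof -
  let ?G = "givens m a b c s"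
  have "frob m ?G S - frob m (1\<^sub>m m) S = (\<Sum>i<m. \<Sum>j<m. (?G $$ (i, j) - 1\<^sub>m m $$ (i, j)) * S $$ (i, j))"
    by (simp add: frob_def left_diff_distrib sum_subtractf)
  also have "\<dots> = (\<Sum>j<m. (?G $$ (a, j) - 1\<^sub>m m $$ (a, j)) * S $$ (a, j))
      + (\<Sum>j<m. (?G $$ (b, j) - 1\<^sub>m m $$ (b, j)) * S $$ (b, j))"
    unfolding sum_split_two[OF ab, of "\<lambda>i. \<Sum>j<m. (?G $$ (i, j) - 1\<^sub>m m $$ (i, j)) * S $$ (i, j)"]
    by (simp add: givens_def)
  also have "\<dots> = (c - 1) * (S $$ (a, a) + S $$ (b, b)) + s * (S $$ (a, b) - S $$ (b, a))"
  proof -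
    have "(\<Sum>j\<in>{..<m} - {a, b}. (?G $$ (a, j) - 1\<^sub>m m $$ (a, j)) * S $$ (a, j)) = 0"
         "(\<Sum>j\<in>{..<m} - {a, b}. (?G $$ (b, j) - 1\<^sub>m m $$ (b, j)) * S $$ (b, j)) = 0"
      using ab by (auto simp: givens_def intro!: sum.neutral)
    then show ?thesis
      unfolding sum_split_two[OF ab] using ab by (simp add: givens_def algebra_simps)
  qed
  finally show ?thesis .
qed

text \<open>The orthogonal polar factor of \<open>M\<close> is a maximiser of \<open>Q \<mapsto> tr (Q\<^sup>T M)\<close>: comparing with
  rotations gives symmetry of \<open>Q\<^sup>T M\<close>, comparing with reflections gives positivity.\<close>

lemma polar_factor:
  assumes M: "M \<in> carrier_mat m m"
  obtains Q where "orthogonal_mat m Q" "transpose_mat (transpose_mat Q * M) = transpose_mat Q * M"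
    "\<And>u. u \<in> carrier_vec m \<Longrightarrow> 0 \<le> u \<bullet> (transpose_mat Q * M *\<^sub>v u)"
proof -
  obtain Q where Q: "orthogonal_mat m Q" and max: "\<And>Q'. orthogonal_mat m Q' \<Longrightarrow> frob m Q' M \<le> frob m Q M"
    using exists_frob_maximal_orthogonal by blast
  note Qc = orthogonal_matD(1)[OF Q]
  define S where "S = transpose_mat Q * M"
  have S: "S \<in> carrier_mat m m" using Qc M by (simp add: S_def)
  \<comment> \<open>\<open>Q * G\<close> is again a competitor, so optimality of \<open>Q\<close>
    for \<open>M\<close> becomes optimality of the identity for \<open>S\<close>.\<close>
  have G: "frob m G S \<le> frob m (1\<^sub>m m) S" if "orthogonal_mat m G" for G
    using max[OF orthogonal_mat_mult[OF Q that]] frob_mult_left[OF Qc orthogonal_matD(1)[OF that] M]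
      frob_mult_left[OF Qc one_carrier_mat M] Qc by (simp add: S_def)
  have pos: "0 \<le> u \<bullet> (S *\<^sub>v u)" if u: "u \<in> carrier_vec m" for u
  proof (cases "euclid_norm u = 0")
    case True
    then show ?thesis using S u by (simp add: euclid_norm_eq_0_iff[OF u])
  next
    case False
    define v where "v = (1 / euclid_norm u) \<cdot>\<^sub>v u"
    have v: "v \<in> carrier_vec m" using u by (simp add: v_def)
    have "v \<bullet> v = 1"
      using False by (simp add: v_def euclid_norm_smult flip: euclid_norm_sq)
    from G[OF orthogonal_householder[OF v this]] have "0 \<le> v \<bullet> (S *\<^sub>v v)"
      by (simp add: frob_householder[OF v S])
    also have "v \<bullet> (S *\<^sub>v v) = (u \<bullet> (S *\<^sub>v u)) / (euclid_norm u)\<^sup>2"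
      using S u by (simp add: v_def mult_mat_vec[OF S u] power2_eq_square)
    finally show ?thesis using False by (simp add: zero_le_divide_iff)
  qed
  have sym: "S $$ (a, b) = S $$ (b, a)" if ab: "a < m" "b < m" for a b
  proof (cases "a = b")
    case False
    define \<alpha> where "\<alpha> = S $$ (a, a) + S $$ (b, b)"
    define \<beta> where "\<beta> = S $$ (a, b) - S $$ (b, a)"
    have le: "c * \<alpha> + s * \<beta> \<le> \<alpha>" if "c\<^sup>2 + s\<^sup>2 = 1" for c s
      using G[OF orthogonal_givens[OF ab False that]] frob_givens[OF ab False, of c s S]
      by (simp add: \<alpha>_def \<beta>_def algebra_simps)
    \<comment> \<open>The rotation with \<open>(c, s) = (\<alpha>, \<beta>) / r\<close> maximises
      \<open>c \<alpha> + s \<beta>\<close>, with value \<open>r\<close>. If \<beta> were nonzero,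
      \<open>r\<close> would exceed \<alpha>.\<close>
    define r where "r = sqrt (\<alpha>\<^sup>2 + \<beta>\<^sup>2)"
    have r2: "r\<^sup>2 = \<alpha>\<^sup>2 + \<beta>\<^sup>2" by (simp add: r_def)
    have "\<beta> = 0"
    proof (rule ccontr)
      assume "\<beta> \<noteq> 0"
      then have r: "r > 0" by (simp add: r_def sum_power2_gt_zero_iff)
      have "(\<alpha> / r)\<^sup>2 + (\<beta> / r)\<^sup>2 = 1"
        using r by (simp add: power_divide r2[symmetric] flip: add_divide_distrib)
      have "r = r\<^sup>2 / r" using r by (simp add: power2_eq_square)
      also have "\<dots> = \<alpha> / r * \<alpha> + \<beta> / r * \<beta>" unfolding r2 by (simp add: power2_eq_square add_divide_distrib)
      also have "\<dots> \<le> \<alpha>" by (rule le[OF \<open>(\<alpha> / r)\<^sup>2 + (\<beta> / r)\<^sup>2 = 1\<close>])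
      finally have "r \<le> \<alpha>" .
      then have "r\<^sup>2 \<le> \<alpha>\<^sup>2" using r by (intro power_mono) auto
      then show False using r2 \<open>\<beta> \<noteq> 0\<close> by simp
    qed
    then show ?thesis by (simp add: \<beta>_def)
  qed simp
  have "transpose_mat S = S" using S sym by (intro eq_matI) auto
  then show ?thesis using that[OF Q] pos by (simp add: S_def)
qed

section \<open>Davis--Kahan perturbation bound\<close>

lemma scalar_prod_mult_transpose:
  fixes A :: "real mat"
  assumes "A \<in> carrier_mat nr nc" "x \<in> carrier_vec nc" "y \<in> carrier_vec nr"
  shows "(A *\<^sub>v x) \<bullet> y = x \<bullet> (transpose_mat A *\<^sub>v y)"
  using transpose_vec_mult_scalar[OF assms] assms
  by (metis comm_scalar_prod mult_mat_vec_carrier transpose_carrier_mat)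

lemma euclid_norm_diff_sq:
  assumes x: "x \<in> carrier_vec N" and y: "y \<in> carrier_vec N"
  shows "(euclid_norm (x - y))\<^sup>2 = x \<bullet> x - 2 * (y \<bullet> x) + y \<bullet> y"
proof -
  have xy: "x - y \<in> carrier_vec N" using x y by simp
  show ?thesis
    unfolding euclid_norm_sq minus_scalar_prod_distrib[OF x y xy] scalar_prod_minus_distrib[OF x x y]
      scalar_prod_minus_distrib[OF y x y] comm_scalar_prod[OF x y] by simp
qed

lemma euclid_norm_isometry:
  assumes X: "X \<in> carrier_mat N d" and XX: "transpose_mat X * X = 1\<^sub>m d" and z: "z \<in> carrier_vec d"
  shows "euclid_norm (X *\<^sub>v z) = euclid_norm z"
proof -
  have Xz: "X *\<^sub>v z \<in> carrier_vec N" by (rule mult_mat_vec_carrier[OF X z])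
  have "(euclid_norm (X *\<^sub>v z))\<^sup>2 = z \<bullet> (transpose_mat X *\<^sub>v (X *\<^sub>v z))"
    unfolding euclid_norm_sq by (rule scalar_prod_mult_transpose[OF X z Xz])
  also have "transpose_mat X *\<^sub>v (X *\<^sub>v z) = z"
    using assoc_mult_mat_vec[of "transpose_mat X" d N X d z] X XX z by simp
  finally have "(euclid_norm (X *\<^sub>v z))\<^sup>2 = (euclid_norm z)\<^sup>2" by (simp add: euclid_norm_sq)
  then show ?thesis by (simp add: power2_eq_iff_nonneg)
qed

text \<open>If \<open>\<phi>\<close> denotes the angle between the ranges, then \<open>|Vu - XQu|\<^sup>2 = 2 - 2 u\<cdot>Su\<close> for the positive
  part \<open>S\<close> of \<open>X\<^sup>T V\<close>, and \<open>u\<cdot>Su \<ge> |Su|\<^sup>2 \<ge> cos\<^sup>2 \<phi>\<close> because \<open>0 \<le> S \<le> 1\<close>.\<close>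

lemma orthogonal_alignment:
  assumes X: "X \<in> carrier_mat N d" and XX: "transpose_mat X * X = 1\<^sub>m d"
    and V: "V \<in> carrier_mat N d" and VV: "transpose_mat V * V = 1\<^sub>m d"
    and sin: "\<And>u. u \<in> carrier_vec d \<Longrightarrow>
      euclid_norm (V *\<^sub>v u - X *\<^sub>v (transpose_mat X *\<^sub>v (V *\<^sub>v u))) \<le> \<epsilon> * euclid_norm u"
  obtains Q where "orthogonal_mat d Q"
    "\<And>u. u \<in> carrier_vec d \<Longrightarrow> (euclid_norm ((V - X * Q) *\<^sub>v u))\<^sup>2 \<le> 2 * (\<epsilon> * euclid_norm u)\<^sup>2"
proof -
  have M: "transpose_mat X * V \<in> carrier_mat d d" using X V by simp
  from polar_factor[OF M] obtain Q where Q: "orthogonal_mat d Q"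
    and sym: "transpose_mat (transpose_mat Q * (transpose_mat X * V)) = transpose_mat Q * (transpose_mat X * V)"
    and pos: "\<And>u. u \<in> carrier_vec d \<Longrightarrow> 0 \<le> u \<bullet> (transpose_mat Q * (transpose_mat X * V) *\<^sub>v u)" by metis
  define S where "S = transpose_mat Q * (transpose_mat X * V)"
  note Qc = orthogonal_matD(1)[OF Q]
  have Qt: "transpose_mat Q \<in> carrier_mat d d" using Qc by simp
  have Xt: "transpose_mat X \<in> carrier_mat d N" using X by simp
  have S: "S \<in> carrier_mat d d" using Qc M by (simp add: S_def)
  have "(euclid_norm ((V - X * Q) *\<^sub>v u))\<^sup>2 \<le> 2 * (\<epsilon> * euclid_norm u)\<^sup>2" if u: "u \<in> carrier_vec d" for u
  proof -
    define g where "g w = transpose_mat X *\<^sub>v (V *\<^sub>v w)" for w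
    have gc: "g w \<in> carrier_vec d" if "w \<in> carrier_vec d" for w
      unfolding g_def by (rule mult_mat_vec_carrier[OF Xt mult_mat_vec_carrier[OF V that]])
    have Sw: "S *\<^sub>v w = transpose_mat Q *\<^sub>v g w" if w: "w \<in> carrier_vec d" for w
      unfolding S_def g_def using assoc_mult_mat_vec[OF Qt M w] assoc_mult_mat_vec[OF Xt V w] by simp
    have QQt: "transpose_mat (transpose_mat Q) * transpose_mat Q = 1\<^sub>m d"
      using orthogonal_matD(3)[OF Q] by simp
    have nS: "euclid_norm (S *\<^sub>v w) = euclid_norm (g w)" if w: "w \<in> carrier_vec d" for w
      unfolding Sw[OF w] by (rule euclid_norm_isometry[OF Qt QQt gc[OF w]])
    have Vw: "V *\<^sub>v w \<in> carrier_vec N" "euclid_norm (V *\<^sub>v w) = euclid_norm w" if w: "w \<in> carrier_vec d" for w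
      using mult_mat_vec_carrier[OF V w] euclid_norm_isometry[OF V VV w] by auto
    have Xg: "X *\<^sub>v g w \<in> carrier_vec N" if "w \<in> carrier_vec d" for w
      by (rule mult_mat_vec_carrier[OF X gc[OF that]])
    \<comment> \<open>\<open>X (g w)\<close> is the orthogonal projection of \<open>V w\<close> to
      the range of \<open>X\<close>, so this is Pythagoras.\<close>
    have pyth: "(euclid_norm (V *\<^sub>v w - X *\<^sub>v g w))\<^sup>2 = (euclid_norm w)\<^sup>2 - (euclid_norm (g w))\<^sup>2"
      if w: "w \<in> carrier_vec d" for w
    proof -
      have "(euclid_norm (V *\<^sub>v w - X *\<^sub>v g w))\<^sup>2 =
          (V *\<^sub>v w) \<bullet> (V *\<^sub>v w) - 2 * ((X *\<^sub>v g w) \<bullet> (V *\<^sub>v w)) + (X *\<^sub>v g w) \<bullet> (X *\<^sub>v g w)"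
        by (rule euclid_norm_diff_sq[OF Vw(1)[OF w] Xg[OF w]])
      also have "(X *\<^sub>v g w) \<bullet> (V *\<^sub>v w) = g w \<bullet> g w"
        using scalar_prod_mult_transpose[OF X gc[OF w] Vw(1)[OF w]] by (simp add: g_def)
      finally show ?thesis using Vw(2)[OF w] euclid_norm_isometry[OF X XX gc[OF w]]
        by (simp flip: euclid_norm_sq)
    qed
    have le1: "euclid_norm (S *\<^sub>v w) \<le> euclid_norm w" if w: "w \<in> carrier_vec d" for w
    proof -
      have "(euclid_norm (g w))\<^sup>2 \<le> (euclid_norm w)\<^sup>2"
        using pyth[OF w] zero_le_power2[of "euclid_norm (V *\<^sub>v w - X *\<^sub>v g w)"] by linarith
      then show ?thesis unfolding nS[OF w] by (rule power2_le_imp_le) simp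
    qed
    have Su: "S *\<^sub>v u \<in> carrier_vec d" by (rule mult_mat_vec_carrier[OF S u])
    have SSu: "S *\<^sub>v (S *\<^sub>v u) \<in> carrier_vec d" by (rule mult_mat_vec_carrier[OF S Su])
    have symS: "(S *\<^sub>v x) \<bullet> y = x \<bullet> (S *\<^sub>v y)" if "x \<in> carrier_vec d" "y \<in> carrier_vec d" for x y
      using scalar_prod_mult_transpose[OF S that] sym by (simp add: S_def)
    define a b c where "a = u \<bullet> (S *\<^sub>v u)" and "b = (S *\<^sub>v u) \<bullet> (S *\<^sub>v u)" and "c = (S *\<^sub>v u) \<bullet> (S *\<^sub>v (S *\<^sub>v u))"
    \<comment> \<open>Positivity of \<open>S\<close> at \<open>u - t S u\<close>. The value
      \<open>t = 1\<close>, with \<open>c \<le> b\<close> from the contraction property, gives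
      \<open>b \<le> a\<close>: this is \<open>S\<^sup>2 \<le> S\<close> for
      \<open>0 \<le> S \<le> 1\<close>, obtained without eigenvalues.\<close>
    have quad: "0 \<le> a - 2 * t * b + t\<^sup>2 * c" for t
    proof -
      define w where "w = u - t \<cdot>\<^sub>v (S *\<^sub>v u)"
      have w: "w \<in> carrier_vec d" using u Su by (simp add: w_def)
      have "S *\<^sub>v w = S *\<^sub>v u - t \<cdot>\<^sub>v (S *\<^sub>v (S *\<^sub>v u))"
        unfolding w_def using mult_minus_distrib_mat_vec[OF S u, of "t \<cdot>\<^sub>v (S *\<^sub>v u)"] mult_mat_vec[OF S Su] Su by simp
      then have "w \<bullet> (S *\<^sub>v w) = a - t * (u \<bullet> (S *\<^sub>v (S *\<^sub>v u))) - t * b + t\<^sup>2 * c"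
        unfolding w_def a_def b_def c_def using u Su SSu
        by (simp add: minus_scalar_prod_distrib[of _ d] scalar_prod_minus_distrib[of _ d] right_diff_distrib power2_eq_square)
      also have "u \<bullet> (S *\<^sub>v (S *\<^sub>v u)) = b" using symS[OF u Su] by (simp add: b_def)
      finally show ?thesis using pos[OF w] by (simp add: S_def mult_ac)
    qed
    have "c \<le> b"
    proof -
      have "c \<le> euclid_norm (S *\<^sub>v u) * euclid_norm (S *\<^sub>v (S *\<^sub>v u))"
        unfolding c_def using abs_scalar_prod_le[OF Su SSu] by simp
      also have "\<dots> \<le> euclid_norm (S *\<^sub>v u) * euclid_norm (S *\<^sub>v u)"
        by (intro mult_left_mono le1 Su) simp
      finally show ?thesis unfolding b_def by (simp add: power2_eq_square flip: euclid_norm_sq)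
    qed
    then have ab: "b \<le> a" using quad[of 1] by simp
    have "(V - X * Q) *\<^sub>v u = V *\<^sub>v u - X *\<^sub>v (Q *\<^sub>v u)"
      using minus_mult_distrib_mat_vec[OF V _ u, of "X * Q"] assoc_mult_mat_vec[OF X Qc u] X Qc by simp
    moreover have Qu: "Q *\<^sub>v u \<in> carrier_vec d" by (rule mult_mat_vec_carrier[OF Qc u])
    moreover have XQu: "X *\<^sub>v (Q *\<^sub>v u) \<in> carrier_vec N" by (rule mult_mat_vec_carrier[OF X Qu])
    ultimately have "(euclid_norm ((V - X * Q) *\<^sub>v u))\<^sup>2 =
        (V *\<^sub>v u) \<bullet> (V *\<^sub>v u) - 2 * ((X *\<^sub>v (Q *\<^sub>v u)) \<bullet> (V *\<^sub>v u)) + (X *\<^sub>v (Q *\<^sub>v u)) \<bullet> (X *\<^sub>v (Q *\<^sub>v u))"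
      using euclid_norm_diff_sq[OF Vw(1)[OF u]] by simp
    also have "(X *\<^sub>v (Q *\<^sub>v u)) \<bullet> (V *\<^sub>v u) = (Q *\<^sub>v u) \<bullet> g u"
      using scalar_prod_mult_transpose[OF X Qu Vw(1)[OF u]] by (simp add: g_def)
    also have "\<dots> = a"
      using scalar_prod_mult_transpose[OF Qc u gc[OF u]] Sw[OF u] by (simp add: a_def)
    also have "(V *\<^sub>v u) \<bullet> (V *\<^sub>v u) = (euclid_norm u)\<^sup>2" using Vw(2)[OF u] by (simp flip: euclid_norm_sq)
    also have "(X *\<^sub>v (Q *\<^sub>v u)) \<bullet> (X *\<^sub>v (Q *\<^sub>v u)) = (euclid_norm u)\<^sup>2"
      using euclid_norm_isometry[OF X XX Qu] euclid_norm_isometry[OF Qc orthogonal_matD(2)[OF Q] u]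
      by (simp flip: euclid_norm_sq)
    also have "(euclid_norm u)\<^sup>2 - 2 * a + (euclid_norm u)\<^sup>2 \<le> 2 * ((euclid_norm u)\<^sup>2 - b)" using ab by simp
    also have "b = (euclid_norm (g u))\<^sup>2" unfolding b_def using nS[OF u] by (simp flip: euclid_norm_sq)
    also have "(euclid_norm u)\<^sup>2 - (euclid_norm (g u))\<^sup>2 = (euclid_norm (V *\<^sub>v u - X *\<^sub>v g u))\<^sup>2"
      using pyth[OF u] by simp
    also have "\<dots> \<le> (\<epsilon> * euclid_norm u)\<^sup>2"
      using sin[OF u] by (intro power_mono) (auto simp: g_def)
    finally show ?thesis by simp
  qed
  then show ?thesis using that Q by blast
qed

section \<open>Rayleigh quotients, underdetermined systems and truncated eigenbases\<close>

definition diag_of :: "nat \<Rightarrow> (nat \<Rightarrow> real) \<Rightarrow> real mat" where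
  "diag_of N lam = mat N N (\<lambda>(i, j). if i = j then lam i else 0)"

lemma diag_of_carrier [simp]: "diag_of N lam \<in> carrier_mat N N"
  by (simp add: diag_of_def)

lemma diag_of_mult_vec:
  "x \<in> carrier_vec N \<Longrightarrow> diag_of N lam *\<^sub>v x = vec N (\<lambda>i. lam i * x $ i)"
  by (intro eq_vecI) (auto simp: diag_of_def scalar_prod_def if_distrib[of "\<lambda>z. z * _"] cong: if_cong)

lemma spectral_form:
  assumes U: "orthogonal_mat N U" and y: "y \<in> carrier_vec N"
  shows "y \<bullet> (U * diag_of N lam * transpose_mat U *\<^sub>v y) = (\<Sum>i<N. lam i * ((transpose_mat U *\<^sub>v y) $ i)\<^sup>2)"
    and "(\<Sum>i<N. ((transpose_mat U *\<^sub>v y) $ i)\<^sup>2) = (euclid_norm y)\<^sup>2"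
proof -
  note Uc = orthogonal_matD(1)[OF U]
  have Ut: "transpose_mat U \<in> carrier_mat N N" using Uc by simp
  define w where "w = transpose_mat U *\<^sub>v y"
  have w: "w \<in> carrier_vec N" unfolding w_def by (rule mult_mat_vec_carrier[OF Ut y])
  have "U * diag_of N lam * transpose_mat U *\<^sub>v y = U *\<^sub>v (diag_of N lam *\<^sub>v w)"
    using assoc_mult_mat_vec[of "U * diag_of N lam" N N "transpose_mat U" N y]
      assoc_mult_mat_vec[of U N N "diag_of N lam" N w] Uc y w by (simp add: w_def)
  then have "y \<bullet> (U * diag_of N lam * transpose_mat U *\<^sub>v y) = w \<bullet> (diag_of N lam *\<^sub>v w)"
    using transpose_vec_mult_scalar[OF Uc mult_mat_vec_carrier[OF diag_of_carrier w] y] by (simp add: w_def)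
  also have "\<dots> = (\<Sum>i<N. lam i * (w $ i)\<^sup>2)"
    using w by (simp add: diag_of_mult_vec scalar_prod_def lessThan_atLeast0 power2_eq_square mult_ac)
  finally show "y \<bullet> (U * diag_of N lam * transpose_mat U *\<^sub>v y) = (\<Sum>i<N. lam i * ((transpose_mat U *\<^sub>v y) $ i)\<^sup>2)"
    by (simp add: w_def)
  have "(\<Sum>i<N. (w $ i)\<^sup>2) = (euclid_norm w)\<^sup>2" using w by (simp add: euclid_norm_def sum_nonneg)
  also have "euclid_norm w = euclid_norm y"
    unfolding w_def using orthogonal_matD(3)[OF U] by (intro euclid_norm_isometry[OF Ut _ y]) simp
  finally show "(\<Sum>i<N. ((transpose_mat U *\<^sub>v y) $ i)\<^sup>2) = (euclid_norm y)\<^sup>2" by (simp add: w_def)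
qed

text \<open>Zero rows complete \<open>Z\<close> to a singular square matrix. This is the dimension
  count behind the min-max arguments: fewer conditions than unknowns leave a nonzero vector.\<close>

lemma exists_kernel_vector:
  assumes Z: "(Z :: real mat) \<in> carrier_mat r d" and "r < d"
  obtains z where "z \<in> carrier_vec d" "z \<noteq> 0\<^sub>v d" "Z *\<^sub>v z = 0\<^sub>v r"
proof -
  define Y where "Y = mat d d (\<lambda>(i, j). if i < r then Z $$ (i, j) else 0)"
  have Y: "Y \<in> carrier_mat d d" by (simp add: Y_def)
  have "transpose_mat Y *\<^sub>v unit_vec d r = 0\<^sub>v d"
    using \<open>r < d\<close> by (intro eq_vecI) (auto simp: Y_def)
  moreover have "unit_vec d r \<noteq> (0\<^sub>v d :: real vec)" using \<open>r < d\<close> by simp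
  ultimately have "det (transpose_mat Y) = 0"
    using det_0_iff_vec_prod_zero[of "transpose_mat Y" d] Y by (metis transpose_carrier_mat unit_vec_carrier)
  then have "det Y = 0" using det_transpose[OF Y] by simp
  then obtain z where z: "z \<in> carrier_vec d" "z \<noteq> 0\<^sub>v d" "Y *\<^sub>v z = 0\<^sub>v d"
    using det_0_iff_vec_prod_zero[OF Y] by auto
  have "Z *\<^sub>v z = 0\<^sub>v r"
  proof (rule eq_vecI)
    fix i assume "i < dim_vec (0\<^sub>v r)"
    then have i: "i < r" by simp
    have "(Z *\<^sub>v z) $ i = (Y *\<^sub>v z) $ i"
      using i \<open>r < d\<close> Z z(1) by (auto simp: Y_def scalar_prod_def intro!: sum.cong)
    then show "(Z *\<^sub>v z) $ i = 0\<^sub>v r $ i" using z(3) i \<open>r < d\<close> by simp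
  qed (use Z in auto)
  then show ?thesis using that z by blast
qed

definition first_cols :: "nat \<Rightarrow> nat \<Rightarrow> real mat \<Rightarrow> real mat" where
  "first_cols N d U = mat N d (\<lambda>(i, j). U $$ (i, j))"

definition pad_vec :: "nat \<Rightarrow> nat \<Rightarrow> real vec \<Rightarrow> real vec" where
  "pad_vec N d w = vec N (\<lambda>i. if i < d then w $ i else 0)"

lemma pad_vec_carrier [simp]: "pad_vec N d w \<in> carrier_vec N"
  by (simp add: pad_vec_def)

lemma first_cols_carrier [simp]: "first_cols N d U \<in> carrier_mat N d"
  by (simp add: first_cols_def)

lemma first_cols_orthonormal:
  assumes U: "orthogonal_mat N U" and d: "d \<le> N"
  shows "transpose_mat (first_cols N d U) * first_cols N d U = 1\<^sub>m d"
proof (rule eq_matI)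
  fix i j assume "i < dim_row (1\<^sub>m d :: real mat)" "j < dim_col (1\<^sub>m d :: real mat)"
  then have ij: "i < d" "j < d" by auto
  have "(transpose_mat (first_cols N d U) * first_cols N d U) $$ (i, j) = (\<Sum>l<N. U $$ (l, i) * U $$ (l, j))"
    using ij by (simp add: first_cols_def scalar_prod_def lessThan_atLeast0)
  then show "(transpose_mat (first_cols N d U) * first_cols N d U) $$ (i, j) = 1\<^sub>m d $$ (i, j)"
    using U ij d unfolding orthogonal_mat_iff_entries by simp
qed (auto simp: first_cols_def)

lemma first_cols_mult_vec:
  assumes U: "U \<in> carrier_mat N N" and d: "d \<le> N" and w: "w \<in> carrier_vec d"
  shows "first_cols N d U *\<^sub>v w = U *\<^sub>v pad_vec N d w"
proof (rule eq_vecI)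
  fix i assume "i < dim_vec (U *\<^sub>v pad_vec N d w)"
  then have i: "i < N" using U by simp
  have "(first_cols N d U *\<^sub>v w) $ i = (\<Sum>j<d. U $$ (i, j) * w $ j)"
    using i w by (simp add: first_cols_def scalar_prod_def lessThan_atLeast0)
  also have "\<dots> = (\<Sum>j<N. U $$ (i, j) * pad_vec N d w $ j)"
    using d by (intro sum.mono_neutral_cong_left) (auto simp: pad_vec_def)
  also have "\<dots> = (U *\<^sub>v pad_vec N d w) $ i"
    using i U by (simp add: scalar_prod_def lessThan_atLeast0 pad_vec_def)
  finally show "(first_cols N d U *\<^sub>v w) $ i = (U *\<^sub>v pad_vec N d w) $ i" .
qed (use U in \<open>simp add: first_cols_def\<close>)

lemma transpose_first_cols_mult_vec:
  assumes U: "U \<in> carrier_mat N N" and "d \<le> N" and g: "g \<in> carrier_vec N" and "i < d"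
  shows "(transpose_mat (first_cols N d U) *\<^sub>v g) $ i = (transpose_mat U *\<^sub>v g) $ i"
  using assms by (auto simp: first_cols_def scalar_prod_def intro!: sum.cong)

lemma diff_mult_mat_vec:
  fixes A B :: "real mat"
  assumes "A \<in> carrier_mat nr nc" "B \<in> carrier_mat nr nc" "x \<in> carrier_vec nc"
  shows "A *\<^sub>v x = B *\<^sub>v x + (A - B) *\<^sub>v x"
proof -
  have "A *\<^sub>v x \<in> carrier_vec nr" "B *\<^sub>v x \<in> carrier_vec nr" using assms by auto
  then show ?thesis unfolding minus_mult_distrib_mat_vec[OF assms] using assms by (intro eq_vecI) auto
qed

text \<open>Cancels a factor that may be zero; the typical use is \<open>x\<^sup>2 \<le> x z\<close>
  for a norm \<open>x\<close>.\<close>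

lemma mult_left_le_nonneg_cancel:
  fixes x y z :: real
  assumes "x * y \<le> x * z" "0 \<le> z" "0 \<le> x" "x = 0 \<Longrightarrow> y = 0"
  shows "y \<le> z"
  using assms mult_left_le_imp_le[of x y z] by (cases "x = 0") auto

text \<open>Let \<open>f u\<close> be the component of \<open>V u\<close> orthogonal to the range of
  \<open>X\<close>. Testing the eigenvalue equation of \<open>V\<close> against \<open>f u\<close>
  bounds it by \<Delta> plus the value of \<open>f\<close> at a rescaled coefficient vector. Hence
  the supremum of \<open>|f u|\<close> over unit vectors satisfies a linear inequality in itself,
  whose solution is the sine bound. The hypothesis \<open>inv\<close> keeps \<open>Lb\<close> from
  mixing the two complementary subspaces.\<close>

lemma davis_kahan:
  assumes d: "0 < d" "d \<le> N"
    and U: "orthogonal_mat N U" and mono: "\<forall>i j. i \<le> j \<longrightarrow> j < N \<longrightarrow> lam i \<le> lam j"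
    and L_eq: "L = U * diag_of N lam * transpose_mat U"
    and V_eq: "V = mat N d (\<lambda>(i, j). U $$ (i, j))"
    and Lb: "Lb \<in> carrier_mat N N" and symLb: "transpose_mat Lb = Lb"
    and \<Delta>: "op_bound (L - Lb) \<Delta>" "0 \<le> \<Delta>" "\<Delta> < high - low"
    and X: "X \<in> carrier_mat N d" and XX: "transpose_mat X * X = 1\<^sub>m d"
    and low: "\<forall>z \<in> carrier_vec d. (X *\<^sub>v z) \<bullet> (Lb *\<^sub>v (X *\<^sub>v z)) \<le> low * (euclid_norm z)\<^sup>2"
    and high: "\<forall>f \<in> carrier_vec N. transpose_mat X *\<^sub>v f = 0\<^sub>v d \<longrightarrow> high * (euclid_norm f)\<^sup>2 \<le> f \<bullet> (Lb *\<^sub>v f)"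
    and inv: "\<forall>f \<in> carrier_vec N. transpose_mat X *\<^sub>v f = 0\<^sub>v d \<longrightarrow> transpose_mat X *\<^sub>v (Lb *\<^sub>v f) = 0\<^sub>v d"
  shows "transpose_mat V * V = 1\<^sub>m d"
    and "u \<in> carrier_vec d \<Longrightarrow>
      euclid_norm (V *\<^sub>v u - X *\<^sub>v (transpose_mat X *\<^sub>v (V *\<^sub>v u))) \<le> \<Delta> / (high - low - \<Delta>) * euclid_norm u"
proof -
  note Uc = orthogonal_matD(1)[OF U]
  have Ut: "transpose_mat U \<in> carrier_mat N N" using Uc by simp
  have Xt: "transpose_mat X \<in> carrier_mat d N" using X by simp
  have V: "V \<in> carrier_mat N d" by (simp add: V_eq)
  have L: "L \<in> carrier_mat N N" 
    unfolding L_eq by (rule mult_carrier_mat[OF mult_carrier_mat[OF Uc diag_of_carrier] Ut])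
  have E: "L - Lb \<in> carrier_mat N N" by (rule minus_carrier_mat[OF Lb])
  have Ebd: "euclid_norm ((L - Lb) *\<^sub>v x) \<le> \<Delta> * euclid_norm x" if "x \<in> carrier_vec N" for x
    using \<Delta>(1) that E by (auto simp: op_bound_def)
  show VV: "transpose_mat V * V = 1\<^sub>m d"
    unfolding V_eq first_cols_def[symmetric] by (rule first_cols_orthonormal[OF U d(2)])
  \<comment> \<open>A min-max estimate: \<open>d - 1\<close> conditions on \<open>d\<close>
    coefficients leave a nonzero \<open>z\<close> with \<open>X z\<close> orthogonal to the first
    \<open>d - 1\<close> eigenvectors of \<open>L\<close>. There the Rayleigh quotient of
    \<open>L\<close> is at least \<open>lam (d - 1)\<close> and at most
    \<open>low + \<Delta>\<close>.\<close>
  have "lam (d - 1) \<le> low + \<Delta>"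
  proof -
    define Z where "Z = mat (d - 1) d (\<lambda>(i, j). (transpose_mat U * X) $$ (i, j))"
    have "Z \<in> carrier_mat (d - 1) d" by (simp add: Z_def)
    then obtain z where z: "z \<in> carrier_vec d" "z \<noteq> 0\<^sub>v d" "Z *\<^sub>v z = 0\<^sub>v (d - 1)"
      using exists_kernel_vector[of Z "d - 1" d] d by auto
    define y where "y = X *\<^sub>v z"
    have y: "y \<in> carrier_vec N" unfolding y_def by (rule mult_mat_vec_carrier[OF X z(1)])
    have ny: "euclid_norm y = euclid_norm z" unfolding y_def by (rule euclid_norm_isometry[OF X XX z(1)])
    have npos: "0 < (euclid_norm z)\<^sup>2" using z euclid_norm_eq_0_iff[OF z(1)] by simp
    have w0: "(transpose_mat U *\<^sub>v y) $ i = 0" if "i < d - 1" for i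
    proof -
      have "transpose_mat U *\<^sub>v y = (transpose_mat U * X) *\<^sub>v z"
        unfolding y_def using assoc_mult_mat_vec[OF Ut X z(1)] by simp
      then have "(transpose_mat U *\<^sub>v y) $ i = row (transpose_mat U * X) i \<bullet> z"
        using that d Uc X by simp
      also have "row (transpose_mat U * X) i = row Z i"
        using that d Uc X by (intro eq_vecI) (auto simp: Z_def)
      also have "row Z i \<bullet> z = (Z *\<^sub>v z) $ i" using that by (simp add: Z_def)
      finally show ?thesis using z(3) that by simp
    qed
    have "lam (d - 1) * (euclid_norm y)\<^sup>2 = (\<Sum>i<N. lam (d - 1) * ((transpose_mat U *\<^sub>v y) $ i)\<^sup>2)"
      by (simp add: sum_distrib_left flip: spectral_form(2)[OF U y])
    also have "\<dots> \<le> (\<Sum>i<N. lam i * ((transpose_mat U *\<^sub>v y) $ i)\<^sup>2)"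
    proof (rule sum_mono)
      fix i assume "i \<in> {..<N}"
      then show "lam (d - 1) * ((transpose_mat U *\<^sub>v y) $ i)\<^sup>2 \<le> lam i * ((transpose_mat U *\<^sub>v y) $ i)\<^sup>2"
        using w0[of i] mono[rule_format, of "d - 1" i] by (cases "i < d - 1") (auto intro: mult_right_mono)
    qed
    also have "\<dots> = y \<bullet> (L *\<^sub>v y)" unfolding L_eq by (rule spectral_form(1)[OF U y, symmetric])
    also have "\<dots> = y \<bullet> (Lb *\<^sub>v y) + y \<bullet> ((L - Lb) *\<^sub>v y)"
      unfolding diff_mult_mat_vec[OF L Lb y]
      by (rule scalar_prod_add_distrib[OF y mult_mat_vec_carrier[OF Lb y] mult_mat_vec_carrier[OF E y]])
    also have "y \<bullet> (Lb *\<^sub>v y) \<le> low * (euclid_norm z)\<^sup>2" unfolding y_def using low z(1) by blast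
    also have "y \<bullet> ((L - Lb) *\<^sub>v y) \<le> \<Delta> * (euclid_norm z)\<^sup>2"
    proof -
      have "y \<bullet> ((L - Lb) *\<^sub>v y) \<le> euclid_norm y * euclid_norm ((L - Lb) *\<^sub>v y)"
        using abs_scalar_prod_le[OF y mult_mat_vec_carrier[OF E y]] by simp
      also have "\<dots> \<le> euclid_norm y * (\<Delta> * euclid_norm y)" by (intro mult_left_mono Ebd y) simp
      finally show ?thesis by (simp add: ny power2_eq_square mult_ac)
    qed
    finally have "lam (d - 1) * (euclid_norm z)\<^sup>2 \<le> (low + \<Delta>) * (euclid_norm z)\<^sup>2"
      by (simp add: ny algebra_simps)
    then show ?thesis using npos by simp
  qed
  \<comment> \<open>Shifting by the least eigenvalue makes the weights \<open>lam i - a\<close>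
    nonnegative, so that the largest modulus among them is \<open>lam (d - 1) - a\<close>, whatever
    the signs of the eigenvalues.\<close>
  define a where "a = lam 0"
  have a: "a \<le> lam i" if "i < d" for i using mono[rule_format, of 0 i] that d by (simp add: a_def)
  have lam_d: "lam i \<le> lam (d - 1)" if "i < d" for i using mono[rule_format, of i "d - 1"] that d by simp
  define f where "f u = V *\<^sub>v u - X *\<^sub>v (transpose_mat X *\<^sub>v (V *\<^sub>v u))" for u
  have Vc: "V *\<^sub>v u \<in> carrier_vec N" if "u \<in> carrier_vec d" for u by (rule mult_mat_vec_carrier[OF V that])
  have gc: "transpose_mat X *\<^sub>v (V *\<^sub>v u) \<in> carrier_vec d" if "u \<in> carrier_vec d" for u
    by (rule mult_mat_vec_carrier[OF Xt Vc[OF that]])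
  have Xgc: "X *\<^sub>v (transpose_mat X *\<^sub>v (V *\<^sub>v u)) \<in> carrier_vec N" if "u \<in> carrier_vec d" for u
    by (rule mult_mat_vec_carrier[OF X gc[OF that]])
  have fc: "f u \<in> carrier_vec N" if "u \<in> carrier_vec d" for u
    unfolding f_def using Vc[OF that] Xgc[OF that] by simp
  have Xf: "transpose_mat X *\<^sub>v f u = 0\<^sub>v d" if u: "u \<in> carrier_vec d" for u
  proof -
    have "transpose_mat X *\<^sub>v (X *\<^sub>v (transpose_mat X *\<^sub>v (V *\<^sub>v u))) = transpose_mat X *\<^sub>v (V *\<^sub>v u)"
      using assoc_mult_mat_vec[OF Xt X gc[OF u]] XX gc[OF u] by simp
    then show ?thesis unfolding f_def mult_minus_distrib_mat_vec[OF Xt Vc[OF u] Xgc[OF u]]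
      using gc[OF u] by simp
  qed
  have perp: "h \<bullet> (X *\<^sub>v z) = 0" if "h \<in> carrier_vec N" "transpose_mat X *\<^sub>v h = 0\<^sub>v d" "z \<in> carrier_vec d" for h z
    using transpose_vec_mult_scalar[OF X that(3) that(1)] that by simp
  have fV: "h \<bullet> (V *\<^sub>v u) = h \<bullet> f u"
    if h: "h \<in> carrier_vec N" "transpose_mat X *\<^sub>v h = 0\<^sub>v d" and u: "u \<in> carrier_vec d" for h u
    unfolding f_def scalar_prod_minus_distrib[OF h(1) Vc[OF u] Xgc[OF u]] perp[OF h gc[OF u]] by simp
  have LV: "L *\<^sub>v (V *\<^sub>v u) = V *\<^sub>v vec d (\<lambda>i. lam i * u $ i)" if u: "u \<in> carrier_vec d" for u
  proof -
    define pad where "pad = pad_vec N d"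
    have pad: "pad w \<in> carrier_vec N" for w by (simp add: pad_def)
    have Vpad: "V *\<^sub>v w = U *\<^sub>v pad w" if "w \<in> carrier_vec d" for w
      unfolding V_eq pad_def first_cols_def[symmetric] by (rule first_cols_mult_vec[OF Uc d(2) that])
    have "L *\<^sub>v (V *\<^sub>v u) = U *\<^sub>v (diag_of N lam *\<^sub>v (transpose_mat U *\<^sub>v (U *\<^sub>v pad u)))"
      unfolding Vpad[OF u] L_eq
      using assoc_mult_mat_vec[of "U * diag_of N lam" N N "transpose_mat U" N "U *\<^sub>v pad u"]
        assoc_mult_mat_vec[of U N N "diag_of N lam" N "transpose_mat U *\<^sub>v (U *\<^sub>v pad u)"]
        Uc Ut pad mult_mat_vec_carrier[OF Uc pad] mult_mat_vec_carrier[OF Ut mult_mat_vec_carrier[OF Uc pad]] by simp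
    also have "transpose_mat U *\<^sub>v (U *\<^sub>v pad u) = pad u"
      using assoc_mult_mat_vec[OF Ut Uc pad, of u] orthogonal_matD(2)[OF U] pad by simp
    also have "diag_of N lam *\<^sub>v pad u = pad (vec d (\<lambda>i. lam i * u $ i))"
      unfolding diag_of_mult_vec[OF pad] by (intro eq_vecI) (auto simp: pad_def pad_vec_def)
    also have "U *\<^sub>v \<dots> = V *\<^sub>v vec d (\<lambda>i. lam i * u $ i)" by (simp add: Vpad)
    finally show ?thesis .
  qed
  define \<sigma> where "\<sigma> = Sup ((\<lambda>u. euclid_norm (f u)) ` {u \<in> carrier_vec d. euclid_norm u = 1})"
  \<comment> \<open>This crude bound makes \<sigma> a genuine finite supremum, so that an inequality
    with \<sigma> on both sides can be solved.\<close>
  have f1: "euclid_norm (f u) \<le> euclid_norm u" if u: "u \<in> carrier_vec d" for u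
  proof -
    have "euclid_norm (f u) * euclid_norm (f u) = f u \<bullet> (V *\<^sub>v u)"
      using fV[OF fc[OF u] Xf[OF u] u] by (simp add: power2_eq_square flip: euclid_norm_sq)
    also have "\<dots> \<le> euclid_norm (f u) * euclid_norm (V *\<^sub>v u)"
      using abs_scalar_prod_le[OF fc[OF u] Vc[OF u]] by simp
    also have "euclid_norm (V *\<^sub>v u) = euclid_norm u" by (rule euclid_norm_isometry[OF V VV u])
    finally show ?thesis by (rule mult_left_le_nonneg_cancel) auto
  qed
  have bdd: "bdd_above ((\<lambda>u. euclid_norm (f u)) ` {u \<in> carrier_vec d. euclid_norm u = 1})"
    by (rule bdd_aboveI2[of _ _ 1]) (use f1 in force)
  have e0: "unit_vec d 0 \<in> {u \<in> carrier_vec d. euclid_norm u = 1}"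
    using d by (simp add: euclid_norm_def if_distrib[of "\<lambda>z. z\<^sup>2"] cong: if_cong)
  have \<sigma>0: "0 \<le> \<sigma>" unfolding \<sigma>_def by (rule cSUP_upper2[OF bdd e0]) simp
  have f_smult: "f (c \<cdot>\<^sub>v u) = c \<cdot>\<^sub>v f u" if u: "u \<in> carrier_vec d" for c u
    unfolding f_def mult_mat_vec[OF V u] mult_mat_vec[OF Xt Vc[OF u]] mult_mat_vec[OF X gc[OF u]]
    using V X by (intro eq_vecI) (auto simp: right_diff_distrib)
  have f\<sigma>: "euclid_norm (f u) \<le> \<sigma> * euclid_norm u" if u: "u \<in> carrier_vec d" for u
  proof (cases "euclid_norm u = 0")
    case True
    then show ?thesis using f1[OF u] by simp
  next
    case False
    define v where "v = (1 / euclid_norm u) \<cdot>\<^sub>v u"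
    have "v \<in> {u \<in> carrier_vec d. euclid_norm u = 1}" using False u by (simp add: v_def euclid_norm_smult)
    then have "euclid_norm (f v) \<le> \<sigma>" unfolding \<sigma>_def by (intro cSUP_upper bdd)
    then show ?thesis using False u by (simp add: v_def f_smult euclid_norm_smult field_simps order_less_le)
  qed
  have ha: "0 < high - a" "lam (d - 1) - a < high - a"
    using \<open>lam (d - 1) \<le> low + \<Delta>\<close> \<Delta> a[of "d - 1"] d by auto
  have key: "(high - a) * euclid_norm (f u) \<le> (\<sigma> * (lam (d - 1) - a) + \<Delta>) * euclid_norm u"
    if u: "u \<in> carrier_vec d" for u
  proof -
    define w where "w = vec d (\<lambda>i. lam i * u $ i)"
    define w' where "w' = vec d (\<lambda>i. (lam i - a) * u $ i)"
    have w: "w \<in> carrier_vec d" "w' \<in> carrier_vec d" by (auto simp: w_def w'_def)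
    have nw': "euclid_norm w' \<le> (lam (d - 1) - a) * euclid_norm u"
    proof -
      have "(euclid_norm w')\<^sup>2 = (\<Sum>i<d. (lam i - a)\<^sup>2 * (u $ i)\<^sup>2)"
        by (simp add: w'_def euclid_norm_def sum_nonneg power_mult_distrib)
      also have "\<dots> \<le> (\<Sum>i<d. (lam (d - 1) - a)\<^sup>2 * (u $ i)\<^sup>2)"
        by (intro sum_mono mult_right_mono power_mono) (use a lam_d in auto)
      also have "\<dots> = ((lam (d - 1) - a) * euclid_norm u)\<^sup>2"
        using u by (simp add: euclid_norm_def sum_nonneg power_mult_distrib sum_distrib_left)
      finally show ?thesis by (rule power2_le_imp_le) (use a[of "d - 1"] d in simp)
    qed
    have wdec: "w = w' + a \<cdot>\<^sub>v u" using u by (intro eq_vecI) (auto simp: w_def w'_def algebra_simps)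
    note h = fc[OF u] Xf[OF u]
    have Lh: "Lb *\<^sub>v f u \<in> carrier_vec N" by (rule mult_mat_vec_carrier[OF Lb h(1)])
    have symm: "x \<bullet> (Lb *\<^sub>v y) = (Lb *\<^sub>v x) \<bullet> y" if "x \<in> carrier_vec N" "y \<in> carrier_vec N" for x y
      using transpose_vec_mult_scalar[OF Lb that(2,1)] symLb by simp
    have "f u \<bullet> (Lb *\<^sub>v f u) = (Lb *\<^sub>v f u) \<bullet> f u" by (rule symm[OF h(1) h(1)])
    \<comment> \<open>By \<open>inv\<close>, \<open>Lb (f u)\<close> is orthogonal to the range of
      \<open>X\<close>, so the projected part of \<open>V u\<close> can be added without changing
      the product.\<close>
    also have "\<dots> = (Lb *\<^sub>v f u) \<bullet> (V *\<^sub>v u)" using fV[OF Lh inv[rule_format, OF h] u] by simp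
    also have "\<dots> = f u \<bullet> (Lb *\<^sub>v (V *\<^sub>v u))" by (rule symm[OF h(1) Vc[OF u], symmetric])
    also have "\<dots> = f u \<bullet> (L *\<^sub>v (V *\<^sub>v u)) - f u \<bullet> ((L - Lb) *\<^sub>v (V *\<^sub>v u))"
      using scalar_prod_add_distrib[OF h(1) mult_mat_vec_carrier[OF Lb Vc[OF u]] mult_mat_vec_carrier[OF E Vc[OF u]]]
        diff_mult_mat_vec[OF L Lb Vc[OF u]] by simp
    also have "f u \<bullet> (L *\<^sub>v (V *\<^sub>v u)) = f u \<bullet> (V *\<^sub>v w)" unfolding LV[OF u] w_def ..
    also have "V *\<^sub>v w = V *\<^sub>v w' + a \<cdot>\<^sub>v (V *\<^sub>v u)"
      unfolding wdec using mult_add_distrib_mat_vec[OF V w(2), of "a \<cdot>\<^sub>v u"] mult_mat_vec[OF V u] u by simp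
    also have "f u \<bullet> \<dots> = f u \<bullet> (V *\<^sub>v w') + a * (f u \<bullet> (V *\<^sub>v u))"
      using scalar_prod_add_distrib[OF h(1) Vc[OF w(2)], of "a \<cdot>\<^sub>v (V *\<^sub>v u)"] h(1) Vc[OF u] by simp
    also have "f u \<bullet> (V *\<^sub>v w') = f u \<bullet> f w'" by (rule fV[OF h w(2)])
    also have "f u \<bullet> (V *\<^sub>v u) = (euclid_norm (f u))\<^sup>2" using fV[OF h u] by (simp add: euclid_norm_sq)
    finally have "f u \<bullet> (Lb *\<^sub>v f u) = f u \<bullet> f w' + a * (euclid_norm (f u))\<^sup>2 - f u \<bullet> ((L - Lb) *\<^sub>v (V *\<^sub>v u))" .
    then have k1: "(high - a) * (euclid_norm (f u))\<^sup>2 \<le> f u \<bullet> f w' - f u \<bullet> ((L - Lb) *\<^sub>v (V *\<^sub>v u))"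
      using high[rule_format, OF h] by (simp add: algebra_simps)
    have k2: "f u \<bullet> f w' \<le> euclid_norm (f u) * (\<sigma> * ((lam (d - 1) - a) * euclid_norm u))"
    proof -
      have "f u \<bullet> f w' \<le> euclid_norm (f u) * euclid_norm (f w')"
        using abs_scalar_prod_le[OF h(1) fc[OF w(2)]] by simp
      also have "euclid_norm (f w') \<le> \<sigma> * euclid_norm w'" by (rule f\<sigma>[OF w(2)])
      also have "\<dots> \<le> \<sigma> * ((lam (d - 1) - a) * euclid_norm u)" by (rule mult_left_mono[OF nw' \<sigma>0])
      finally show ?thesis by (simp add: mult_left_mono)
    qed
    have k3: "- (f u \<bullet> ((L - Lb) *\<^sub>v (V *\<^sub>v u))) \<le> euclid_norm (f u) * (\<Delta> * euclid_norm u)"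
    proof -
      have "- (f u \<bullet> ((L - Lb) *\<^sub>v (V *\<^sub>v u))) \<le> euclid_norm (f u) * euclid_norm ((L - Lb) *\<^sub>v (V *\<^sub>v u))"
        using abs_scalar_prod_le[OF h(1) mult_mat_vec_carrier[OF E Vc[OF u]]] by simp
      also have "euclid_norm ((L - Lb) *\<^sub>v (V *\<^sub>v u)) \<le> \<Delta> * euclid_norm u"
        using Ebd[OF Vc[OF u]] euclid_norm_isometry[OF V VV u] by simp
      finally show ?thesis by (simp add: mult_left_mono)
    qed
    have "(high - a) * (euclid_norm (f u))\<^sup>2
        \<le> euclid_norm (f u) * (\<sigma> * ((lam (d - 1) - a) * euclid_norm u)) + euclid_norm (f u) * (\<Delta> * euclid_norm u)"
      using k1 k2 k3 by linarith
    then have "euclid_norm (f u) * ((high - a) * euclid_norm (f u))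
        \<le> euclid_norm (f u) * ((\<sigma> * (lam (d - 1) - a) + \<Delta>) * euclid_norm u)"
      by (simp add: algebra_simps power2_eq_square)
    moreover have "0 \<le> (\<sigma> * (lam (d - 1) - a) + \<Delta>) * euclid_norm u"
      using \<sigma>0 a[of "d - 1"] d \<Delta>(2) by simp
    ultimately show ?thesis by (rule mult_left_le_nonneg_cancel) (simp_all add: less_imp_le[OF ha(1)])
  qed
  \<comment> \<open>\<open>key\<close> on the unit sphere puts \<sigma> on both sides; it can be
    solved for because the right-hand coefficient \<open>lam (d - 1) - a\<close> is smaller than
    \<open>high - a\<close>.\<close>
  have "\<sigma> \<le> (\<sigma> * (lam (d - 1) - a) + \<Delta>) / (high - a)"
    unfolding \<sigma>_def
  proof (rule cSUP_least)
    show "{u \<in> carrier_vec d. euclid_norm u = 1} \<noteq> {}" using e0 by blast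
    fix u assume "u \<in> {u \<in> carrier_vec d. euclid_norm u = 1}"
    then show "euclid_norm (f u) \<le> (Sup ((\<lambda>u. euclid_norm (f u)) ` {u \<in> carrier_vec d. euclid_norm u = 1})
        * (lam (d - 1) - a) + \<Delta>) / (high - a)"
      using key[of u] ha(1) by (simp add: pos_le_divide_eq mult.commute \<sigma>_def)
  qed
  then have "\<sigma> * (high - lam (d - 1)) \<le> \<Delta>"
    using ha(1) by (simp add: pos_le_divide_eq algebra_simps)
  moreover have "\<sigma> * (high - low - \<Delta>) \<le> \<sigma> * (high - lam (d - 1))"
    using \<sigma>0 \<open>lam (d - 1) \<le> low + \<Delta>\<close> by (intro mult_left_mono) auto
  ultimately have \<sigma>le: "\<sigma> \<le> \<Delta> / (high - low - \<Delta>)"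
    using \<Delta>(3) by (simp add: pos_le_divide_eq)
  show "euclid_norm (V *\<^sub>v u - X *\<^sub>v (transpose_mat X *\<^sub>v (V *\<^sub>v u))) \<le> \<Delta> / (high - low - \<Delta>) * euclid_norm u"
    if u: "u \<in> carrier_vec d"
    using order_trans[OF f\<sigma>[OF u] mult_right_mono[OF \<sigma>le euclid_norm_nonneg]] by (simp add: f_def)
qed

section \<open>Spectrum of the population Laplacian\<close>

lemma mult_mat_vec_index:
  assumes "M \<in> carrier_mat r k" "g \<in> carrier_vec k" "i < r"
  shows "(M *\<^sub>v g) $ i = (\<Sum>a<k. M $$ (i, a) * g $ a)"
  using assms by (simp add: scalar_prod_def lessThan_atLeast0)

lemma csize_pos: "valid_partition n k cl \<Longrightarrow> i < k \<Longrightarrow> 0 < csize n cl i"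
  by (auto simp: valid_partition_def csize_def card_gt_0_iff)

lemma sum_csize:
  assumes "valid_partition n k cl"
  shows "(\<Sum>i<k. csize n cl i) = n"
proof -
  have "(\<Sum>i<k. sum (\<lambda>_. 1::nat) {j \<in> {..<n}. cl j = i}) = sum (\<lambda>_. 1) {..<n}"
    by (rule sum.group) (use assms in \<open>auto simp: valid_partition_def\<close>)
  then show ?thesis by (simp add: csize_def)
qed

text \<open>The matrix \<open>B\<close> inside \<open>Cbar_mat\<close>. There the factor is
  \<open>p (1 - 2 \<eta>) / d\<close> with \<open>d = p (n - 1)\<close>, so \<open>p\<close> cancels
  and \<open>q = (1 - 2 \<eta>) / (n - 1)\<close>.\<close>

definition block_mat :: "nat \<Rightarrow> nat \<Rightarrow> (nat \<Rightarrow> nat) \<Rightarrow> real \<Rightarrow> real mat" where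
  "block_mat n k cl q = mat k k (\<lambda>(i, i'). if i = i' then real (csize n cl i) * q
      else - sqrt (real (csize n cl i) * real (csize n cl i')) * q)"

text \<open>For that \<open>q\<close>, the Laplacian with the adjacency matrix and the degrees
  replaced by their expectations.\<close>

definition mean_Lsym :: "nat \<Rightarrow> (nat \<Rightarrow> nat) \<Rightarrow> real \<Rightarrow> real mat" where
  "mean_Lsym n cl q = mat n n (\<lambda>(i, j). if i = j then 1 else if cl i = cl j then - q else q)"

lemma block_mat_carrier [simp]: "block_mat n k cl q \<in> carrier_mat k k"
  by (simp add: block_mat_def)

lemma mean_Lsym_carrier [simp]: "mean_Lsym n cl q \<in> carrier_mat n n"
  by (simp add: mean_Lsym_def)

lemma Theta_mat_carrier [simp]: "Theta_mat n k cl \<in> carrier_mat n k"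
  by (simp add: Theta_mat_def)

lemma Cbar_mat_eq:
  assumes "0 < p" "2 \<le> n"
  shows "Cbar_mat n k cl p \<eta> = (1 + (1 - 2 * \<eta>) / (real n - 1)) \<cdot>\<^sub>m 1\<^sub>m k - block_mat n k cl ((1 - 2 * \<eta>) / (real n - 1))"
  using assms by (intro eq_matI) (auto simp: Cbar_mat_def block_mat_def Let_def)

lemma Theta_orthonormal:
  assumes "valid_partition n k cl"
  shows "transpose_mat (Theta_mat n k cl) * Theta_mat n k cl = 1\<^sub>m k"
proof (rule eq_matI)
  fix a b assume "a < dim_row (1\<^sub>m k :: real mat)" "b < dim_col (1\<^sub>m k :: real mat)"
  then have ab: "a < k" "b < k" by auto
  have "(transpose_mat (Theta_mat n k cl) * Theta_mat n k cl) $$ (a, b)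
    = (\<Sum>j<n. (if cl j = a then 1 / sqrt (real (csize n cl a)) else 0) * (if cl j = b then 1 / sqrt (real (csize n cl b)) else 0))"
    using ab by (simp add: Theta_mat_def scalar_prod_def lessThan_atLeast0)
  also have "\<dots> = (\<Sum>j\<in>{j \<in> {..<n}. cl j = a}. if a = b then 1 / real (csize n cl a) else 0)"
    unfolding sum.inter_filter[OF finite_lessThan] by (intro sum.cong) auto
  also have "\<dots> = 1\<^sub>m k $$ (a, b)"
  proof -
    have "card {j \<in> {..<n}. cl j = a} = csize n cl a" by (simp add: csize_def)
    then show ?thesis using csize_pos[OF assms ab(1)] ab by auto
  qed
  finally show "(transpose_mat (Theta_mat n k cl) * Theta_mat n k cl) $$ (a, b) = 1\<^sub>m k $$ (a, b)" .
qed (auto simp: Theta_mat_def)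

lemma Theta_mult_vec:
  assumes "valid_partition n k cl" "h \<in> carrier_vec k" "j < n"
  shows "(Theta_mat n k cl *\<^sub>v h) $ j = h $ cl j / sqrt (real (csize n cl (cl j)))"
proof -
  have "cl j < k" using assms by (simp add: valid_partition_def)
  have "(Theta_mat n k cl *\<^sub>v h) $ j = (\<Sum>i\<in>{0..<k}. (if cl j = i then 1 / sqrt (real (csize n cl i)) else 0) * h $ i)"
    using assms by (simp add: Theta_mat_def scalar_prod_def)
  also have "\<dots> = (\<Sum>i\<in>{0..<k}. if cl j = i then h $ i / sqrt (real (csize n cl i)) else 0)"
    by (intro sum.cong) auto
  finally show ?thesis using \<open>cl j < k\<close> by simp
qed

text \<open>\<open>\<Theta> B \<Theta>\<^sup>T\<close> has entries \<open>q\<close> within and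
  \<open>- q\<close> across clusters, and also \<open>q\<close> on the diagonal; the scalar
  \<open>1 + q\<close> restores the diagonal entry 1.\<close>

lemma mean_Lsym_mult_vec:
  assumes P: "valid_partition n k cl" and x: "x \<in> carrier_vec n"
  shows "mean_Lsym n cl q *\<^sub>v x = (1 + q) \<cdot>\<^sub>v x -
    Theta_mat n k cl *\<^sub>v (block_mat n k cl q *\<^sub>v (transpose_mat (Theta_mat n k cl) *\<^sub>v x))"
proof (rule eq_vecI)
  let ?g = "transpose_mat (Theta_mat n k cl) *\<^sub>v x" and ?c = "\<lambda>i. real (csize n cl i)"
  have gc: "?g \<in> carrier_vec k" by (rule mult_mat_vec_carrier[OF _ x]) simp
  have Bg: "block_mat n k cl q *\<^sub>v ?g \<in> carrier_vec k" by (rule mult_mat_vec_carrier[OF block_mat_carrier gc])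
  fix j assume "j < dim_vec ((1 + q) \<cdot>\<^sub>v x - Theta_mat n k cl *\<^sub>v (block_mat n k cl q *\<^sub>v ?g))"
  then have j: "j < n" by (simp add: Theta_mat_def)
  have cj: "cl i < k" if "i < n" for i using P that by (simp add: valid_partition_def)
  have cp: "0 < ?c (cl i)" if "i < n" for i using csize_pos[OF P cj[OF that]] by simp
  have g: "?g $ a = (\<Sum>i<n. if cl i = a then x $ i / sqrt (?c a) else 0)" if "a < k" for a
    using that x by (auto simp: Theta_mat_def scalar_prod_def lessThan_atLeast0 intro!: sum.cong)
  have "(block_mat n k cl q *\<^sub>v ?g) $ cl j = (\<Sum>a<k. block_mat n k cl q $$ (cl j, a) * ?g $ a)"
    by (rule mult_mat_vec_index[OF block_mat_carrier gc cj[OF j]])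
  also have "\<dots> = (\<Sum>a<k. \<Sum>i<n. if cl i = a then block_mat n k cl q $$ (cl j, a) * (x $ i / sqrt (?c a)) else 0)"
    by (intro sum.cong[OF refl]) (simp add: g sum_distrib_left if_distrib[of "\<lambda>z. _ * z"] cong: if_cong)
  also have "\<dots> = (\<Sum>i<n. \<Sum>a<k. if cl i = a then block_mat n k cl q $$ (cl j, a) * (x $ i / sqrt (?c a)) else 0)"
    by (rule sum.swap)
  also have "\<dots> = (\<Sum>i<n. block_mat n k cl q $$ (cl j, cl i) * (x $ i / sqrt (?c (cl i))))"
    using cj by (intro sum.cong[OF refl]) simp
  also have "\<dots> = (\<Sum>i<n. sqrt (?c (cl j)) * (if cl i = cl j then q else - q) * x $ i)"
  proof (rule sum.cong[OF refl])
    fix i assume "i \<in> {..<n}"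
    then have i: "i < n" by simp
    show "block_mat n k cl q $$ (cl j, cl i) * (x $ i / sqrt (?c (cl i))) = sqrt (?c (cl j)) * (if cl i = cl j then q else - q) * x $ i"
    proof (cases "cl i = cl j")
      case True
      then show ?thesis using cj[OF j] cp[OF j] by (simp add: block_mat_def real_div_sqrt field_simps)
    next
      case False
      then show ?thesis using cj[OF j] cj[OF i] cp[OF i] by (simp add: block_mat_def real_sqrt_mult)
    qed
  qed
  finally have "(Theta_mat n k cl *\<^sub>v (block_mat n k cl q *\<^sub>v ?g)) $ j = (\<Sum>i<n. (if cl i = cl j then q else - q) * x $ i)"
    unfolding Theta_mult_vec[OF P Bg j] using cp[OF j] by (simp add: mult.assoc flip: sum_distrib_left)
  then have "((1 + q) \<cdot>\<^sub>v x - Theta_mat n k cl *\<^sub>v (block_mat n k cl q *\<^sub>v ?g)) $ j =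
      (1 + q) * x $ j - (\<Sum>i<n. (if cl i = cl j then q else - q) * x $ i)"
    using j x by (simp add: Theta_mat_def)
  also have "(1 + q) * x $ j = (\<Sum>i<n. if i = j then (1 + q) * x $ i else 0)" using j by simp
  also have "\<dots> - (\<Sum>i<n. (if cl i = cl j then q else - q) * x $ i) = (\<Sum>i<n. mean_Lsym n cl q $$ (j, i) * x $ i)"
    unfolding sum_subtractf[symmetric] using j by (intro sum.cong) (auto simp: mean_Lsym_def algebra_simps)
  also have "\<dots> = (mean_Lsym n cl q *\<^sub>v x) $ j"
    using j x by (simp add: mean_Lsym_def scalar_prod_def lessThan_atLeast0)
  finally show "(mean_Lsym n cl q *\<^sub>v x) $ j = ((1 + q) \<cdot>\<^sub>v x - Theta_mat n k cl *\<^sub>v (block_mat n k cl q *\<^sub>v ?g)) $ j"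
    by simp
qed (auto simp: mean_Lsym_def Theta_mat_def)

lemma block_mat_form:
  assumes g: "g \<in> carrier_vec k"
  shows "g \<bullet> (block_mat n k cl q *\<^sub>v g) =
    q * (2 * (\<Sum>i<k. real (csize n cl i) * (g $ i)\<^sup>2) - (\<Sum>i<k. sqrt (real (csize n cl i)) * g $ i)\<^sup>2)"
proof -
  let ?c = "\<lambda>i. real (csize n cl i)"
  have "g \<bullet> (block_mat n k cl q *\<^sub>v g) = (\<Sum>i<k. \<Sum>j<k. g $ i * (block_mat n k cl q $$ (i, j) * g $ j))"
    using g by (simp add: scalar_prod_def lessThan_atLeast0 block_mat_def sum_distrib_left)
  also have "\<dots> = (\<Sum>i<k. \<Sum>j<k. (if j = i then 2 * q * (?c j * (g $ j)\<^sup>2) else 0)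
      - q * ((sqrt (?c i) * g $ i) * (sqrt (?c j) * g $ j)))"
    by (intro sum.cong) (auto simp: block_mat_def real_sqrt_mult power2_eq_square algebra_simps)
  also have "\<dots> = (\<Sum>i<k. 2 * q * (?c i * (g $ i)\<^sup>2)) - q * (\<Sum>i<k. \<Sum>j<k. (sqrt (?c i) * g $ i) * (sqrt (?c j) * g $ j))"
    by (simp add: sum_subtractf sum_distrib_left)
  also have "(\<Sum>i<k. \<Sum>j<k. (sqrt (?c i) * g $ i) * (sqrt (?c j) * g $ j)) = (\<Sum>i<k. sqrt (?c i) * g $ i)\<^sup>2"
    unfolding power2_eq_square sum_product ..
  finally show ?thesis by (simp add: algebra_simps sum_distrib_left)
qed

section \<open>Eigenvalue bounds for the small matrix and their lifting\<close>

lemma spectral_form_le: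
  assumes U: "orthogonal_mat N U" and y: "y \<in> carrier_vec N"
    and le: "\<And>i. i < N \<Longrightarrow> (transpose_mat U *\<^sub>v y) $ i \<noteq> 0 \<Longrightarrow> lam i \<le> b"
  shows "y \<bullet> (U * diag_of N lam * transpose_mat U *\<^sub>v y) \<le> b * (euclid_norm y)\<^sup>2"
  unfolding spectral_form(1)[OF U y] spectral_form(2)[OF U y, symmetric] sum_distrib_left
proof (rule sum_mono)
  fix i assume "i \<in> {..<N}"
  then show "lam i * ((transpose_mat U *\<^sub>v y) $ i)\<^sup>2 \<le> b * ((transpose_mat U *\<^sub>v y) $ i)\<^sup>2"
    using le[of i] by (cases "(transpose_mat U *\<^sub>v y) $ i = 0") (auto intro: mult_right_mono)
qed

lemma spectral_form_ge:
  assumes U: "orthogonal_mat N U" and y: "y \<in> carrier_vec N"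
    and ge: "\<And>i. i < N \<Longrightarrow> (transpose_mat U *\<^sub>v y) $ i \<noteq> 0 \<Longrightarrow> b \<le> lam i"
  shows "b * (euclid_norm y)\<^sup>2 \<le> y \<bullet> (U * diag_of N lam * transpose_mat U *\<^sub>v y)"
  unfolding spectral_form(1)[OF U y] spectral_form(2)[OF U y, symmetric] sum_distrib_left
proof (rule sum_mono)
  fix i assume "i \<in> {..<N}"
  then show "b * ((transpose_mat U *\<^sub>v y) $ i)\<^sup>2 \<le> lam i * ((transpose_mat U *\<^sub>v y) $ i)\<^sup>2"
    using ge[of i] by (cases "(transpose_mat U *\<^sub>v y) $ i = 0") (auto intro: mult_right_mono)
qed

lemma shifted_mult_vec:
  assumes "(B :: real mat) \<in> carrier_mat k k" "g \<in> carrier_vec k"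
  shows "(\<alpha> \<cdot>\<^sub>m 1\<^sub>m k - B) *\<^sub>v g = \<alpha> \<cdot>\<^sub>v g - B *\<^sub>v g"
proof -
  have "(\<alpha> \<cdot>\<^sub>m 1\<^sub>m k) *\<^sub>v g = \<alpha> \<cdot>\<^sub>v g"
    using assms(2)
    by (intro eq_vecI) (auto simp: scalar_prod_def if_distrib[of "\<lambda>z. _ * z"] if_distrib[of "\<lambda>z. z * _"] cong: if_cong)
  then show ?thesis
    using minus_mult_distrib_mat_vec[of "\<alpha> \<cdot>\<^sub>m 1\<^sub>m k" k k B g] assms by simp
qed

lemma shifted_form:
  assumes "(B :: real mat) \<in> carrier_mat k k" "g \<in> carrier_vec k"
  shows "g \<bullet> ((\<alpha> \<cdot>\<^sub>m 1\<^sub>m k - B) *\<^sub>v g) = \<alpha> * (euclid_norm g)\<^sup>2 - g \<bullet> (B *\<^sub>v g)"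
proof -
  have "B *\<^sub>v g \<in> carrier_vec k" by (rule mult_mat_vec_carrier[OF assms])
  then show ?thesis unfolding shifted_mult_vec[OF assms]
    using scalar_prod_minus_distrib[OF assms(2), of "\<alpha> \<cdot>\<^sub>v g" "B *\<^sub>v g"] assms(2) by (simp add: euclid_norm_sq)
qed

text \<open>A nonzero \<open>y\<close> can satisfy \<open>k - 1\<close> conditions: orthogonality to
  the first \<open>k - 2\<close> eigenvectors and to \<nu>. On such \<open>y\<close> the rank-one
  part vanishes, and the diagonal part has entries \<open>1 + q - 2 q n\<^sub>i\<close>. Indices
  start at 0, so \<open>\<mu> (k - 2)\<close> is the last of the \<open>k - 1\<close> smallest
  eigenvalues.\<close>

lemma Cbar_second_largest_le:
  assumes k: "2 \<le> k" and q: "0 \<le> q"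
    and U: "orthogonal_mat k U" and mono: "\<forall>i j. i \<le> j \<longrightarrow> j < k \<longrightarrow> \<mu> i \<le> \<mu> j"
    and eq: "(1 + q) \<cdot>\<^sub>m 1\<^sub>m k - block_mat n k cl q = U * diag_of k \<mu> * transpose_mat U"
    and smin: "\<And>i. i < k \<Longrightarrow> smin \<le> real (csize n cl i)"
  shows "\<mu> (k - 2) \<le> 1 + q - 2 * q * smin"
proof -
  define \<nu> where "\<nu> i = sqrt (real (csize n cl i))" for i
  have Uc: "U \<in> carrier_mat k k" by (rule orthogonal_matD[OF U])
  have Ut: "transpose_mat U \<in> carrier_mat k k" using Uc by simp
  define Z where "Z = mat (k - 1) k (\<lambda>(i, j). if i < k - 2 then transpose_mat U $$ (i, j) else \<nu> j)"
  have Z: "Z \<in> carrier_mat (k - 1) k" by (simp add: Z_def)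
  obtain y where y: "y \<in> carrier_vec k" "y \<noteq> 0\<^sub>v k" "Z *\<^sub>v y = 0\<^sub>v (k - 1)"
    using exists_kernel_vector[OF Z] k by auto
  have y0: "(transpose_mat U *\<^sub>v y) $ i = 0" if i: "i < k - 2" for i
  proof -
    have "(transpose_mat U *\<^sub>v y) $ i = (Z *\<^sub>v y) $ i"
      using mult_mat_vec_index[OF Ut y(1), of i] mult_mat_vec_index[OF Z y(1), of i] i
      by (simp add: Z_def)
    then show ?thesis using y(3) i by simp
  qed
  have "(\<Sum>i<k. \<nu> i * y $ i) = (Z *\<^sub>v y) $ (k - 2)"
    using mult_mat_vec_index[OF Z y(1), of "k - 2"] k by (simp add: Z_def)
  then have y\<nu>: "(\<Sum>i<k. \<nu> i * y $ i) = 0" using y(3) k by simp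
  have npos: "0 < (euclid_norm y)\<^sup>2" using y euclid_norm_eq_0_iff[OF y(1)] by simp
  have "\<mu> (k - 2) * (euclid_norm y)\<^sup>2 \<le> y \<bullet> (U * diag_of k \<mu> * transpose_mat U *\<^sub>v y)"
    by (rule spectral_form_ge[OF U y(1)]) (use y0 mono in \<open>auto simp: not_less[symmetric]\<close>)
  also have "\<dots> = (1 + q) * (euclid_norm y)\<^sup>2 - q * (2 * (\<Sum>i<k. real (csize n cl i) * (y $ i)\<^sup>2))"
    unfolding eq[symmetric] shifted_form[OF block_mat_carrier y(1)] block_mat_form[OF y(1)]
    using y\<nu> by (simp add: \<nu>_def)
  also have "\<dots> \<le> (1 + q) * (euclid_norm y)\<^sup>2 - q * (2 * (smin * (euclid_norm y)\<^sup>2))"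
  proof -
    have "smin * (euclid_norm y)\<^sup>2 = (\<Sum>i<k. smin * (y $ i)\<^sup>2)"
      using y(1) by (simp add: euclid_norm_def sum_nonneg sum_distrib_left)
    also have "\<dots> \<le> (\<Sum>i<k. real (csize n cl i) * (y $ i)\<^sup>2)"
      by (intro sum_mono mult_right_mono smin) auto
    finally show ?thesis using q by (intro diff_mono mult_left_mono) auto
  qed
  finally have "\<mu> (k - 2) * (euclid_norm y)\<^sup>2 \<le> (1 + q - 2 * q * smin) * (euclid_norm y)\<^sup>2"
    by (simp add: algebra_simps)
  then show ?thesis using npos by simp
qed

text \<open>The test vector is \<nu>: its squared norm is \<open>n\<close>, and the form of
  \<open>diag(n\<^sub>i)\<close> at \<nu> is the sum of the squares of the cluster sizes, at most
  \<open>smax n\<close>.\<close>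

lemma Cbar_largest_ge:
  assumes P: "valid_partition n k cl" and k: "2 \<le> k" and q: "0 \<le> q" and n: "0 < n"
    and U: "orthogonal_mat k U" and mono: "\<forall>i j. i \<le> j \<longrightarrow> j < k \<longrightarrow> \<mu> i \<le> \<mu> j"
    and eq: "(1 + q) \<cdot>\<^sub>m 1\<^sub>m k - block_mat n k cl q = U * diag_of k \<mu> * transpose_mat U"
    and smax: "\<And>i. i < k \<Longrightarrow> real (csize n cl i) \<le> smax"
  shows "1 + q - q * (2 * smax - real n) \<le> \<mu> (k - 1)"
proof -
  let ?c = "\<lambda>i. real (csize n cl i)"
  define \<nu> where "\<nu> = vec k (\<lambda>i. sqrt (?c i))"
  have \<nu>: "\<nu> \<in> carrier_vec k" by (simp add: \<nu>_def)
  have sum: "(\<Sum>i<k. ?c i) = real n" using sum_csize[OF P] by (simp flip: of_nat_sum)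
  have n\<nu>: "(euclid_norm \<nu>)\<^sup>2 = real n"
    using sum by (simp add: \<nu>_def euclid_norm_def sum_nonneg)
  have "(\<Sum>i<k. ?c i * (\<nu> $ i)\<^sup>2) \<le> (\<Sum>i<k. smax * ?c i)"
    by (intro sum_mono) (auto simp: \<nu>_def intro: mult_right_mono smax)
  also have "\<dots> = smax * real n" by (simp add: sum flip: sum_distrib_left)
  finally have s1: "(\<Sum>i<k. ?c i * (\<nu> $ i)\<^sup>2) \<le> smax * real n" .
  have s2: "(\<Sum>i<k. sqrt (?c i) * \<nu> $ i) = real n" using sum by (simp add: \<nu>_def)
  have "(1 + q) * real n - q * (2 * (smax * real n) - (real n)\<^sup>2)
      \<le> (1 + q) * real n - q * (2 * (\<Sum>i<k. ?c i * (\<nu> $ i)\<^sup>2) - (real n)\<^sup>2)"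
    using s1 q by (intro diff_mono mult_left_mono) auto
  also have "\<dots> = \<nu> \<bullet> (U * diag_of k \<mu> * transpose_mat U *\<^sub>v \<nu>)"
    unfolding eq[symmetric] shifted_form[OF block_mat_carrier \<nu>] block_mat_form[OF \<nu>] n\<nu> s2 ..
  also have "\<dots> \<le> \<mu> (k - 1) * (euclid_norm \<nu>)\<^sup>2"
    by (rule spectral_form_le[OF U \<nu>]) (use mono k in auto)
  finally have "real n * (1 + q - q * (2 * smax - real n)) \<le> real n * \<mu> (k - 1)"
    unfolding n\<nu> by (simp add: algebra_simps power2_eq_square)
  then show ?thesis using n by simp
qed

text \<open>The population Laplacian acts as \<open>C\<close> on the range of \<Theta> and as the
  scalar \<open>1 + q\<close> on its complement. This transports estimates from dimension
  \<open>k\<close> to dimension \<open>n\<close>.\<close>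

lemma mean_Lsym_form:
  fixes q :: real
  assumes P: "valid_partition n k cl" and x: "x \<in> carrier_vec n"
  defines "g \<equiv> transpose_mat (Theta_mat n k cl) *\<^sub>v x" and "C \<equiv> (1 + q) \<cdot>\<^sub>m 1\<^sub>m k - block_mat n k cl q"
  shows "x \<bullet> (mean_Lsym n cl q *\<^sub>v x) = g \<bullet> (C *\<^sub>v g) + (1 + q) * ((euclid_norm x)\<^sup>2 - (euclid_norm g)\<^sup>2)"
    and "transpose_mat (Theta_mat n k cl) *\<^sub>v (mean_Lsym n cl q *\<^sub>v x) = C *\<^sub>v g"
    and "euclid_norm g \<le> euclid_norm x"
proof -
  let ?T = "Theta_mat n k cl" and ?B = "block_mat n k cl q"
  have T: "?T \<in> carrier_mat n k" "transpose_mat ?T \<in> carrier_mat k n" by auto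
  have g: "g \<in> carrier_vec k" unfolding g_def by (rule mult_mat_vec_carrier[OF T(2) x])
  have Bg: "?B *\<^sub>v g \<in> carrier_vec k" by (rule mult_mat_vec_carrier[OF block_mat_carrier g])
  have TBg: "?T *\<^sub>v (?B *\<^sub>v g) \<in> carrier_vec n" by (rule mult_mat_vec_carrier[OF T(1) Bg])
  have Tg: "?T *\<^sub>v g \<in> carrier_vec n" by (rule mult_mat_vec_carrier[OF T(1) g])
  have ax: "(1 + q) \<cdot>\<^sub>v x \<in> carrier_vec n" using x by simp
  have Lx: "mean_Lsym n cl q *\<^sub>v x = (1 + q) \<cdot>\<^sub>v x - ?T *\<^sub>v (?B *\<^sub>v g)"
    unfolding g_def by (rule mean_Lsym_mult_vec[OF P x])
  have "x \<bullet> (mean_Lsym n cl q *\<^sub>v x) = (1 + q) * (x \<bullet> x) - x \<bullet> (?T *\<^sub>v (?B *\<^sub>v g))"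
    unfolding Lx scalar_prod_minus_distrib[OF x ax TBg] using x by simp
  also have "x \<bullet> (?T *\<^sub>v (?B *\<^sub>v g)) = g \<bullet> (?B *\<^sub>v g)"
    unfolding g_def[symmetric] using transpose_vec_mult_scalar[OF T(1) Bg x] by (simp add: g_def)
  finally show "x \<bullet> (mean_Lsym n cl q *\<^sub>v x) = g \<bullet> (C *\<^sub>v g) + (1 + q) * ((euclid_norm x)\<^sup>2 - (euclid_norm g)\<^sup>2)"
    unfolding C_def shifted_form[OF block_mat_carrier g] by (simp add: euclid_norm_sq algebra_simps)
  have "transpose_mat ?T *\<^sub>v (?T *\<^sub>v (?B *\<^sub>v g)) = ?B *\<^sub>v g"
    using assoc_mult_mat_vec[OF T(2) T(1) Bg] Theta_orthonormal[OF P] Bg by simp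
  then show "transpose_mat ?T *\<^sub>v (mean_Lsym n cl q *\<^sub>v x) = C *\<^sub>v g"
    unfolding Lx mult_minus_distrib_mat_vec[OF T(2) ax TBg] C_def shifted_mult_vec[OF block_mat_carrier g]
      mult_mat_vec[OF T(2) x] by (simp add: g_def)
  have "euclid_norm g * euclid_norm g = (?T *\<^sub>v g) \<bullet> x"
    using scalar_prod_mult_transpose[OF T(1) g x] by (simp add: g_def euclid_norm_sq flip: power2_eq_square)
  also have "\<dots> \<le> euclid_norm (?T *\<^sub>v g) * euclid_norm x" using abs_scalar_prod_le[OF Tg x] by simp
  also have "euclid_norm (?T *\<^sub>v g) = euclid_norm g" by (rule euclid_norm_isometry[OF T(1) Theta_orthonormal[OF P] g])
  finally show "euclid_norm g \<le> euclid_norm x" by (rule mult_left_le_nonneg_cancel) auto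
qed

lemma mean_Lsym_symmetric: "transpose_mat (mean_Lsym n cl q) = mean_Lsym n cl q"
  by (intro eq_matI) (auto simp: mean_Lsym_def)

text \<open>Supplies what \<open>davis_kahan\<close> asks of the reference matrix. A vector
  orthogonal to the range of \<open>X\<close> has, inside the range of \<Theta>, only a component
  along the top eigenvector of \<open>C\<close>; hence \<open>high\<close> has to lie below both
  \<open>\<mu> (k - 1)\<close> and \<open>1 + q\<close>.\<close>

lemma population_structure:
  assumes P: "valid_partition n k cl" and k: "2 \<le> k"
    and U: "orthogonal_mat k U" and mono: "\<forall>i j. i \<le> j \<longrightarrow> j < k \<longrightarrow> \<mu> i \<le> \<mu> j"
    and eq: "(1 + q) \<cdot>\<^sub>m 1\<^sub>m k - block_mat n k cl q = U * diag_of k \<mu> * transpose_mat U"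
    and R: "R = first_cols k (k - 1) U" and X: "X = Theta_mat n k cl * R"
  shows "X \<in> carrier_mat n (k - 1)" and "transpose_mat X * X = 1\<^sub>m (k - 1)"
    and "z \<in> carrier_vec (k - 1) \<Longrightarrow> \<mu> (k - 2) \<le> low \<Longrightarrow>
      (X *\<^sub>v z) \<bullet> (mean_Lsym n cl q *\<^sub>v (X *\<^sub>v z)) \<le> low * (euclid_norm z)\<^sup>2"
    and "f \<in> carrier_vec n \<Longrightarrow> transpose_mat X *\<^sub>v f = 0\<^sub>v (k - 1) \<Longrightarrow> high \<le> \<mu> (k - 1) \<Longrightarrow> high \<le> 1 + q \<Longrightarrow>
      high * (euclid_norm f)\<^sup>2 \<le> f \<bullet> (mean_Lsym n cl q *\<^sub>v f)"
    and "f \<in> carrier_vec n \<Longrightarrow> transpose_mat X *\<^sub>v f = 0\<^sub>v (k - 1) \<Longrightarrow>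
      transpose_mat X *\<^sub>v (mean_Lsym n cl q *\<^sub>v f) = 0\<^sub>v (k - 1)"
proof -
  let ?T = "Theta_mat n k cl" and ?L = "mean_Lsym n cl q"
  define C where "C = (1 + q) \<cdot>\<^sub>m 1\<^sub>m k - block_mat n k cl q"
  have Ceq: "C = U * diag_of k \<mu> * transpose_mat U" unfolding C_def by (rule eq)
  note Uc = orthogonal_matD(1)[OF U]
  have Ut: "transpose_mat U \<in> carrier_mat k k" using Uc by simp
  have Rc: "R \<in> carrier_mat k (k - 1)" "transpose_mat R \<in> carrier_mat (k - 1) k" by (simp_all add: R)
  have T: "?T \<in> carrier_mat n k" "transpose_mat ?T \<in> carrier_mat k n" by auto
  have RR: "transpose_mat R * R = 1\<^sub>m (k - 1)" unfolding R by (rule first_cols_orthonormal[OF U]) simp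
  show Xc: "X \<in> carrier_mat n (k - 1)" unfolding X by (rule mult_carrier_mat[OF T(1) Rc(1)])
  have Xt: "transpose_mat X = transpose_mat R * transpose_mat ?T" unfolding X by (rule transpose_mult[OF T(1) Rc(1)])
  have "transpose_mat X * X = transpose_mat R * (transpose_mat ?T * (?T * R))"
    unfolding Xt unfolding X by (rule assoc_mult_mat[OF Rc(2) T(2) mult_carrier_mat[OF T(1) Rc(1)]])
  also have "transpose_mat ?T * (?T * R) = R"
    using assoc_mult_mat[OF T(2) T(1) Rc(1)] Theta_orthonormal[OF P] Rc(1) by simp
  finally show XX: "transpose_mat X * X = 1\<^sub>m (k - 1)" using RR by simp
  show "(X *\<^sub>v z) \<bullet> (?L *\<^sub>v (X *\<^sub>v z)) \<le> low * (euclid_norm z)\<^sup>2"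
    if z: "z \<in> carrier_vec (k - 1)" and low: "\<mu> (k - 2) \<le> low"
  proof -
    have Xz: "X *\<^sub>v z \<in> carrier_vec n" by (rule mult_mat_vec_carrier[OF Xc z])
    have Rz: "R *\<^sub>v z \<in> carrier_vec k" by (rule mult_mat_vec_carrier[OF Rc(1) z])
    have "transpose_mat ?T *\<^sub>v (X *\<^sub>v z) = transpose_mat ?T *\<^sub>v (?T *\<^sub>v (R *\<^sub>v z))"
      unfolding X using assoc_mult_mat_vec[OF T(1) Rc(1) z] by simp
    also have "\<dots> = R *\<^sub>v z"
      using assoc_mult_mat_vec[OF T(2) T(1) Rz] Theta_orthonormal[OF P] Rz by simp
    finally have g: "transpose_mat ?T *\<^sub>v (X *\<^sub>v z) = R *\<^sub>v z" .
    have nz: "euclid_norm (X *\<^sub>v z) = euclid_norm z" "euclid_norm (R *\<^sub>v z) = euclid_norm z"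
      by (rule euclid_norm_isometry[OF Xc XX z], rule euclid_norm_isometry[OF Rc(1) RR z])
    have "(X *\<^sub>v z) \<bullet> (?L *\<^sub>v (X *\<^sub>v z)) = (R *\<^sub>v z) \<bullet> (C *\<^sub>v (R *\<^sub>v z))"
      unfolding mean_Lsym_form(1)[OF P Xz] g nz C_def by simp
    also have "\<dots> \<le> low * (euclid_norm (R *\<^sub>v z))\<^sup>2"
      unfolding Ceq
    proof (rule spectral_form_le[OF U Rz])
      fix i assume i: "i < k" "(transpose_mat U *\<^sub>v (R *\<^sub>v z)) $ i \<noteq> 0"
      have "transpose_mat U *\<^sub>v (R *\<^sub>v z) = transpose_mat U *\<^sub>v (U *\<^sub>v pad_vec k (k - 1) z)"
        unfolding R using first_cols_mult_vec[OF Uc _ z] by simp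
      also have "\<dots> = pad_vec k (k - 1) z"
        using assoc_mult_mat_vec[OF Ut Uc pad_vec_carrier[of k "k - 1" z]] orthogonal_matD(2)[OF U] by simp
      finally have "i < k - 1" using i by (auto simp: pad_vec_def split: if_splits)
      then have "i \<le> k - 2" "k - 2 < k" using k by auto
      then show "\<mu> i \<le> low" using mono[rule_format, of i "k - 2"] low by simp
    qed
    finally show ?thesis by (simp add: nz)
  qed
  have perp: "(transpose_mat U *\<^sub>v (transpose_mat ?T *\<^sub>v f)) $ i = 0"
    if f: "f \<in> carrier_vec n" and 0: "transpose_mat X *\<^sub>v f = 0\<^sub>v (k - 1)" and i: "i < k - 1" for f i
  proof -
    have Tf: "transpose_mat ?T *\<^sub>v f \<in> carrier_vec k" by (rule mult_mat_vec_carrier[OF T(2) f])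
    have "(transpose_mat U *\<^sub>v (transpose_mat ?T *\<^sub>v f)) $ i = (transpose_mat R *\<^sub>v (transpose_mat ?T *\<^sub>v f)) $ i"
      unfolding R using transpose_first_cols_mult_vec[OF Uc _ Tf i] by simp
    also have "transpose_mat R *\<^sub>v (transpose_mat ?T *\<^sub>v f) = transpose_mat X *\<^sub>v f"
      unfolding Xt using assoc_mult_mat_vec[OF Rc(2) T(2) f] by simp
    finally show ?thesis using 0 i by simp
  qed
  show "high * (euclid_norm f)\<^sup>2 \<le> f \<bullet> (?L *\<^sub>v f)"
    if f: "f \<in> carrier_vec n" and 0: "transpose_mat X *\<^sub>v f = 0\<^sub>v (k - 1)"
      and high: "high \<le> \<mu> (k - 1)" "high \<le> 1 + q"
  proof -
    define g where "g = transpose_mat ?T *\<^sub>v f"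
    have g: "g \<in> carrier_vec k" unfolding g_def by (rule mult_mat_vec_carrier[OF T(2) f])
    have "high * (euclid_norm g)\<^sup>2 \<le> g \<bullet> (C *\<^sub>v g)"
      unfolding Ceq
    proof (rule spectral_form_ge[OF U g])
      fix i assume i: "i < k" "(transpose_mat U *\<^sub>v g) $ i \<noteq> 0"
      then have "\<not> i < k - 1" using perp[OF f 0] by (auto simp: g_def)
      then have "i = k - 1" using i by simp
      then show "high \<le> \<mu> i" using high by simp
    qed
    moreover have "high * ((euclid_norm f)\<^sup>2 - (euclid_norm g)\<^sup>2) \<le> (1 + q) * ((euclid_norm f)\<^sup>2 - (euclid_norm g)\<^sup>2)"
      using high mean_Lsym_form(3)[OF P f] by (intro mult_right_mono) (auto simp: g_def power_mono)
    ultimately show ?thesis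
      unfolding mean_Lsym_form(1)[OF P f] g_def[symmetric] C_def[symmetric] by (simp add: algebra_simps)
  qed
  show "transpose_mat X *\<^sub>v (?L *\<^sub>v f) = 0\<^sub>v (k - 1)"
    if f: "f \<in> carrier_vec n" and 0: "transpose_mat X *\<^sub>v f = 0\<^sub>v (k - 1)"
  proof (rule eq_vecI)
    define g where "g = transpose_mat ?T *\<^sub>v f"
    have g: "g \<in> carrier_vec k" unfolding g_def by (rule mult_mat_vec_carrier[OF T(2) f])
    fix i assume "i < dim_vec (0\<^sub>v (k - 1) :: real vec)"
    then have i: "i < k - 1" by simp
    have Lf: "?L *\<^sub>v f \<in> carrier_vec n" by (rule mult_mat_vec_carrier[OF mean_Lsym_carrier f])
    have Ug: "transpose_mat U *\<^sub>v g \<in> carrier_vec k" by (rule mult_mat_vec_carrier[OF Ut g])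
    have DUg: "diag_of k \<mu> *\<^sub>v (transpose_mat U *\<^sub>v g) \<in> carrier_vec k" by (rule mult_mat_vec_carrier[OF diag_of_carrier Ug])
    have "transpose_mat X *\<^sub>v (?L *\<^sub>v f) = transpose_mat R *\<^sub>v (C *\<^sub>v g)"
      unfolding Xt using assoc_mult_mat_vec[OF Rc(2) T(2) Lf] mean_Lsym_form(2)[OF P f] by (simp add: g_def C_def)
    also have Cg: "C *\<^sub>v g = U *\<^sub>v (diag_of k \<mu> *\<^sub>v (transpose_mat U *\<^sub>v g))"
      unfolding Ceq using assoc_mult_mat_vec[OF mult_carrier_mat[OF Uc diag_of_carrier] Ut g]
        assoc_mult_mat_vec[OF Uc diag_of_carrier Ug] by simp
    finally have "(transpose_mat X *\<^sub>v (?L *\<^sub>v f)) $ i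
        = (transpose_mat U *\<^sub>v (U *\<^sub>v (diag_of k \<mu> *\<^sub>v (transpose_mat U *\<^sub>v g)))) $ i"
      unfolding R using transpose_first_cols_mult_vec[OF Uc _ mult_mat_vec_carrier[OF Uc DUg] i] by simp
    also have "transpose_mat U *\<^sub>v (U *\<^sub>v (diag_of k \<mu> *\<^sub>v (transpose_mat U *\<^sub>v g))) = diag_of k \<mu> *\<^sub>v (transpose_mat U *\<^sub>v g)"
      using assoc_mult_mat_vec[OF Ut Uc DUg] orthogonal_matD(2)[OF U] DUg by simp
    also have "\<dots> $ i = \<mu> i * (transpose_mat U *\<^sub>v g) $ i" using i by (simp add: diag_of_mult_vec[OF Ug])
    finally show "(transpose_mat X *\<^sub>v (?L *\<^sub>v f)) $ i = 0\<^sub>v (k - 1) $ i"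
      using perp[OF f 0 i] i by (simp add: g_def)
  qed (use Xc in simp)
qed

text \<open>As \<open>k (2 + sqrt k) \<ge> 6\<close>, the hypothesis gives
  \<open>sqrt \<rho> \<ge> 23/24\<close> and hence \<open>smin \<ge> 3/4 smax\<close>. The first gap
  inequality then follows from \<open>n / k \<le> smax\<close>, the second from
  \<open>smax \<le> n\<close> and \<open>n / k \<le> n / 2\<close>.\<close>

lemma cluster_size_gap:
  assumes P: "valid_partition n k cl" and k: "2 \<le> k" and n: "0 < n"
    and \<rho>: "sqrt (aspect_ratio n k cl) > 1 - 1 / (4 * real k * (2 + sqrt (real k)))"
  obtains smin smax where "\<And>i. i < k \<Longrightarrow> smin \<le> real (csize n cl i)" "\<And>i. i < k \<Longrightarrow> real (csize n cl i) \<le> smax"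
    "real n / real k \<le> 2 * smin" "real n / real k \<le> 2 * smin - (2 * smax - real n)"
proof -
  define smin smax where "smin = Min (csize n cl ` {..<k})" and "smax = Max (csize n cl ` {..<k})"
  have ne: "csize n cl ` {..<k} \<noteq> {}" "finite (csize n cl ` {..<k})" using k by (auto simp: lessThan_empty_iff)
  have le: "smin \<le> csize n cl i" "csize n cl i \<le> smax" if "i < k" for i
    using that ne by (auto simp: smin_def smax_def)
  have "smax \<in> csize n cl ` {..<k}" unfolding smax_def by (rule Max_in[OF ne(2,1)])
  then obtain i where i: "i < k" "smax = csize n cl i" by auto
  have smax_pos: "0 < smax" using csize_pos[OF P i(1)] i by simp
  have smax_n: "smax \<le> n" using member_le_sum[of i "{..<k}" "csize n cl"] i sum_csize[OF P] by simp
  have "(\<Sum>i<k. csize n cl i) \<le> (\<Sum>i<k. smax)" by (rule sum_mono) (use le in simp)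
  then have "n \<le> k * smax" using sum_csize[OF P] by simp
  then have nk: "real n \<le> real k * real smax" by (metis of_nat_le_iff of_nat_mult)
  have ar: "aspect_ratio n k cl = real smin / real smax"
    using n by (simp add: aspect_ratio_def smin_def smax_def)
  have "2 * 3 \<le> real k * (2 + sqrt (real k))"
    using k real_sqrt_ge_1_iff[of "real k"] by (intro mult_mono) auto
  then have "1 / (4 * (real k * (2 + sqrt (real k)))) \<le> 1 / 24" by (intro divide_left_mono) auto
  then have "1 - 1 / 24 \<le> 1 - 1 / (4 * real k * (2 + sqrt (real k)))" unfolding mult.assoc by (rule diff_left_mono)
  then have "23 / 24 \<le> sqrt (aspect_ratio n k cl)" using \<rho> by linarith
  then have "(23 / 24)\<^sup>2 \<le> (sqrt (aspect_ratio n k cl))\<^sup>2" by (intro power_mono) auto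
  also have "\<dots> = real smin / real smax" by (simp add: ar)
  finally have "(23 / 24)\<^sup>2 \<le> real smin / real smax" .
  moreover have "(3 / 4 :: real) \<le> (23 / 24)\<^sup>2" by (simp add: power2_eq_square)
  ultimately have "3 / 4 \<le> real smin / real smax" by (rule order_trans[rotated])
  then have r: "3 / 4 * real smax \<le> real smin" using smax_pos by (simp add: pos_le_divide_eq)
  have 1: "real n / real k \<le> real smax" using nk k by (simp add: divide_le_eq mult.commute)
  have 2: "real n / real k \<le> real n / 2" using k by (intro divide_left_mono) auto
  show ?thesis
  proof (rule that[of "real smin" "real smax"])
    show "real n / real k \<le> 2 * real smin" using 1 r by linarith
    show "real n / real k \<le> 2 * real smin - (2 * real smax - real n)"
      using r 2 smax_n by linarith
  qed (use le in auto)
qed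

section \<open>Expectations in the signed stochastic block model\<close>

definition pairs :: "nat \<Rightarrow> (nat \<times> nat) set" where
  "pairs n = {(j, j'). j < j' \<and> j' < n}"

definition ssbm_expect :: "nat \<Rightarrow> (nat \<Rightarrow> nat) \<Rightarrow> real \<Rightarrow> real \<Rightarrow> (real mat \<Rightarrow> real) \<Rightarrow> real" where
  "ssbm_expect n cl p \<eta> F = (\<Sum>A \<in> signed_adj n. ssbm_weight n cl p \<eta> A * F A)"

lemma finite_pairs [simp]: "finite (pairs n)"
  by (rule finite_subset[of _ "{..<n} \<times> {..<n}"]) (auto simp: pairs_def)

lemma signed_adj_sym: "A \<in> signed_adj n \<Longrightarrow> i < n \<Longrightarrow> j < n \<Longrightarrow> A $$ (i, j) = A $$ (j, i)"
  by (auto simp: signed_adj_def)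

lemma signed_adj_diag: "A \<in> signed_adj n \<Longrightarrow> i < n \<Longrightarrow> A $$ (i, i) = 0"
  by (simp add: signed_adj_def)

lemma signed_adj_entry:
  "A \<in> signed_adj n \<Longrightarrow> i < n \<Longrightarrow> j < n \<Longrightarrow> A $$ (i, j) = -1 \<or> A $$ (i, j) = 0 \<or> A $$ (i, j) = 1"
  by (simp add: signed_adj_def)

lemma signed_adj_carrier: "A \<in> signed_adj n \<Longrightarrow> A \<in> carrier_mat n n"
  by (simp add: signed_adj_def)

text \<open>A signed adjacency matrix is determined by its strict upper triangle. The four clauses
  have the shape that reindexing a sum along a bijection requires.\<close>

lemma signed_adj_bij_witness:
  fixes n :: nat
  defines "f \<equiv> \<lambda>g. mat n n (\<lambda>(i, j). if i < j then g (i, j) else if j < i then g (j, i) else (0::real))"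
    and "h \<equiv> \<lambda>A. restrict (\<lambda>e. A $$ e) (pairs n)"
  shows "A \<in> signed_adj n \<Longrightarrow> f (h A) = A"
    and "A \<in> signed_adj n \<Longrightarrow> h A \<in> PiE (pairs n) (\<lambda>_. {-1, 0, 1})"
    and "g \<in> PiE (pairs n) (\<lambda>_. {-1, 0, 1}) \<Longrightarrow> h (f g) = g"
    and "g \<in> PiE (pairs n) (\<lambda>_. {-1, 0, 1}) \<Longrightarrow> f g \<in> signed_adj n"
proof -
  show "f (h A) = A" if "A \<in> signed_adj n"
  proof (rule eq_matI)
    show "dim_row (f (h A)) = dim_row A" "dim_col (f (h A)) = dim_col A"
      using signed_adj_carrier[OF that] by (auto simp: f_def)
    fix i j assume "i < dim_row A" "j < dim_col A"
    then have ij: "i < n" "j < n" using signed_adj_carrier[OF that] by auto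
    show "f (h A) $$ (i, j) = A $$ (i, j)"
    proof (cases i j rule: linorder_cases)
      case less
      then show ?thesis using ij by (simp add: f_def h_def pairs_def)
    next
      case equal
      then show ?thesis using ij signed_adj_diag[OF that, of i] by (simp add: f_def)
    next
      case greater
      then show ?thesis using ij signed_adj_sym[OF that, of i j] by (simp add: f_def h_def pairs_def)
    qed
  qed
  show "h A \<in> PiE (pairs n) (\<lambda>_. {-1, 0, 1})" if "A \<in> signed_adj n"
  proof -
    have "A $$ e \<in> {-1, 0, 1}" if "e \<in> pairs n" for e
      using signed_adj_entry[OF \<open>A \<in> _\<close>, of "fst e" "snd e"] that by (auto simp: pairs_def)
    then show ?thesis by (auto simp: h_def)
  qed
  show "h (f g) = g" if "g \<in> PiE (pairs n) (\<lambda>_. {-1, 0, 1})"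
  proof
    fix e show "h (f g) e = g e"
      using that by (cases e) (auto simp: h_def f_def pairs_def PiE_def extensional_def)
  qed
  show "f g \<in> signed_adj n" if "g \<in> PiE (pairs n) (\<lambda>_. {-1, 0, 1})"
  proof -
    have *: "g e \<in> {-1, 0, 1}" if "e \<in> pairs n" for e
      using PiE_mem[OF \<open>g \<in> _\<close> that] .
    have "f g $$ (i, j) \<in> {-1, 0, 1} \<and> f g $$ (i, j) = f g $$ (j, i)" if "i < n" "j < n" for i j
      using that *[of "(i, j)"] *[of "(j, i)"] by (auto simp: f_def pairs_def)
    moreover have "f g \<in> carrier_mat n n" "\<And>i. i < n \<Longrightarrow> f g $$ (i, i) = 0"
      by (auto simp: f_def)
    ultimately show ?thesis unfolding signed_adj_def by blast
  qed
qed

lemma finite_signed_adj [simp]: "finite (signed_adj n)"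
proof -
  have "inj_on (\<lambda>A. restrict (\<lambda>e. A $$ e) (pairs n)) (signed_adj n)"
    by (rule inj_on_inverseI, erule signed_adj_bij_witness(1))
  moreover have "(\<lambda>A. restrict (\<lambda>e. A $$ e) (pairs n)) ` signed_adj n \<subseteq> PiE (pairs n) (\<lambda>_. {-1, 0, 1})"
    using signed_adj_bij_witness(2) by blast
  ultimately show ?thesis
    by (meson finite_PiE finite.intros finite_pairs finite_subset inj_on_finite)
qed

text \<open>Independence of the entries: the weight is a product over pairs, so after reindexing by
  functions on pairs the sum of products is the expansion of a product of sums.\<close>

lemma ssbm_expect_prod:
  "ssbm_expect n cl p \<eta> (\<lambda>A. \<Prod>e\<in>pairs n. g e (A $$ e)) =
    (\<Prod>e\<in>pairs n. \<Sum>a\<in>{-1, 0, 1}. ssbm_entry_prob cl p \<eta> (fst e) (snd e) a * g e a)"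
proof -
  have "ssbm_expect n cl p \<eta> (\<lambda>A. \<Prod>e\<in>pairs n. g e (A $$ e)) =
      (\<Sum>A\<in>signed_adj n. \<Prod>e\<in>pairs n. ssbm_entry_prob cl p \<eta> (fst e) (snd e) (A $$ e) * g e (A $$ e))"
    unfolding ssbm_expect_def ssbm_weight_def pairs_def prod.distrib by (simp add: case_prod_unfold)
  also have "\<dots> = (\<Sum>a\<in>PiE (pairs n) (\<lambda>_. {-1, 0, 1}).
       \<Prod>e\<in>pairs n. ssbm_entry_prob cl p \<eta> (fst e) (snd e) (a e) * g e (a e))"
    by (rule sum.reindex_bij_witness, erule signed_adj_bij_witness, erule signed_adj_bij_witness,
        erule signed_adj_bij_witness, erule signed_adj_bij_witness, rule prod.cong) auto
  also have "\<dots> = (\<Prod>e\<in>pairs n. \<Sum>a\<in>{-1, 0, 1}. ssbm_entry_prob cl p \<eta> (fst e) (snd e) a * g e a)"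
    by (rule prod_sum_PiE[symmetric]) auto
  finally show ?thesis .
qed

lemma entry_expect:
  "(\<Sum>a\<in>{-1, 0, 1::real}. ssbm_entry_prob cl p \<eta> j j' a * g a) =
    (let s = (if cl j = cl j' then 1 else -1) in (1 - p) * g 0 + p * (1 - \<eta>) * g s + p * \<eta> * g (- s))"
  by (auto simp: ssbm_entry_prob_def Let_def)

lemma ssbm_expect_const: "ssbm_expect n cl p \<eta> (\<lambda>_. c) = c"
proof -
  have "ssbm_expect n cl p \<eta> (\<lambda>A. \<Prod>e\<in>pairs n. 1) = 1"
    unfolding ssbm_expect_prod[where g = "\<lambda>_ _. 1"] entry_expect by (simp add: Let_def algebra_simps)
  then show ?thesis
    by (simp add: ssbm_expect_def flip: sum_distrib_right)
qed

lemma ssbm_expect_sum: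
  "ssbm_expect n cl p \<eta> (\<lambda>A. \<Sum>i\<in>I. F i A) = (\<Sum>i\<in>I. ssbm_expect n cl p \<eta> (F i))"
  unfolding ssbm_expect_def sum_distrib_left by (rule sum.swap)

lemma ssbm_expect_add:
  "ssbm_expect n cl p \<eta> (\<lambda>A. F A + G A) = ssbm_expect n cl p \<eta> F + ssbm_expect n cl p \<eta> G"
  by (simp add: ssbm_expect_def algebra_simps sum.distrib)

lemma ssbm_expect_diff:
  "ssbm_expect n cl p \<eta> (\<lambda>A. F A - G A) = ssbm_expect n cl p \<eta> F - ssbm_expect n cl p \<eta> G"
  by (simp add: ssbm_expect_def algebra_simps sum_subtractf)

lemma ssbm_expect_cmult:
  "ssbm_expect n cl p \<eta> (\<lambda>A. c * F A) = c * ssbm_expect n cl p \<eta> F"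
  by (simp add: ssbm_expect_def sum_distrib_left algebra_simps)

lemma ssbm_weight_nonneg:
  "0 \<le> p \<Longrightarrow> p \<le> 1 \<Longrightarrow> 0 \<le> \<eta> \<Longrightarrow> \<eta> \<le> 1 \<Longrightarrow> 0 \<le> ssbm_weight n cl p \<eta> A"
  unfolding ssbm_weight_def by (rule prod_nonneg) (auto simp: ssbm_entry_prob_def Let_def)

text \<open>Markov's inequality and the union bound in one: \<open>F\<close> dominates the indicator
  of the bad event, so all failure modes can be added up inside a single \<open>F\<close>.\<close>

lemma ssbm_prob_ge:
  assumes "0 \<le> p" "p \<le> 1" "0 \<le> \<eta>" "\<eta> \<le> 1"
    and nonneg: "\<And>A. A \<in> signed_adj n \<Longrightarrow> 0 \<le> F A"
    and bad: "\<And>A. A \<in> signed_adj n \<Longrightarrow> A \<notin> E \<Longrightarrow> 1 \<le> F A"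
  shows "ssbm_prob n cl p \<eta> E \<ge> 1 - ssbm_expect n cl p \<eta> F"
proof -
  have "1 - ssbm_expect n cl p \<eta> F = ssbm_expect n cl p \<eta> (\<lambda>A. 1 - F A)"
    by (simp add: ssbm_expect_diff ssbm_expect_const)
  also have "\<dots> \<le> (\<Sum>A\<in>signed_adj n. if A \<in> E then ssbm_weight n cl p \<eta> A else 0)"
    unfolding ssbm_expect_def
  proof (rule sum_mono)
    fix A assume A: "A \<in> signed_adj n"
    show "ssbm_weight n cl p \<eta> A * (1 - F A) \<le> (if A \<in> E then ssbm_weight n cl p \<eta> A else 0)"
      using ssbm_weight_nonneg[OF assms(1-4), of n cl A] nonneg[OF A] bad[OF A]
      by (cases "A \<in> E") (auto simp: mult_le_0_iff intro!: mult_left_le)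
  qed
  also have "\<dots> = ssbm_prob n cl p \<eta> E"
    unfolding ssbm_prob_def by (simp add: sum.inter_restrict)
  finally show ?thesis .
qed

section \<open>Moments of the noise matrix\<close>

definition vertex_lists :: "nat \<Rightarrow> nat \<Rightarrow> nat list set" where
  "vertex_lists n L = {l. set l \<subseteq> {..<n} \<and> length l = L}"

lemma finite_vertex_lists [simp]: "finite (vertex_lists n L)"
  unfolding vertex_lists_def by (rule finite_lists_length_eq) simp

lemma vertex_lists_0 [simp]: "vertex_lists n 0 = {[]}"
  by (auto simp: vertex_lists_def)

lemma sum_vertex_lists_Suc:
  "(\<Sum>l\<in>vertex_lists n (Suc L). f l) = (\<Sum>a<n. \<Sum>l\<in>vertex_lists n L. f (a # l))"
proof -
  have "(\<Sum>l\<in>vertex_lists n (Suc L). f l) = (\<Sum>(a, l)\<in>{..<n} \<times> vertex_lists n L. f (a # l))"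
    by (rule sum.reindex_bij_witness[of _ "\<lambda>(a, l). a # l" "\<lambda>l. (hd l, tl l)"])
      (auto simp: vertex_lists_def length_Suc_conv)
  then show ?thesis by (simp add: sum.cartesian_product)
qed

text \<open>A walk is given by its start vertex and the list of the vertices that follow.\<close>

fun walk_prod :: "real mat \<Rightarrow> nat \<Rightarrow> nat list \<Rightarrow> real" where
  "walk_prod W j [] = 1"
| "walk_prod W j (a # l) = W $$ (a, j) * walk_prod W a l"

text \<open>Endpoints are sorted as in \<open>pairs\<close>, so both directions of travel count as
  the same edge. A loop yields an element outside \<open>pairs\<close>, which marks the walks that
  vanish through the zero diagonal.\<close>

fun walk_edges :: "nat \<Rightarrow> nat list \<Rightarrow> (nat \<times> nat) list" where
  "walk_edges j [] = []"
| "walk_edges j (a # l) = (min a j, max a j) # walk_edges a l"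

lemma pow_mat_index_walks:
  assumes W: "W \<in> carrier_mat n n" and "i < n" "j < n"
  shows "(W ^\<^sub>m L) $$ (i, j) =
    (\<Sum>l\<in>vertex_lists n L. if last (j # l) = i then walk_prod W j l else 0)"
  using \<open>j < n\<close>
proof (induction L arbitrary: j)
  case 0
  then show ?case using W \<open>i < n\<close> by auto
next
  case (Suc L)
  have "(W ^\<^sub>m Suc L) $$ (i, j) = (\<Sum>a<n. (W ^\<^sub>m L) $$ (i, a) * W $$ (a, j))"
    using W \<open>i < n\<close> Suc.prems pow_carrier_mat[OF W, of L]
    by (simp add: scalar_prod_def lessThan_atLeast0)
  also have "\<dots> = (\<Sum>a<n. \<Sum>l\<in>vertex_lists n L.
      if last (j # a # l) = i then walk_prod W j (a # l) else 0)"
  proof (rule sum.cong[OF refl])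
    fix a assume "a \<in> {..<n}"
    then show "(W ^\<^sub>m L) $$ (i, a) * W $$ (a, j) =
        (\<Sum>l\<in>vertex_lists n L. if last (j # a # l) = i then walk_prod W j (a # l) else 0)"
      by (simp only: Suc.IH lessThan_iff sum_distrib_right) (auto intro!: sum.cong)
  qed
  finally show ?case by (simp only: sum_vertex_lists_Suc)
qed

lemma set_walk_edges_verts: "e \<in> set (walk_edges j l) \<Longrightarrow> fst e \<in> insert j (set l) \<and> snd e \<in> insert j (set l)"
proof (induction l arbitrary: j)
  case (Cons a l)
  then consider "e = (min a j, max a j)" | "e \<in> set (walk_edges a l)" by auto
  then show ?case
    by cases (use Cons.IH in \<open>auto simp: min_def max_def\<close>)
qed simp

lemma length_walk_edges [simp]: "length (walk_edges j l) = length l"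
  by (induction j l rule: walk_edges.induct) auto

text \<open>The visited edges form a connected graph. In the induction a start vertex that never
  recurs brings an edge that never recurs.\<close>

lemma card_walk_verts_le: "card (insert j (set l)) \<le> Suc (card (set (walk_edges j l)))"
proof (induction j l rule: walk_edges.induct)
  case (2 j a l)
  show ?case
  proof (cases "j \<in> insert a (set l)")
    case True
    then have "insert j (set (a # l)) = insert a (set l)" by auto
    then have "card (insert j (set (a # l))) \<le> Suc (card (set (walk_edges a l)))"
      using 2 by simp
    also have "\<dots> \<le> Suc (card (set (walk_edges j (a # l))))"
      by (simp add: card_insert_if)
    finally show ?thesis .
  next
    case False
    have "(min a j, max a j) \<notin> set (walk_edges a l)"
      using set_walk_edges_verts[of "(min a j, max a j)" a l] False by (auto simp: min_def max_def split: if_splits)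
    then show ?thesis using 2 False by (simp add: card_insert_if)
  qed
qed simp

lemma walk_prod_eq_0:
  assumes "\<And>i. i < n \<Longrightarrow> W $$ (i, i) = 0" "l \<in> vertex_lists n L" "j < n"
    and "\<not> set (walk_edges j l) \<subseteq> pairs n"
  shows "walk_prod W j l = 0"
  using assms(2-)
proof (induction l arbitrary: j L)
  case (Cons a l)
  then show ?case
  proof (cases "a = j")
    case True
    then show ?thesis using assms(1) Cons.prems by simp
  next
    case False
    then have "(min a j, max a j) \<in> pairs n"
      using Cons.prems by (auto simp: pairs_def vertex_lists_def min_def max_def)
    then have "\<not> set (walk_edges a l) \<subseteq> pairs n" using Cons.prems by auto
    moreover have "l \<in> vertex_lists n (length l)" "a < n" using Cons.prems by (auto simp: vertex_lists_def)
    ultimately show ?thesis using Cons.IH by simp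
  qed
qed auto

lemma walk_prod_eq_prod_pairs:
  assumes sym: "\<And>i j. i < n \<Longrightarrow> j < n \<Longrightarrow> W $$ (i, j) = W $$ (j, i)"
    and "l \<in> vertex_lists n L" "j < n" "set (walk_edges j l) \<subseteq> pairs n"
  shows "walk_prod W j l = (\<Prod>e\<in>pairs n. (W $$ e) ^ count_list (walk_edges j l) e)"
  using assms(2-)
proof (induction l arbitrary: j L)
  case (Cons a l)
  let ?e = "(min a j, max a j)"
  have a: "l \<in> vertex_lists n (length l)" "a < n" using Cons.prems by (auto simp: vertex_lists_def)
  have e: "?e \<in> pairs n" using Cons.prems by simp
  have "(\<Prod>e\<in>pairs n. (W $$ e) ^ count_list (walk_edges j (a # l)) e)
      = (\<Prod>e\<in>pairs n. (if ?e = e then W $$ e else 1) * (W $$ e) ^ count_list (walk_edges a l) e)"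
    by (rule prod.cong) auto
  also have "\<dots> = W $$ ?e * walk_prod W a l"
    using e a Cons by (simp add: prod.distrib)
  also have "W $$ ?e = W $$ (a, j)"
    using sym[of a j] a Cons.prems by (simp add: min_def max_def)
  finally show ?case by simp
qed simp

text \<open>A vertex put in front of a list either occurs in it, with at most \<open>M\<close>
  choices and unchanged weight, or is new, with at most \<open>n\<close> choices and a further
  factor \<open>z\<close>. So each position costs at most \<open>n z + M\<close>.\<close>

lemma weighted_count_vertex_lists:
  fixes z :: real
  assumes "0 \<le> z"
  shows "(\<Sum>l\<in>vertex_lists n N. if card (set l) \<le> M then z ^ card (set l) else 0) \<le> (real n * z + real M) ^ N"
proof (induction N)
  case (Suc N)
  let ?g = "\<lambda>l. if card (set l) \<le> M then z ^ card (set l) else 0"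
  have step: "(\<Sum>a<n. ?g (a # l)) \<le> (real n * z + real M) * ?g l" for l :: "nat list"
  proof (cases "card (set l) \<le> M")
    case False
    then have "\<not> card (set (a # l)) \<le> M" for a
      by (simp add: card_insert_if)
    then show ?thesis using False by simp
  next
    case True
    have "(\<Sum>a<n. ?g (a # l)) \<le> (\<Sum>a<n. (if a \<in> set l then z ^ card (set l) else 0) + z * z ^ card (set l))"
      using assms by (intro sum_mono) (auto simp: card_insert_if insert_absorb)
    also have "\<dots> = real (card ({..<n} \<inter> set l)) * z ^ card (set l) + real n * (z * z ^ card (set l))"
      by (simp add: sum.distrib flip: sum.inter_restrict)
    also have "real (card ({..<n} \<inter> set l)) * z ^ card (set l) \<le> real M * z ^ card (set l)"
      using assms True card_mono[of "set l" "{..<n} \<inter> set l"] by (intro mult_right_mono) auto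
    finally show ?thesis using True by (simp add: algebra_simps)
  qed
  have "(\<Sum>l\<in>vertex_lists n (Suc N). ?g l) = (\<Sum>l\<in>vertex_lists n N. \<Sum>a<n. ?g (a # l))"
    unfolding sum_vertex_lists_Suc by (rule sum.swap)
  also have "\<dots> \<le> (\<Sum>l\<in>vertex_lists n N. (real n * z + real M) * ?g l)"
    by (rule sum_mono, rule step)
  also have "\<dots> \<le> (real n * z + real M) * (real n * z + real M) ^ N"
    unfolding sum_distrib_left[symmetric] using Suc assms by (intro mult_left_mono) auto
  finally show ?case by simp
qed simp

text \<open>Trading the constraint \<open>card (set l) \<le> M\<close> for an exponential tilt with \<open>z = M / n\<close>.\<close>

lemma tilted_count_vertex_lists:
  fixes x :: real
  assumes "0 < n" "0 < M" "real M \<le> real n * x"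
  shows "(\<Sum>l\<in>vertex_lists n N. if card (set l) \<le> M then x ^ card (set l) else 0)
    \<le> (real n * x / real M) ^ M * (2 * real M) ^ N"
proof -
  \<comment> \<open>This value makes both contributions to \<open>n z + M\<close> equal. The
    assumption \<open>M \<le> n x\<close> is \<open>z \<le> x\<close>, which makes
    \<open>(x / z)^t\<close> largest at \<open>t = M\<close>.\<close>
  define z where "z = real M / real n"
  have z: "0 < z" "z \<le> x" using assms by (auto simp: z_def field_simps)
  have "x ^ t \<le> (x / z) ^ M * z ^ t" if "t \<le> M" for t
  proof -
    have "x ^ t = (x / z) ^ t * z ^ t" using z by (simp add: power_divide)
    also have "\<dots> \<le> (x / z) ^ M * z ^ t"
      using z that by (intro mult_right_mono power_increasing) auto
    finally show ?thesis .
  qed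
  then have "(\<Sum>l\<in>vertex_lists n N. if card (set l) \<le> M then x ^ card (set l) else 0)
      \<le> (\<Sum>l\<in>vertex_lists n N. (x / z) ^ M * (if card (set l) \<le> M then z ^ card (set l) else 0))"
    by (intro sum_mono) auto
  also have "\<dots> \<le> (x / z) ^ M * (real n * z + real M) ^ N"
    unfolding sum_distrib_left[symmetric] using z
    by (intro mult_left_mono weighted_count_vertex_lists) auto
  also have "real n * z + real M = 2 * real M" using assms by (simp add: z_def)
  also have "x / z = real n * x / real M" by (simp add: z_def)
  finally show ?thesis .
qed

section \<open>Moments of the centred entries and the expected trace\<close>

definition ssbm_mean :: "(nat \<Rightarrow> nat) \<Rightarrow> real \<Rightarrow> real \<Rightarrow> nat \<Rightarrow> nat \<Rightarrow> real" where
  "ssbm_mean cl p \<eta> i j = (if i = j then 0 else (if cl i = cl j then 1 else -1) * p * (1 - 2 * \<eta>))"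

definition noise :: "nat \<Rightarrow> (nat \<Rightarrow> nat) \<Rightarrow> real \<Rightarrow> real \<Rightarrow> real mat \<Rightarrow> real mat" where
  "noise n cl p \<eta> A = mat n n (\<lambda>(i, j). A $$ (i, j) - ssbm_mean cl p \<eta> i j)"

lemma noise_carrier [simp]: "noise n cl p \<eta> A \<in> carrier_mat n n"
  by (simp add: noise_def)

lemma noise_sym: "A \<in> signed_adj n \<Longrightarrow> i < n \<Longrightarrow> j < n \<Longrightarrow> noise n cl p \<eta> A $$ (i, j) = noise n cl p \<eta> A $$ (j, i)"
  using signed_adj_sym[of A n i j] by (simp add: noise_def ssbm_mean_def)

lemma noise_diag: "A \<in> signed_adj n \<Longrightarrow> i < n \<Longrightarrow> noise n cl p \<eta> A $$ (i, i) = 0"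
  using signed_adj_diag[of A n i] by (simp add: noise_def ssbm_mean_def)

definition entry_moment :: "(nat \<Rightarrow> nat) \<Rightarrow> real \<Rightarrow> real \<Rightarrow> nat \<Rightarrow> nat \<Rightarrow> nat \<Rightarrow> real" where
  "entry_moment cl p \<eta> i j r =
    (\<Sum>a\<in>{-1, 0, 1}. ssbm_entry_prob cl p \<eta> i j a * (a - ssbm_mean cl p \<eta> i j) ^ r)"

lemma entry_moment_0: "entry_moment cl p \<eta> i j 0 = 1"
  unfolding entry_moment_def entry_expect by (simp add: Let_def algebra_simps)

lemma entry_moment_1: "i \<noteq> j \<Longrightarrow> entry_moment cl p \<eta> i j 1 = 0"
  unfolding entry_moment_def entry_expect ssbm_mean_def by (simp add: Let_def algebra_simps)

text \<open>A centred entry is at most 2 in modulus, so all but two of the \<open>r\<close> factors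
  cost 2 each; the remaining two give the second moment, which is \<open>p\<close> minus the squared
  mean.\<close>

lemma entry_moment_bound:
  assumes "0 \<le> p" "p \<le> 1" "0 \<le> \<eta>" "\<eta> \<le> 1/2" "2 \<le> r"
  shows "\<bar>entry_moment cl p \<eta> i j r\<bar> \<le> 2 ^ (r - 2) * p"
proof -
  let ?m = "ssbm_mean cl p \<eta> i j" and ?q = "ssbm_entry_prob cl p \<eta> i j"
  have q: "?q a \<ge> 0" for a using assms by (auto simp: ssbm_entry_prob_def Let_def)
  have "p * (1 - 2 * \<eta>) \<le> 1 * 1" using assms by (intro mult_mono) auto
  then have m: "\<bar>?m\<bar> \<le> 1" using assms by (auto simp: ssbm_mean_def abs_mult)
  have "\<bar>entry_moment cl p \<eta> i j r\<bar> \<le> (\<Sum>a\<in>{-1, 0, 1}. ?q a * \<bar>a - ?m\<bar> ^ r)"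
    unfolding entry_moment_def
    by (rule order_trans[OF sum_abs]) (simp add: abs_mult power_abs q)
  also have "\<dots> \<le> (\<Sum>a\<in>{-1, 0, 1}. ?q a * (2 ^ (r - 2) * (a - ?m)\<^sup>2))"
  proof (rule sum_mono)
    fix a :: real assume "a \<in> {-1, 0, 1}"
    then have a: "\<bar>a - ?m\<bar> \<le> 2" using m by auto
    have "\<bar>a - ?m\<bar> ^ r = \<bar>a - ?m\<bar> ^ (r - 2) * \<bar>a - ?m\<bar>\<^sup>2"
      using \<open>2 \<le> r\<close> by (metis le_add_diff_inverse2 power_add)
    also have "\<dots> \<le> 2 ^ (r - 2) * (a - ?m)\<^sup>2"
      unfolding power2_abs using a by (intro mult_right_mono power_mono) auto
    finally show "?q a * \<bar>a - ?m\<bar> ^ r \<le> ?q a * (2 ^ (r - 2) * (a - ?m)\<^sup>2)"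
      using q by (intro mult_left_mono)
  qed
  also have "\<dots> = 2 ^ (r - 2) * (\<Sum>a\<in>{-1, 0, 1}. ?q a * (a - ?m)\<^sup>2)"
    by (simp add: sum_distrib_left algebra_simps)
  also have "(\<Sum>a\<in>{-1, 0, 1}. ?q a * (a - ?m)\<^sup>2) \<le> p"
  proof -
    have "(\<Sum>a\<in>{-1, 0, 1}. ?q a * (a - ?m)\<^sup>2) = p - 2 * (if cl i = cl j then 1 else -1) * p * (1 - 2 * \<eta>) * ?m + ?m\<^sup>2"
      unfolding entry_expect by (simp add: Let_def algebra_simps power2_eq_square)
    also have "\<dots> = p - ?m\<^sup>2"
      by (simp add: ssbm_mean_def algebra_simps power2_eq_square)
    finally show ?thesis by simp
  qed
  finally show ?thesis by (simp add: mult_left_mono)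
qed

lemma expect_walk_prod_noise:
  assumes "l \<in> vertex_lists n L" "j < n"
  shows "ssbm_expect n cl p \<eta> (\<lambda>A. walk_prod (noise n cl p \<eta> A) j l) =
    (if set (walk_edges j l) \<subseteq> pairs n
     then \<Prod>e\<in>pairs n. entry_moment cl p \<eta> (fst e) (snd e) (count_list (walk_edges j l) e) else 0)"
proof (cases "set (walk_edges j l) \<subseteq> pairs n")
  case False
  then show ?thesis
    using walk_prod_eq_0[OF noise_diag assms False] by (simp add: ssbm_expect_def)
next
  case True
  have "ssbm_expect n cl p \<eta> (\<lambda>A. walk_prod (noise n cl p \<eta> A) j l) =
    ssbm_expect n cl p \<eta> (\<lambda>A. \<Prod>e\<in>pairs n.
      (A $$ e - ssbm_mean cl p \<eta> (fst e) (snd e)) ^ count_list (walk_edges j l) e)"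
    unfolding ssbm_expect_def
  proof (rule sum.cong[OF refl])
    fix A assume "A \<in> signed_adj n"
    then have "walk_prod (noise n cl p \<eta> A) j l =
        (\<Prod>e\<in>pairs n. (noise n cl p \<eta> A $$ e) ^ count_list (walk_edges j l) e)"
      by (intro walk_prod_eq_prod_pairs[OF noise_sym assms True])
    also have "\<dots> = (\<Prod>e\<in>pairs n.
        (A $$ e - ssbm_mean cl p \<eta> (fst e) (snd e)) ^ count_list (walk_edges j l) e)"
      by (rule prod.cong) (auto simp: noise_def pairs_def)
    finally show "ssbm_weight n cl p \<eta> A * walk_prod (noise n cl p \<eta> A) j l =
      ssbm_weight n cl p \<eta> A * (\<Prod>e\<in>pairs n.
        (A $$ e - ssbm_mean cl p \<eta> (fst e) (snd e)) ^ count_list (walk_edges j l) e)" by simp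
  qed
  then show ?thesis
    using True by (simp only: ssbm_expect_prod[where g = "\<lambda>e a. (a - ssbm_mean cl p \<eta> (fst e) (snd e)) ^ count_list (walk_edges j l) e"] entry_moment_def if_True)
qed

text \<open>In a surviving walk an edge of multiplicity \<open>c \<ge> 2\<close> costs
  \<open>2^(c - 2) p\<close>, so \<open>e\<close> edges cost \<open>4^m (p/4)^e\<close>. Since
  \<open>e \<ge> v - 1\<close> for \<open>v\<close> vertices and \<open>p/4 \<le> 1\<close>, the
  bound can be written in terms of \<open>v\<close> alone. From then on vertex lists are counted and
  edges are forgotten.\<close>

lemma expect_walk_prod_noise_le:
  assumes p: "0 < p" "p \<le> 1" and \<eta>: "0 \<le> \<eta>" "\<eta> \<le> 1/2"
    and l: "l \<in> vertex_lists n (2 * m)" and j: "j < n"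
  shows "\<bar>ssbm_expect n cl p \<eta> (\<lambda>A. walk_prod (noise n cl p \<eta> A) j l)\<bar> \<le>
    4 ^ Suc m / p * (if card (set (j # l)) \<le> Suc m then (p / 4) ^ card (set (j # l)) else 0)"
    (is "\<bar>?E\<bar> \<le> ?rhs")
proof (cases "set (walk_edges j l) \<subseteq> pairs n \<and> (\<forall>e\<in>set (walk_edges j l). count_list (walk_edges j l) e \<noteq> 1)")
  case False
  have "?E = 0"
  proof (cases "set (walk_edges j l) \<subseteq> pairs n")
    case True
    then obtain e where e: "e \<in> set (walk_edges j l)" "count_list (walk_edges j l) e = 1"
      using False by blast
    then have "e \<in> pairs n" using True by auto
    moreover have "entry_moment cl p \<eta> (fst e) (snd e) (count_list (walk_edges j l) e) = 0"
      using e \<open>e \<in> pairs n\<close> entry_moment_1[of "fst e" "snd e" cl p \<eta>] by (auto simp: pairs_def)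
    ultimately show ?thesis
      unfolding expect_walk_prod_noise[OF l j] by (auto intro!: prod_zero)
  qed (simp add: expect_walk_prod_noise[OF l j])
  moreover have "0 \<le> ?rhs" using p by simp
  ultimately show ?thesis by simp
next
  case True
  let ?es = "walk_edges j l" and ?S = "set (walk_edges j l)"
  let ?c = "count_list ?es"
  have c: "2 \<le> ?c e" if "e \<in> ?S" for e
    using True that count_list_0_iff[of ?es e] by (metis One_nat_def Suc_1 Suc_leI le_neq_implies_less less_Suc_eq_le not_less_eq_eq neq0_conv)
  have len: "(\<Sum>e\<in>?S. ?c e) = 2 * m"
    using sum_count_set[of ?es ?S] l by (simp add: vertex_lists_def)
  have "(\<Sum>e\<in>?S. 2) \<le> (\<Sum>e\<in>?S. ?c e)" by (intro sum_mono c)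
  then have em: "card ?S \<le> m" using len by simp
  have vm: "card (set (j # l)) \<le> Suc (card ?S)" using card_walk_verts_le[of j l] by simp
  have "\<bar>?E\<bar> = (\<Prod>e\<in>pairs n. \<bar>entry_moment cl p \<eta> (fst e) (snd e) (?c e)\<bar>)"
    using True by (simp add: expect_walk_prod_noise[OF l j] abs_prod)
  also have "\<dots> = (\<Prod>e\<in>?S. \<bar>entry_moment cl p \<eta> (fst e) (snd e) (?c e)\<bar>)"
    using True by (intro prod.mono_neutral_right) (auto simp: entry_moment_0 count_list_0_iff)
  also have "\<dots> \<le> (\<Prod>e\<in>?S. 2 ^ (?c e - 2) * p)"
    using p \<eta> c by (intro prod_mono conjI entry_moment_bound) auto
  also have "\<dots> = 2 ^ (\<Sum>e\<in>?S. ?c e - 2) * p ^ card ?S"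
    by (simp add: prod.distrib power_sum)
  also have "(\<Sum>e\<in>?S. ?c e - 2) = 2 * (m - card ?S)"
    using len c by (simp add: sum_subtractf_nat)
  also have "(2::real) ^ (2 * (m - card ?S)) * p ^ card ?S = 4 ^ m * (p / 4) ^ card ?S"
  proof -
    have "(2::real) ^ (2 * (m - card ?S)) = 4 ^ (m - card ?S)" by (simp add: power_mult)
    also have "\<dots> = 4 ^ m / 4 ^ card ?S" using em by (simp add: power_diff)
    finally show ?thesis by (simp add: power_divide)
  qed
  also have "\<dots> \<le> 4 ^ m * (p / 4) ^ (card (set (j # l)) - 1)"
    using p vm by (intro mult_left_mono power_decreasing) auto
  also have "\<dots> = 4 ^ Suc m / p * (p / 4) ^ card (set (j # l))"
  proof -
    obtain v where v: "card (set (j # l)) = Suc v"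
      by (metis List.finite_set card_0_eq list.simps(15) insert_not_empty not0_implies_Suc)
    show ?thesis unfolding v using p by simp
  qed
  finally show ?thesis using vm em by simp
qed

text \<open>The start vertex joins the list, which gives lists of length \<open>2 m + 1\<close>, and
  the closing condition of the walk is dropped. The count is then used with \<open>M = m + 1\<close>
  and \<open>x = p / 4\<close>; \<open>large\<close> is its assumption
  \<open>M \<le> n x\<close>.\<close>

theorem expect_trace_noise_power_le:
  assumes p: "0 < p" "p \<le> 1" and \<eta>: "0 \<le> \<eta>" "\<eta> \<le> 1/2" and n: "0 < n"
    and large: "4 * real (Suc m) \<le> real n * p"
  shows "ssbm_expect n cl p \<eta> (\<lambda>A. \<Sum>i<n. (noise n cl p \<eta> A ^\<^sub>m (2 * m)) $$ (i, i))
    \<le> 2 * real n * (4 * real n * p * real (Suc m)) ^ m"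
proof -
  let ?W = "noise n cl p \<eta>" and ?V = "vertex_lists n (2 * m)"
  have "ssbm_expect n cl p \<eta> (\<lambda>A. \<Sum>i<n. (?W A ^\<^sub>m (2 * m)) $$ (i, i)) =
      (\<Sum>i<n. \<Sum>l\<in>?V. ssbm_expect n cl p \<eta> (\<lambda>A. if last (i # l) = i then walk_prod (?W A) i l else 0))"
    unfolding ssbm_expect_sum[symmetric]
    by (intro arg_cong[of _ _ "ssbm_expect n cl p \<eta>"] ext sum.cong pow_mat_index_walks[OF noise_carrier]) auto
  also have "\<dots> \<le> (\<Sum>i<n. \<Sum>l\<in>?V. 4 ^ Suc m / p * (if card (set (i # l)) \<le> Suc m then (p / 4) ^ card (set (i # l)) else 0))"
  proof (intro sum_mono)
    fix i l assume il: "i \<in> {..<n}" "l \<in> ?V"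
    show "ssbm_expect n cl p \<eta> (\<lambda>A. if last (i # l) = i then walk_prod (?W A) i l else 0)
      \<le> 4 ^ Suc m / p * (if card (set (i # l)) \<le> Suc m then (p / 4) ^ card (set (i # l)) else 0)"
      (is "_ \<le> ?r")
    proof (cases "last (i # l) = i")
      case True
      have "i < n" using il by simp
      from expect_walk_prod_noise_le[OF p \<eta> il(2) this, of cl] show ?thesis
        using True by (auto dest: abs_le_D1)
    next
      case False
      have "0 \<le> ?r" using p by simp
      then show ?thesis using False by (simp only: if_False ssbm_expect_const)
    qed
  qed
  also have "\<dots> = 4 ^ Suc m / p * (\<Sum>l\<in>vertex_lists n (Suc (2 * m)). if card (set l) \<le> Suc m then (p / 4) ^ card (set l) else 0)"
    by (simp only: sum_vertex_lists_Suc sum_distrib_left)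
  also have "\<dots> \<le> 4 ^ Suc m / p * ((real n * (p / 4) / real (Suc m)) ^ Suc m * (2 * real (Suc m)) ^ Suc (2 * m))"
    using p n large by (intro mult_left_mono tilted_count_vertex_lists) auto
  also have "\<dots> = 2 * real n * (4 * real n * p * real (Suc m)) ^ m"
  proof -
    define M where "M = real (Suc m)"
    have M: "M > 0" by (simp add: M_def)
    have "4 ^ Suc m / p * ((real n * (p / 4) / M) ^ Suc m * (2 * M) ^ Suc (2 * m))
      = 4 ^ Suc m / p * ((real n * p) ^ Suc m / (4 ^ Suc m * M ^ Suc m) * (2 * M * (4 ^ m * (M ^ m * M ^ m))))"
      by (simp add: power_mult_distrib power_divide power_mult power_even_eq power2_eq_square)
    also have "\<dots> = 2 * real n * ((real n * p) ^ m * 4 ^ m * M ^ m)"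
      using p M by (simp add: field_simps)
    also have "\<dots> = 2 * real n * (4 * real n * p * M) ^ m"
      by (simp add: power_mult_distrib)
    finally show ?thesis by (simp only: M_def)
  qed
  finally show ?thesis .
qed

section \<open>Degree concentration\<close>

lemma signed_degree_pairs:
  assumes A: "A \<in> signed_adj n" and j: "j < n"
  shows "signed_degree A j = (\<Sum>e | e \<in> pairs n \<and> (fst e = j \<or> snd e = j). \<bar>A $$ e\<bar>)"
proof -
  have "signed_degree A j = (\<Sum>j'\<in>{..<n}. \<bar>A $$ (j, j')\<bar>)"
    using signed_adj_carrier[OF A] by (simp add: signed_degree_def)
  also have "\<dots> = (\<Sum>j'\<in>{..<n} - {j}. \<bar>A $$ (j, j')\<bar>)"
    using j signed_adj_diag[OF A j] by (simp add: sum.remove)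
  also have "\<dots> = (\<Sum>e | e \<in> pairs n \<and> (fst e = j \<or> snd e = j). \<bar>A $$ e\<bar>)"
    by (rule sum.reindex_bij_witness[of _ "\<lambda>e. if fst e = j then snd e else fst e" "\<lambda>i. (min i j, max i j)"])
      (use j signed_adj_sym[OF A] in \<open>auto simp: pairs_def min_def max_def\<close>)
  finally show ?thesis .
qed

lemma card_incident_pairs:
  assumes "j < n"
  shows "card {e \<in> pairs n. fst e = j \<or> snd e = j} = n - 1"
proof -
  have "bij_betw (\<lambda>i. (min i j, max i j)) ({..<n} - {j}) {e \<in> pairs n. fst e = j \<or> snd e = j}"
    by (rule bij_betw_byWitness[where f' = "\<lambda>e. if fst e = j then snd e else fst e"])
      (use assms in \<open>auto simp: pairs_def min_def max_def\<close>)
  from bij_betw_same_card[OF this] show ?thesis using assms by simp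
qed

lemma exp_le_quadratic:
  fixes t :: real
  assumes "\<bar>t\<bar> \<le> 1"
  shows "exp t \<le> 1 + t + t\<^sup>2"
proof (cases "0 \<le> t")
  case True
  then show ?thesis using exp_bound[of t] assms by simp
next
  case False
  define u where "u = - t"
  have u: "0 \<le> u" using False by (simp add: u_def)
  \<comment> \<open>For \<open>t = - u\<close> it suffices that
    \<open>(1 - u + u\<^sup>2) exp u \<ge> 1\<close>; the quadratic Taylor polynomial of
    \<open>exp u\<close> already achieves this.\<close>
  have "1 \<le> 1 + u\<^sup>2 / 2 + u ^ 3 / 2 + u ^ 4 / 2" using u by simp
  also have "\<dots> = (1 - u + u\<^sup>2) * (1 + u + u\<^sup>2 / 2)"
    by (simp add: field_simps power2_eq_square power3_eq_cube power4_eq_xxxx)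
  also have "\<dots> \<le> (1 - u + u\<^sup>2) * exp u"
  proof (intro mult_left_mono exp_lower_Taylor_quadratic u)
    have "1 - u + u\<^sup>2 = (u - 1/2)\<^sup>2 + 3/4" by (simp add: power2_eq_square algebra_simps)
    then show "0 \<le> 1 - u + u\<^sup>2" by simp
  qed
  finally show ?thesis by (simp add: u_def exp_minus field_simps)
qed

text \<open>Sign flips do not affect \<open>|A e|\<close>, so the degree is a sum of
  \<open>n - 1\<close> independent Bernoulli variables with parameter \<open>p\<close>, whatever the
  clusters and \<eta> are.\<close>

lemma degree_mgf_le:
  assumes p: "0 \<le> p" "p \<le> 1" and j: "j < n" and t: "\<bar>t\<bar> \<le> 1"
  shows "ssbm_expect n cl p \<eta> (\<lambda>A. exp (t * (signed_degree A j - p * (real n - 1))))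
    \<le> exp (p * (real n - 1) * t\<^sup>2)"
proof -
  let ?I = "{e \<in> pairs n. fst e = j \<or> snd e = j}"
  have n1: "real (n - 1) = real n - 1" using j by simp
  have "ssbm_expect n cl p \<eta> (\<lambda>A. exp (t * signed_degree A j)) =
      ssbm_expect n cl p \<eta> (\<lambda>A. \<Prod>e\<in>pairs n. if fst e = j \<or> snd e = j then exp (t * \<bar>A $$ e\<bar>) else 1)"
    unfolding ssbm_expect_def
  proof (rule sum.cong[OF refl])
    fix A assume A: "A \<in> signed_adj n"
    have "exp (t * signed_degree A j) = (\<Prod>e\<in>?I. exp (t * \<bar>A $$ e\<bar>))"
      by (simp add: signed_degree_pairs[OF A j] sum_distrib_left exp_sum)
    also have "\<dots> = (\<Prod>e\<in>pairs n. if fst e = j \<or> snd e = j then exp (t * \<bar>A $$ e\<bar>) else 1)"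
      by (simp add: prod.inter_filter)
    finally show "ssbm_weight n cl p \<eta> A * exp (t * signed_degree A j) = ssbm_weight n cl p \<eta> A *
      (\<Prod>e\<in>pairs n. if fst e = j \<or> snd e = j then exp (t * \<bar>A $$ e\<bar>) else 1)" by simp
  qed
  also have "\<dots> = (\<Prod>e\<in>pairs n. if fst e = j \<or> snd e = j then 1 + p * (exp t - 1) else 1)"
    unfolding ssbm_expect_prod[where g = "\<lambda>e a. if fst e = j \<or> snd e = j then exp (t * \<bar>a\<bar>) else 1"]
      entry_expect by (rule prod.cong) (auto simp: Let_def algebra_simps)
  also have "\<dots> = (1 + p * (exp t - 1)) ^ (n - 1)"
    by (simp add: card_incident_pairs[OF j] flip: prod.inter_filter)
  also have "\<dots> \<le> exp (p * (exp t - 1)) ^ (n - 1)"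
  proof (rule power_mono[OF exp_ge_add_one_self])
    have "1 + p * (exp t - 1) = (1 - p) + p * exp t" by (simp add: algebra_simps)
    also have "\<dots> \<ge> 0" using p by simp
    finally show "0 \<le> 1 + p * (exp t - 1)" .
  qed
  also have "\<dots> = exp (p * (real n - 1) * (exp t - 1))"
    by (simp only: exp_of_nat_mult[symmetric] n1) (simp add: mult_ac)
  also have "\<dots> \<le> exp (p * (real n - 1) * (t + t\<^sup>2))"
    using exp_le_quadratic[OF t] p j by (simp add: mult_left_mono)
  finally have *: "ssbm_expect n cl p \<eta> (\<lambda>A. exp (t * signed_degree A j)) \<le> exp (p * (real n - 1) * (t + t\<^sup>2))" .
  have "ssbm_expect n cl p \<eta> (\<lambda>A. exp (t * (signed_degree A j - p * (real n - 1)))) =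
      exp (- t * (p * (real n - 1))) * ssbm_expect n cl p \<eta> (\<lambda>A. exp (t * signed_degree A j))"
    unfolding ssbm_expect_cmult[symmetric] by (simp add: algebra_simps flip: exp_add)
  also have "\<dots> \<le> exp (- t * (p * (real n - 1))) * exp (p * (real n - 1) * (t + t\<^sup>2))"
    by (rule mult_left_mono[OF *]) simp
  also have "\<dots> = exp (p * (real n - 1) * t\<^sup>2)"
    by (simp add: algebra_simps flip: exp_add)
  finally show ?thesis .
qed

section \<open>Perturbation of the Laplacian and the main theorem\<close>

lemma euclid_norm_scale_le:
  assumes x: "x \<in> carrier_vec n" and "\<And>i. i < n \<Longrightarrow> \<bar>e i\<bar> \<le> c" and "0 \<le> c"
  shows "euclid_norm (vec n (\<lambda>i. e i * x $ i)) \<le> c * euclid_norm x"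
proof -
  have "(euclid_norm (vec n (\<lambda>i. e i * x $ i)))\<^sup>2 = (\<Sum>i<n. (e i)\<^sup>2 * (x $ i)\<^sup>2)"
    by (simp add: euclid_norm_def sum_nonneg power_mult_distrib)
  also have "\<dots> \<le> (\<Sum>i<n. c\<^sup>2 * (x $ i)\<^sup>2)"
  proof (intro sum_mono mult_right_mono)
    fix i assume "i \<in> {..<n}"
    then have "\<bar>e i\<bar>\<^sup>2 \<le> c\<^sup>2" by (intro power_mono assms) auto
    then show "(e i)\<^sup>2 \<le> c\<^sup>2" by simp
  qed simp
  also have "\<dots> = (c * euclid_norm x)\<^sup>2"
    using x by (simp add: euclid_norm_def sum_nonneg power_mult_distrib sum_distrib_left)
  finally show ?thesis by (rule power2_le_imp_le) (use assms in simp)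
qed

text \<open>After squaring, the two sides reduce to
  \<open>(1 + \<epsilon>)\<^sup>2 (1 - \<epsilon>) \<ge> 1\<close> and
  \<open>(1 - \<epsilon>)\<^sup>2 (1 + \<epsilon>) \<le> 1\<close>, both valid for
  \<open>0 \<le> \<epsilon> \<le> 1/2\<close>.\<close>

lemma inverse_sqrt_ratio_bounds:
  fixes d D \<epsilon> :: real
  assumes "0 < D" "0 \<le> \<epsilon>" "\<epsilon> \<le> 1/2" "\<bar>d - D\<bar> \<le> \<epsilon> * D"
  shows "\<bar>sqrt D * inverse (sqrt d) - 1\<bar> \<le> \<epsilon>"
proof -
  have "\<epsilon> * D \<le> 1/2 * D" using assms by (intro mult_right_mono) auto
  then have d: "0 < d" using assms by linarith
  define s where "s = sqrt D * inverse (sqrt d)"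
  have s0: "0 \<le> s" using assms d by (simp add: s_def)
  have "s = sqrt (D / d)" unfolding s_def real_sqrt_divide by (rule divide_inverse[symmetric])
  then have s2: "s\<^sup>2 = D / d" using assms d by simp
  have "\<epsilon>\<^sup>2 \<le> (1/2)\<^sup>2" using assms by (intro power_mono) auto
  then have e2: "\<epsilon>\<^sup>2 \<le> 1/4" by (simp add: power2_eq_square)
  have "D \<le> (1 + \<epsilon>)\<^sup>2 * d"
  proof -
    have "D * 1 \<le> D * ((1 + \<epsilon>)\<^sup>2 * (1 - \<epsilon>))"
    proof (rule mult_left_mono)
      have "\<epsilon> * (\<epsilon> + \<epsilon>\<^sup>2) \<le> \<epsilon> * 1" using assms e2 by (intro mult_left_mono) auto
      then show "1 \<le> (1 + \<epsilon>)\<^sup>2 * (1 - \<epsilon>)" by (simp add: algebra_simps power2_eq_square)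
    qed (use assms in simp)
    also have "\<dots> = (1 + \<epsilon>)\<^sup>2 * ((1 - \<epsilon>) * D)" by simp
    also have "\<dots> \<le> (1 + \<epsilon>)\<^sup>2 * d" using assms by (intro mult_left_mono) (auto simp: algebra_simps)
    finally show ?thesis by simp
  qed
  then have "s\<^sup>2 \<le> (1 + \<epsilon>)\<^sup>2" unfolding s2 using d by (simp add: divide_le_eq)
  then have 1: "s \<le> 1 + \<epsilon>" by (rule power2_le_imp_le) (use assms in simp)
  have "(1 - \<epsilon>)\<^sup>2 * d \<le> D"
  proof -
    have "(1 - \<epsilon>)\<^sup>2 * d \<le> (1 - \<epsilon>)\<^sup>2 * ((1 + \<epsilon>) * D)" using assms by (intro mult_left_mono) (auto simp: algebra_simps)
    also have "\<dots> = ((1 - \<epsilon>) * (1 - \<epsilon>\<^sup>2)) * D" by (simp add: algebra_simps power2_eq_square)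
    also have "\<dots> \<le> (1 * 1) * D" using assms e2 by (intro mult_right_mono mult_mono) auto
    finally show ?thesis by simp
  qed
  then have "(1 - \<epsilon>)\<^sup>2 \<le> s\<^sup>2" unfolding s2 using d by (simp add: le_divide_eq)
  then have "1 - \<epsilon> \<le> s" by (rule power2_le_imp_le) (rule s0)
  then show ?thesis using 1 by (simp add: s_def)
qed

lemma Lsym_signed_carrier: "A \<in> carrier_mat n n \<Longrightarrow> Lsym_signed A \<in> carrier_mat n n"
  by (intro carrier_matI) (auto simp: Lsym_signed_def Let_def)

lemma Lsym_signed_index:
  assumes A: "A \<in> carrier_mat n n" and ij: "i < n" "j < n"
  shows "Lsym_signed A $$ (i, j) = (if i = j then 1 else 0) -
    inverse (sqrt (signed_degree A i)) * A $$ (i, j) * inverse (sqrt (signed_degree A j))"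
proof -
  define h where "h i = inverse (sqrt (signed_degree A i))" for i
  have L: "Lsym_signed A = 1\<^sub>m n - diag_of n h * A * diag_of n h"
    unfolding Lsym_signed_def Let_def diag_of_def h_def using A by simp
  have l: "(diag_of n h * A) $$ (i, l) = h i * A $$ (i, l)" if "l < n" for l
    using A ij that by (simp add: diag_of_def scalar_prod_def if_distrib[of "\<lambda>z. z * _"] cong: if_cong)
  have "(diag_of n h * A * diag_of n h) $$ (i, j) = (\<Sum>l<n. (diag_of n h * A) $$ (i, l) * diag_of n h $$ (l, j))"
    using A ij by (simp add: diag_of_def scalar_prod_def[of "row _ _"] lessThan_atLeast0)
  also have "\<dots> = (\<Sum>l<n. if l = j then h i * A $$ (i, l) * h l else 0)"
    using ij by (intro sum.cong[OF refl]) (simp add: l, simp add: diag_of_def)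
  also have "\<dots> = h i * A $$ (i, j) * h j" using ij by simp
  finally show ?thesis using A ij unfolding L by (simp add: h_def diag_of_def)
qed

text \<open>Equal to \<open>1 - mean_Lsym\<close>: for \<open>q = (1 - 2 \<eta>) / (n - 1)\<close>
  it is the expected adjacency matrix divided by the expected degree.\<close>

definition mean_T :: "nat \<Rightarrow> (nat \<Rightarrow> nat) \<Rightarrow> real \<Rightarrow> real mat" where
  "mean_T n cl q = mat n n (\<lambda>(i, j). if i = j then 0 else if cl i = cl j then q else - q)"

lemma mean_T_carrier [simp]: "mean_T n cl q \<in> carrier_mat n n"
  by (simp add: mean_T_def)

text \<open>The Frobenius norm is enough: \<open>n (n - 1)\<close> entries of size at most
  \<open>1 / (n - 1)\<close> have squares summing to at most
  \<open>n / (n - 1) \<le> 4\<close>.\<close>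

lemma op_bound_mean_T:
  assumes n: "2 \<le> n" and q: "\<bar>q\<bar> \<le> 1 / (real n - 1)" and x: "x \<in> carrier_vec n"
  shows "euclid_norm (mean_T n cl q *\<^sub>v x) \<le> 2 * euclid_norm x"
proof -
  let ?T = "mean_T n cl q"
  have "(\<Sum>i<n. (?T * transpose_mat ?T) $$ (i, i)) = (\<Sum>i<n. \<Sum>j<n. if j = i then 0 else q\<^sup>2)"
    by (intro sum.cong[OF refl]) (auto simp: mean_T_def scalar_prod_def lessThan_atLeast0 power2_eq_square intro!: sum.cong)
  also have "\<dots> = (\<Sum>i<n. real (n - 1) * q\<^sup>2)"
  proof (rule sum.cong[OF refl])
    fix i assume "i \<in> {..<n}"
    then have "(\<Sum>j<n. if j = i then 0 else q\<^sup>2) = (\<Sum>j\<in>{..<n} - {i}. q\<^sup>2)"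
      by (simp add: sum.remove[of _ i])
    also have "\<dots> = real (n - 1) * q\<^sup>2" using \<open>i \<in> _\<close> by simp
    finally show "(\<Sum>j<n. if j = i then 0 else q\<^sup>2) = real (n - 1) * q\<^sup>2" .
  qed
  also have "\<dots> = real n * (real n - 1) * q\<^sup>2" using n by (simp add: of_nat_diff)
  also have "\<dots> \<le> real n * (real n - 1) * (1 / (real n - 1))\<^sup>2"
    using n power_mono[OF q, of 2] by (intro mult_left_mono) auto
  also have "\<dots> = real n / (real n - 1)" using n by (simp add: power2_eq_square)
  also have "\<dots> \<le> 2\<^sup>2" using n by (simp add: divide_le_eq)
  finally have "(\<Sum>i<n. (?T * transpose_mat ?T) $$ (i, i)) \<le> 2\<^sup>2" .
  with euclid_norm_mult_mat_vec_le_trace[OF mean_T_carrier x, of cl q]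
  have "(euclid_norm (?T *\<^sub>v x))\<^sup>2 \<le> (2 * euclid_norm x)\<^sup>2"
    unfolding power_mult_distrib by (meson mult_right_mono order_trans zero_le_power2)
  then show ?thesis by (rule power2_le_imp_le) simp
qed

text \<open>With \<open>S = diag(sqrt(D / d\<^sub>i))\<close> for the degrees
  \<open>d\<^sub>i\<close> and \<open>A = W + D T\<close>, the difference is
  \<open>- S W S / D + T (1 - S) + (1 - S) T S\<close>. Here
  \<open>|1 - S| \<le> \<epsilon>\<close>, \<open>|S| \<le> 1 + \<epsilon>\<close> and
  \<open>|T| \<le> 2\<close>.\<close>

lemma Lsym_perturbation:
  assumes A: "A \<in> signed_adj n" and n: "2 \<le> n" and p: "0 < p" and \<eta>: "0 \<le> \<eta>" "\<eta> \<le> 1/2"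
    and \<epsilon>: "0 \<le> \<epsilon>" "\<epsilon> \<le> 1/2"
    and deg: "\<And>i. i < n \<Longrightarrow> \<bar>signed_degree A i - p * (real n - 1)\<bar> \<le> \<epsilon> * (p * (real n - 1))"
    and W: "op_bound (noise n cl p \<eta> A) \<theta>" and \<theta>: "0 \<le> \<theta>"
  shows "op_bound (Lsym_signed A - mean_Lsym n cl ((1 - 2 * \<eta>) / (real n - 1)))
    ((1 + \<epsilon>)\<^sup>2 * \<theta> / (p * (real n - 1)) + 2 * \<epsilon> * (2 + \<epsilon>))"
  unfolding op_bound_def
proof
  define q where "q = (1 - 2 * \<eta>) / (real n - 1)"
  define D where "D = p * (real n - 1)"
  let ?T = "mean_T n cl q" and ?W = "noise n cl p \<eta> A" and ?M = "Lsym_signed A - mean_Lsym n cl q"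
  have Ac: "A \<in> carrier_mat n n" by (rule signed_adj_carrier[OF A])
  have D: "0 < D" using p n by (simp add: D_def)
  have q: "\<bar>q\<bar> \<le> 1 / (real n - 1)" using \<eta> n by (simp add: q_def divide_right_mono)
  define e where "e i = sqrt D * inverse (sqrt (signed_degree A i))" for i
  have e1: "\<bar>e i - 1\<bar> \<le> \<epsilon>" if "i < n" for i
    unfolding e_def by (rule inverse_sqrt_ratio_bounds[OF D \<epsilon>]) (use deg[OF that] in \<open>simp add: D_def\<close>)
  have eb: "\<bar>e i\<bar> \<le> 1 + \<epsilon>" if "i < n" for i using e1[OF that] by linarith
  define S where "S v = vec n (\<lambda>i. e i * v $ i)" for v
  have Sc: "S v \<in> carrier_vec n" for v by (simp add: S_def)
  have Mc: "?M \<in> carrier_mat n n" by (rule minus_carrier_mat[OF mean_Lsym_carrier])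
  fix x :: "real vec" assume "x \<in> carrier_vec (dim_col (Lsym_signed A - mean_Lsym n cl ((1 - 2 * \<eta>) / (real n - 1))))"
  then have x: "x \<in> carrier_vec n" by (simp add: mean_Lsym_def)
  have WS: "?W *\<^sub>v S x \<in> carrier_vec n" by (rule mult_mat_vec_carrier[OF noise_carrier Sc])
  have TS: "?T *\<^sub>v S x \<in> carrier_vec n" by (rule mult_mat_vec_carrier[OF mean_T_carrier Sc])
  have xS: "vec n (\<lambda>i. (1 - e i) * x $ i) \<in> carrier_vec n" by simp
  have Txs: "?T *\<^sub>v vec n (\<lambda>i. (1 - e i) * x $ i) \<in> carrier_vec n" by (rule mult_mat_vec_carrier[OF mean_T_carrier xS])
  let ?a = "(- 1 / D) \<cdot>\<^sub>v S (?W *\<^sub>v S x)" and ?b = "?T *\<^sub>v vec n (\<lambda>i. (1 - e i) * x $ i)"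
    and ?c = "vec n (\<lambda>i. (1 - e i) * (?T *\<^sub>v S x) $ i)"
  have dec: "?M *\<^sub>v x = ?a + (?b + ?c)"
  proof (rule eq_vecI)
    fix i assume "i < dim_vec (?a + (?b + ?c))"
    then have i: "i < n" by simp
    have ent: "?M $$ (i, j) = (- 1 / D) * (e i * (?W $$ (i, j) * e j)) + (?T $$ (i, j) * (1 - e j) + (1 - e i) * (?T $$ (i, j) * e j))"
      if j: "j < n" for j
    proof -
      have "inverse (sqrt (signed_degree A i)) * A $$ (i, j) * inverse (sqrt (signed_degree A j)) = e i * A $$ (i, j) * e j / D"
      proof -
        have "e i * A $$ (i, j) * e j / D = (sqrt D * sqrt D / D) *
            (inverse (sqrt (signed_degree A i)) * A $$ (i, j) * inverse (sqrt (signed_degree A j)))"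
          by (simp only: e_def divide_inverse mult_ac)
        also have "sqrt D * sqrt D / D = 1" using D by simp
        finally show ?thesis by simp
      qed
      then have "?M $$ (i, j) = ?T $$ (i, j) - e i * A $$ (i, j) * e j / D"
        using i j by (simp add: Lsym_signed_index[OF Ac i j] mean_Lsym_def mean_T_def)
      moreover have "A $$ (i, j) = ?W $$ (i, j) + D * ?T $$ (i, j)"
        using i j n by (simp add: noise_def ssbm_mean_def mean_T_def D_def q_def)
      ultimately show ?thesis using D by (simp add: field_simps)
    qed
    have "(?M *\<^sub>v x) $ i = (\<Sum>j<n. ?M $$ (i, j) * x $ j)" by (rule mult_mat_vec_index[OF Mc x i])
    also have "\<dots> = (\<Sum>j<n. (- 1 / D) * (e i * (?W $$ (i, j) * S x $ j)) + (?T $$ (i, j) * vec n (\<lambda>i. (1 - e i) * x $ i) $ j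
        + (1 - e i) * (?T $$ (i, j) * S x $ j)))"
    proof (rule sum.cong[OF refl])
      fix j assume "j \<in> {..<n}"
      then have j: "j < n" by simp
      show "?M $$ (i, j) * x $ j = (- 1 / D) * (e i * (?W $$ (i, j) * S x $ j)) + (?T $$ (i, j) * vec n (\<lambda>i. (1 - e i) * x $ i) $ j
        + (1 - e i) * (?T $$ (i, j) * S x $ j))"
        unfolding ent[OF j] using j by (simp add: S_def algebra_simps)
    qed
    also have "\<dots> = (- 1 / D) * (e i * (?W *\<^sub>v S x) $ i) + (?b $ i + (1 - e i) * (?T *\<^sub>v S x) $ i)"
      unfolding mult_mat_vec_index[OF noise_carrier Sc i] mult_mat_vec_index[OF mean_T_carrier xS i]
        mult_mat_vec_index[OF mean_T_carrier Sc i]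
      by (simp only: sum.distrib sum_distrib_left)
    also have "\<dots> = (?a + (?b + ?c)) $ i" using i Txs by (simp add: S_def)
    finally show "(?M *\<^sub>v x) $ i = (?a + (?b + ?c)) $ i" .
  qed (simp add: mean_Lsym_def)
  have Snorm: "euclid_norm (S v) \<le> (1 + \<epsilon>) * euclid_norm v" if "v \<in> carrier_vec n" for v
    unfolding S_def by (rule euclid_norm_scale_le[OF that eb]) (use \<epsilon> in auto)
  have a: "euclid_norm ?a \<le> (1 + \<epsilon>)\<^sup>2 * \<theta> / D * euclid_norm x"
  proof -
    have "euclid_norm (S (?W *\<^sub>v S x)) \<le> (1 + \<epsilon>) * euclid_norm (?W *\<^sub>v S x)" by (rule Snorm[OF WS])
    also have "euclid_norm (?W *\<^sub>v S x) \<le> \<theta> * euclid_norm (S x)" using W Sc[of x] by (simp add: op_bound_def noise_def)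
    also have "euclid_norm (S x) \<le> (1 + \<epsilon>) * euclid_norm x" by (rule Snorm[OF x])
    finally have "euclid_norm (S (?W *\<^sub>v S x)) \<le> (1 + \<epsilon>) * (\<theta> * ((1 + \<epsilon>) * euclid_norm x))"
      using \<theta> \<epsilon> by (simp add: mult_left_mono)
    then have "1 / D * euclid_norm (S (?W *\<^sub>v S x)) \<le> 1 / D * ((1 + \<epsilon>) * (\<theta> * ((1 + \<epsilon>) * euclid_norm x)))"
      using D by (intro mult_left_mono) auto
    then show ?thesis using D by (simp add: euclid_norm_smult power2_eq_square mult_ac)
  qed
  have b: "euclid_norm ?b \<le> 2 * (\<epsilon> * euclid_norm x)"
  proof -
    have "euclid_norm ?b \<le> 2 * euclid_norm (vec n (\<lambda>i. (1 - e i) * x $ i))" by (rule op_bound_mean_T[OF n q xS])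
    also have "euclid_norm (vec n (\<lambda>i. (1 - e i) * x $ i)) \<le> \<epsilon> * euclid_norm x"
      by (rule euclid_norm_scale_le[OF x]) (use e1 \<epsilon> in \<open>auto simp: abs_minus_commute\<close>)
    finally show ?thesis by simp
  qed
  have c: "euclid_norm ?c \<le> \<epsilon> * (2 * ((1 + \<epsilon>) * euclid_norm x))"
  proof -
    have "euclid_norm ?c \<le> \<epsilon> * euclid_norm (?T *\<^sub>v S x)"
      by (rule euclid_norm_scale_le[OF TS]) (use e1 \<epsilon> in \<open>auto simp: abs_minus_commute\<close>)
    also have "\<dots> \<le> \<epsilon> * (2 * ((1 + \<epsilon>) * euclid_norm x))"
      using op_bound_mean_T[OF n q Sc, of cl x] Snorm[OF x] \<epsilon> by (intro mult_left_mono) auto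
    finally show ?thesis .
  qed
  have "euclid_norm (?M *\<^sub>v x) \<le> euclid_norm ?a + (euclid_norm ?b + euclid_norm ?c)"
  proof -
    have ac: "?a \<in> carrier_vec n" using Sc by simp
    have cc: "?c \<in> carrier_vec n" by simp
    have "?b + ?c \<in> carrier_vec n" using Txs by simp
    from euclid_norm_triangle[OF ac this] euclid_norm_triangle[OF Txs cc] show ?thesis unfolding dec by linarith
  qed
  also have "\<dots> \<le> ((1 + \<epsilon>)\<^sup>2 * \<theta> / D + 2 * \<epsilon> * (2 + \<epsilon>)) * euclid_norm x"
    using a b c by (simp add: algebra_simps)
  finally show "euclid_norm ((Lsym_signed A - mean_Lsym n cl ((1 - 2 * \<eta>) / (real n - 1))) *\<^sub>v x)
    \<le> ((1 + \<epsilon>)\<^sup>2 * \<theta> / (p * (real n - 1)) + 2 * \<epsilon> * (2 + \<epsilon>)) * euclid_norm x"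
    by (simp add: D_def q_def)
qed

lemma noise_symmetric: "A \<in> signed_adj n \<Longrightarrow> transpose_mat (noise n cl p \<eta> A) = noise n cl p \<eta> A"
  by (intro eq_matI) (auto simp: noise_sym noise_def[of n cl p \<eta>] signed_adj_sym ssbm_mean_def)

section \<open>Probability of the good event\<close>

lemma trace_even_power_nonneg:
  assumes W: "(W :: real mat) \<in> carrier_mat n n" and sym: "transpose_mat W = W"
  shows "0 \<le> (\<Sum>i<n. (W ^\<^sub>m (2 * m)) $$ (i, i))"
proof -
  have M: "W ^\<^sub>m m \<in> carrier_mat n n" by (rule pow_carrier_mat[OF W])
  have "W ^\<^sub>m (2 * m) = W ^\<^sub>m m * transpose_mat (W ^\<^sub>m m)"
    by (simp add: pow_mat_symmetric[OF W sym] mult_2 pow_mat_plus[OF W])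
  then have "(W ^\<^sub>m (2 * m)) $$ (i, i) = (euclid_norm (row (W ^\<^sub>m m) i))\<^sup>2" if "i < n" for i
    using W M that by (simp add: euclid_norm_sq)
  then show ?thesis by (intro sum_nonneg) simp
qed

lemma two_le_ln: "10 \<le> n \<Longrightarrow> 2 \<le> ln (real n)"
proof -
  assume n: "10 \<le> n"
  have "exp (2::real) = exp 1 * exp 1" by (simp flip: exp_add)
  also have "\<dots> \<le> 3 * 3" by (intro mult_mono exp_le) auto
  finally show ?thesis using n by (subst ln_ge_iff) auto
qed

lemma exp_minus_3_ln: "0 < n \<Longrightarrow> exp (- 3 * ln (real n)) = 1 / real n ^ 3"
  using exp_of_nat_mult[of 3 "ln (real n)"] by (simp add: exp_minus divide_inverse)

text \<open>A single function \<open>F\<close> collects the failure modes: the normalised trace, and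
  for each vertex an exponential for the upper and one for the lower tail of its degree. The trace
  and the degrees cost at most \<open>1/n\<close> each. The number 112896 is the square of 336, the
  reciprocal of the largest admissible \<open>r\<close>.\<close>

lemma good_event_prob:
  assumes n: "10 \<le> n" and p: "0 < p" "p \<le> 1" and \<eta>: "0 \<le> \<eta>" "\<eta> \<le> 1/2"
    and big: "112896 * ln (real n) \<le> real n * p"
    and E: "\<And>A. A \<in> signed_adj n \<Longrightarrow> op_bound (noise n cl p \<eta> A) (15 * sqrt (real n * p * ln (real n))) \<Longrightarrow>
      (\<And>i. i < n \<Longrightarrow> \<bar>signed_degree A i - p * (real n - 1)\<bar> \<le> 4 * sqrt (ln (real n) / (real n * p)) * (p * (real n - 1)))
      \<Longrightarrow> A \<in> E"
  shows "1 - 2 / real n \<le> ssbm_prob n cl p \<eta> E"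
proof -
  define D where "D = p * (real n - 1)"
  define r where "r = sqrt (ln (real n) / (real n * p))"
  define \<theta> where "\<theta> = 15 * sqrt (real n * p * ln (real n))"
  define m where "m = nat \<lceil>ln (real n)\<rceil>"
  define s where "s = 4 * r * D"
  define tr where "tr A = (\<Sum>i<n. (noise n cl p \<eta> A ^\<^sub>m (2 * m)) $$ (i, i))" for A
  define dev where "dev t i A = exp (t * (signed_degree A i - p * (real n - 1)))" for t i A
  define F where "F A = 1 / \<theta> ^ (2 * m) * tr A + (\<Sum>i<n. exp (- (2 * r * s)) * dev (2 * r) i A + exp (- (2 * r * s)) * dev (- 2 * r) i A)" for A
  have ln2: "2 \<le> ln (real n)" by (rule two_le_ln[OF n])
  have n0: "0 < n" using n by simp
  have np: "0 < real n * p" using p n by simp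
  have D: "0 < D" using p n by (simp add: D_def)
  have r0: "0 \<le> r" using ln2 np by (simp add: r_def)
  have r2: "r\<^sup>2 = ln (real n) / (real n * p)" using ln2 np by (simp add: r_def)
  have "r\<^sup>2 \<le> (1 / 2)\<^sup>2"
  proof -
    have "r\<^sup>2 \<le> 1 / 4" unfolding r2 using big np ln2 by (simp add: divide_le_eq)
    then show ?thesis by (simp add: power2_eq_square)
  qed
  then have r_half: "r \<le> 1 / 2" by (rule power2_le_imp_le) simp
  \<comment> \<open>\<open>ln n \<ge> 2\<close> absorbs both the rounding and the successor:
    \<open>m + 1 \<le> ln n + 2 \<le> 2 ln n\<close>.\<close>
  have m_ge: "ln (real n) \<le> real m" and m_le: "real (Suc m) \<le> 2 * ln (real n)"
    using ln2 unfolding m_def by linarith+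
  have m0: "0 < m" using m_ge ln2 by (cases m) auto
  have \<theta>0: "0 < \<theta>" using np ln2 by (simp add: \<theta>_def)
  have \<theta>2: "\<theta>\<^sup>2 = 225 * (real n * p * ln (real n))" using np ln2 by (simp add: \<theta>_def power_mult_distrib)
  have n3: "1 / real n ^ 3 * (2 * real n) \<le> 1 / real n"
    using n by (simp add: field_simps power3_eq_cube)
  have "1 - ssbm_expect n cl p \<eta> F \<le> ssbm_prob n cl p \<eta> E"
  proof (rule ssbm_prob_ge)
    fix A assume A: "A \<in> signed_adj n"
    have tr0: "0 \<le> tr A" unfolding tr_def by (rule trace_even_power_nonneg[OF noise_carrier noise_symmetric[OF A]])
    have sum0: "0 \<le> (\<Sum>i<n. exp (- (2 * r * s)) * dev (2 * r) i A + exp (- (2 * r * s)) * dev (- 2 * r) i A)"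
      by (intro sum_nonneg) (simp add: dev_def)
    show "0 \<le> F A" using tr0 sum0 \<theta>0 by (simp add: F_def)
    assume "A \<notin> E"
    then consider "\<not> op_bound (noise n cl p \<eta> A) \<theta>" | i where "i < n" "s < \<bar>signed_degree A i - D\<bar>"
      using E[OF A] unfolding \<theta>_def s_def r_def D_def by force
    then show "1 \<le> F A"
    proof cases
      case 1
      then have "\<not> tr A \<le> \<theta> ^ (2 * m)"
        using op_bound_of_trace_power[OF noise_carrier noise_symmetric[OF A] m0] \<theta>0 unfolding tr_def by auto
      then have "1 \<le> 1 / \<theta> ^ (2 * m) * tr A" using \<theta>0 by simp
      then show ?thesis using sum0 by (simp add: F_def)
    next
      case (2 i)
      have "1 \<le> exp (- (2 * r * s)) * dev (2 * r) i A + exp (- (2 * r * s)) * dev (- 2 * r) i A"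
      proof (cases "0 \<le> signed_degree A i - D")
        case True
        then have "2 * r * s \<le> 2 * r * (signed_degree A i - D)" using 2 r0 by (intro mult_left_mono) auto
        then have "1 \<le> exp (- (2 * r * s)) * dev (2 * r) i A" by (simp add: dev_def D_def flip: exp_add)
        then show ?thesis by (simp add: dev_def add_increasing2)
      next
        case False
        then have "2 * r * s \<le> 2 * r * - (signed_degree A i - D)" using 2 r0 by (intro mult_left_mono) auto
        then have "0 \<le> - (2 * r * s) + - 2 * r * (signed_degree A i - D)" by (simp add: algebra_simps)
        then have "1 \<le> exp (- (2 * r * s)) * dev (- 2 * r) i A"
          unfolding dev_def D_def exp_add[symmetric] one_le_exp_iff .
        then show ?thesis by (simp add: dev_def add_increasing)
      qed
      also have "\<dots> \<le> (\<Sum>i<n. exp (- (2 * r * s)) * dev (2 * r) i A + exp (- (2 * r * s)) * dev (- 2 * r) i A)"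
        using 2 by (intro member_le_sum) (auto simp: dev_def)
      finally show ?thesis using tr0 \<theta>0 by (simp add: F_def add_increasing)
    qed
  qed (use p \<eta> in auto)
  moreover have "ssbm_expect n cl p \<eta> F \<le> 1 / real n + 1 / real n"
  proof -
    have "4 * real (Suc m) \<le> 4 * (2 * ln (real n))" using m_le by (rule mult_left_mono) simp
    also have "\<dots> \<le> 112896 * ln (real n)" using ln2 by simp
    also note big
    finally have large: "4 * real (Suc m) \<le> real n * p" .
    have "ssbm_expect n cl p \<eta> F = 1 / \<theta> ^ (2 * m) * ssbm_expect n cl p \<eta> tr
        + (\<Sum>i<n. exp (- (2 * r * s)) * ssbm_expect n cl p \<eta> (dev (2 * r) i) + exp (- (2 * r * s)) * ssbm_expect n cl p \<eta> (dev (- 2 * r) i))"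
      unfolding F_def by (simp only: ssbm_expect_add ssbm_expect_sum ssbm_expect_cmult)
    also have "1 / \<theta> ^ (2 * m) * ssbm_expect n cl p \<eta> tr \<le> 1 / real n"
    proof -
      have "ssbm_expect n cl p \<eta> tr \<le> 2 * real n * (4 * real n * p * real (Suc m)) ^ m"
        unfolding tr_def by (intro expect_trace_noise_power_le p \<eta> n0 large)
      also have "\<dots> \<le> 2 * real n * ((8 / 225) * \<theta>\<^sup>2) ^ m"
      proof (intro mult_left_mono power_mono)
        have "4 * real n * p * real (Suc m) \<le> 4 * real n * p * (2 * ln (real n))" using p m_le by (intro mult_left_mono) auto
        then show "4 * real n * p * real (Suc m) \<le> 8 / 225 * \<theta>\<^sup>2" by (simp add: \<theta>2)
      qed (use p in auto)
      also have "\<dots> = 2 * real n * (8 / 225) ^ m * \<theta> ^ (2 * m)" by (simp only: power_mult_distrib power_mult mult.assoc)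
      finally have "1 / \<theta> ^ (2 * m) * ssbm_expect n cl p \<eta> tr \<le> 1 / \<theta> ^ (2 * m) * (2 * real n * (8 / 225) ^ m * \<theta> ^ (2 * m))"
        using \<theta>0 by (intro mult_left_mono) auto
      also have "\<dots> = 2 * real n * (8 / 225) ^ m" using \<theta>0 by simp
      \<comment> \<open>The constant 15 in \<theta> is chosen for this step:
        \<open>8 / 15\<^sup>2 \<le> 1/27 \<le> exp (- 3)\<close>, and \<open>m \<ge> ln n\<close>
        turns the \<open>m\<close>-th power into \<open>1 / n^3\<close>.\<close>
      also have "\<dots> \<le> 2 * real n * exp (- 3) ^ m"
      proof (intro mult_left_mono power_mono)
        have "exp (3::real) = exp 1 ^ 3" using exp_of_nat_mult[of 3 "1::real"] by simp
        also have "\<dots> \<le> 3 ^ 3" by (intro power_mono exp_le) simp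
        finally have "inverse (27::real) \<le> exp (- 3)" unfolding exp_minus by (intro le_imp_inverse_le) auto
        then show "8 / 225 \<le> exp (- 3 :: real)" by simp
      qed auto
      also have "\<dots> \<le> 2 * real n * exp (- 3 * ln (real n))"
        using m_ge by (intro mult_left_mono) (simp_all flip: exp_of_nat_mult)
      also have "\<dots> \<le> 1 / real n" unfolding exp_minus_3_ln[OF n0] using n3 by (simp add: mult_ac)
      finally show ?thesis .
    qed
    also have "(\<Sum>i<n. exp (- (2 * r * s)) * ssbm_expect n cl p \<eta> (dev (2 * r) i) + exp (- (2 * r * s)) * ssbm_expect n cl p \<eta> (dev (- 2 * r) i))
        \<le> (\<Sum>i<n. 2 * (1 / real n ^ 3))"
    proof (rule sum_mono)
      fix i assume "i \<in> {..<n}"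
      then have i: "i < n" by simp
      have "r\<^sup>2 * D = ln (real n) * ((real n - 1) / real n)" unfolding r2 D_def using p n by (simp add: field_simps)
      also have "\<dots> \<ge> ln (real n) * (3 / 4)" using ln2 n by (intro mult_left_mono) (auto simp: field_simps)
      finally have rD: "3 * ln (real n) \<le> 4 * (r\<^sup>2 * D)" by simp
      \<comment> \<open>Chernoff with parameter \<open>2 r\<close> at deviation
        \<open>s = 4 r D\<close>: the exponent is \<open>- 8 r\<^sup>2 D + 4 r\<^sup>2 D\<close>,
        and \<open>r\<^sup>2 D \<ge> 3/4 ln n\<close> bounds each of the \<open>2 n\<close> tails by
        \<open>1 / n^3\<close>.\<close>
      have b: "exp (- (2 * r * s)) * ssbm_expect n cl p \<eta> (dev t i) \<le> 1 / real n ^ 3" if t: "\<bar>t\<bar> = 2 * r" for t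
      proof -
        have "exp (- (2 * r * s)) * ssbm_expect n cl p \<eta> (dev t i) \<le> exp (- (2 * r * s)) * exp (D * t\<^sup>2)"
          unfolding dev_def D_def using p t r_half by (intro mult_left_mono degree_mgf_le i) auto
        also have "t\<^sup>2 = 4 * r\<^sup>2" using arg_cong[OF t, of "\<lambda>x. x\<^sup>2"] by (simp add: power_mult_distrib)
        also have "exp (- (2 * r * s)) * exp (D * (4 * r\<^sup>2)) = exp (- (4 * (r\<^sup>2 * D)))"
          by (simp add: s_def power2_eq_square algebra_simps flip: exp_add)
        also have "\<dots> \<le> exp (- 3 * ln (real n))" using rD by simp
        finally show ?thesis unfolding exp_minus_3_ln[OF n0] .
      qed
      show "exp (- (2 * r * s)) * ssbm_expect n cl p \<eta> (dev (2 * r) i) + exp (- (2 * r * s)) * ssbm_expect n cl p \<eta> (dev (- 2 * r) i)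
        \<le> 2 * (1 / real n ^ 3)"
        using b[of "2 * r"] b[of "- 2 * r"] r0 by simp
    qed
    also have "(\<Sum>i<n. 2 * (1 / real n ^ 3)) \<le> 1 / real n" using n3 by (simp add: mult_ac)
    finally show ?thesis by simp
  qed
  ultimately show ?thesis by simp
qed

text \<open>\<open>0 < d\<close> makes the unit sphere nonempty, so that the supremum is that of a
  nonempty set.\<close>

lemma spec_norm_le:
  assumes "M \<in> carrier_mat N d" "0 < d"
    and "\<And>u. u \<in> carrier_vec d \<Longrightarrow> euclid_norm (M *\<^sub>v u) \<le> c * euclid_norm u"
  shows "spec_norm M \<le> c"
  unfolding spec_norm_def
proof (rule cSup_least)
  have "unit_vec d 0 \<in> carrier_vec d" "euclid_norm (unit_vec d 0) = 1"
    using assms(2) by (simp_all add: euclid_norm_def if_distrib[of "\<lambda>z. z\<^sup>2"] cong: if_cong)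
  then show "{euclid_norm (M *\<^sub>v x) |x. x \<in> carrier_vec (dim_col M) \<and> euclid_norm x = 1} \<noteq> {}"
    using assms(1) by (auto intro!: exI[of _ "unit_vec d 0"])
qed (use assms in force)

text \<open>The deterministic half of the argument. With gap at least
  \<open>g = (1 - 2 \<eta>) / k\<close>, the assumption on \<Delta> gives
  \<open>\<Delta> \<le> g / 4\<close>, so the sine is at most
  \<open>(\<delta> g / 2) / (3 g / 4) \<le> \<delta>\<close>. Alignment costs a factor
  \<open>sqrt 2 \<le> 2\<close>.\<close>

lemma spectral_alignment:
  assumes n: "10 \<le> n" and k: "2 \<le> k" and P: "valid_partition n k cl"
    and \<eta>: "0 \<le> \<eta>" "\<eta> < 1/2" and p: "0 < p"
    and \<rho>: "sqrt (aspect_ratio n k cl) > 1 - 1 / (4 * real k * (2 + sqrt (real k)))"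
    and \<delta>: "0 < \<delta>" "\<delta> < 1/2"
    and \<Delta>: "op_bound (Lsym_signed A - mean_Lsym n cl ((1 - 2 * \<eta>) / (real n - 1))) \<Delta>"
      "0 \<le> \<Delta>" "\<Delta> \<le> 1/2 * \<delta> * ((1 - 2 * \<eta>) / real k)"
    and A: "A \<in> carrier_mat n n"
    and R: "bottom_eigvecs (Cbar_mat n k cl p \<eta>) (k - 1) R"
    and V: "bottom_eigvecs (Lsym_signed A) (k - 1) V"
  shows "\<exists>Q. orthogonal_mat (k - 1) Q \<and> spec_norm (V - Theta_mat n k cl * R * Q) \<le> 2 * \<delta>"
proof -
  define q where "q = (1 - 2 * \<eta>) / (real n - 1)"
  define g where "g = (1 - 2 * \<eta>) / real k"
  have q0: "0 \<le> q" using \<eta> n by (simp add: q_def)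
  have g0: "0 < g" using \<eta> k by (simp add: g_def)
  have Cbar: "Cbar_mat n k cl p \<eta> = (1 + q) \<cdot>\<^sub>m 1\<^sub>m k - block_mat n k cl q"
    unfolding q_def by (rule Cbar_mat_eq) (use p n in auto)
  have dimC: "dim_row (Cbar_mat n k cl p \<eta>) = k" by (simp add: Cbar block_mat_def)
  from R obtain U \<mu> where U: "orthogonal_mat k U" and \<mu>: "\<forall>i j. i \<le> j \<longrightarrow> j < k \<longrightarrow> \<mu> i \<le> \<mu> j"
    and Ceq: "Cbar_mat n k cl p \<eta> = U * diag_of k \<mu> * transpose_mat U" and Req: "R = first_cols k (k - 1) U"
    unfolding bottom_eigvecs_def Let_def dimC diag_of_def first_cols_def by blast
  have L: "Lsym_signed A \<in> carrier_mat n n" by (rule Lsym_signed_carrier[OF A])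
  then have dimL: "dim_row (Lsym_signed A) = n" by simp
  from V obtain U' lam where U': "orthogonal_mat n U'" and lam: "\<forall>i j. i \<le> j \<longrightarrow> j < n \<longrightarrow> lam i \<le> lam j"
    and Leq: "Lsym_signed A = U' * diag_of n lam * transpose_mat U'" and Veq: "V = mat n (k - 1) (\<lambda>(i, j). U' $$ (i, j))"
    and kn: "k - 1 \<le> n"
    unfolding bottom_eigvecs_def Let_def dimL diag_of_def by blast
  obtain smin smax where s: "\<And>i. i < k \<Longrightarrow> smin \<le> real (csize n cl i)" "\<And>i. i < k \<Longrightarrow> real (csize n cl i) \<le> smax"
    and gap: "real n / real k \<le> 2 * smin" "real n / real k \<le> 2 * smin - (2 * smax - real n)"
    using cluster_size_gap[OF P k _ \<rho>] n by auto
  define X where "X = Theta_mat n k cl * R"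
  define low where "low = 1 + q - 2 * q * smin"
  \<comment> \<open>The maximum with 0 keeps \<open>high\<close> below both \<open>1 + q\<close> and
    the lower bound for \<open>\<mu> (k - 1)\<close>.\<close>
  define high where "high = 1 + q - q * max 0 (2 * smax - real n)"
  note eq = Ceq[unfolded Cbar]
  have low: "\<mu> (k - 2) \<le> low" unfolding low_def by (rule Cbar_second_largest_le[OF k q0 U \<mu> eq s(1)])
  have high1: "high \<le> 1 + q" using q0 by (simp add: high_def)
  have "q * (2 * smax - real n) \<le> q * max 0 (2 * smax - real n)" using q0 by (intro mult_left_mono) auto
  moreover have "1 + q - q * (2 * smax - real n) \<le> \<mu> (k - 1)" by (rule Cbar_largest_ge[OF P k q0 _ U \<mu> eq s(2)]) (use n in simp)
  ultimately have high: "high \<le> \<mu> (k - 1)" by (simp add: high_def)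
  \<comment> \<open>The denominator \<open>n - 1\<close> in \<open>q\<close> is smaller than
    \<open>n\<close>, so \<open>q n \<ge> 1 - 2 \<eta>\<close>.\<close>
  have "g \<le> q * (real n / real k)"
    unfolding g_def q_def using \<eta> n k by (simp add: field_simps)
  also have "\<dots> \<le> q * (2 * smin - max 0 (2 * smax - real n))" using gap q0 by (intro mult_left_mono) auto
  also have "\<dots> = high - low" by (simp add: high_def low_def algebra_simps)
  finally have gap': "g \<le> high - low" .
  note pop = population_structure[OF P k U \<mu> eq Req X_def]
  have "\<Delta> \<le> 1/2 * \<delta> * g" using \<Delta>(3) by (simp add: g_def)
  moreover have "1/2 * \<delta> * g \<le> 1/4 * g" using \<delta> g0 by (intro mult_right_mono) auto
  ultimately have \<Delta>g: "\<Delta> \<le> 1/4 * g" by linarith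
  then have \<Delta>lt: "\<Delta> < high - low" using gap' g0 by linarith
  have k1: "0 < k - 1" using k by simp
  have low': "\<forall>z \<in> carrier_vec (k - 1). (X *\<^sub>v z) \<bullet> (mean_Lsym n cl q *\<^sub>v (X *\<^sub>v z)) \<le> low * (euclid_norm z)\<^sup>2"
    using pop(3)[OF _ low] by blast
  have high': "\<forall>f \<in> carrier_vec n. transpose_mat X *\<^sub>v f = 0\<^sub>v (k - 1) \<longrightarrow> high * (euclid_norm f)\<^sup>2 \<le> f \<bullet> (mean_Lsym n cl q *\<^sub>v f)"
    using pop(4)[OF _ _ high high1] by blast
  have inv': "\<forall>f \<in> carrier_vec n. transpose_mat X *\<^sub>v f = 0\<^sub>v (k - 1) \<longrightarrow> transpose_mat X *\<^sub>v (mean_Lsym n cl q *\<^sub>v f) = 0\<^sub>v (k - 1)"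
    using pop(5) by blast
  note dk = davis_kahan[OF k1 kn U' lam Leq Veq mean_Lsym_carrier mean_Lsym_symmetric \<Delta>(1)[folded q_def]
      \<Delta>(2) \<Delta>lt pop(1,2) low' high' inv']
  have "\<Delta> / (high - low - \<Delta>) \<le> \<delta>"
  proof -
    have "\<Delta> \<le> \<delta> * (3/4 * g)" using \<open>\<Delta> \<le> 1/2 * \<delta> * g\<close> mult_pos_pos[OF \<delta>(1) g0] by linarith
    also have "\<dots> \<le> \<delta> * (high - low - \<Delta>)" using gap' \<Delta>g \<delta> by (intro mult_left_mono) linarith+
    finally show ?thesis using \<Delta>lt by (simp add: divide_le_eq)
  qed
  then have sin: "euclid_norm (V *\<^sub>v u - X *\<^sub>v (transpose_mat X *\<^sub>v (V *\<^sub>v u))) \<le> \<delta> * euclid_norm u"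
    if "u \<in> carrier_vec (k - 1)" for u
    using order_trans[OF dk(2)[OF that] mult_right_mono[OF _ euclid_norm_nonneg]] by blast
  have Vc: "V \<in> carrier_mat n (k - 1)" by (simp add: Veq)
  obtain Q where Q: "orthogonal_mat (k - 1) Q"
    and al: "\<And>u. u \<in> carrier_vec (k - 1) \<Longrightarrow> (euclid_norm ((V - X * Q) *\<^sub>v u))\<^sup>2 \<le> 2 * (\<delta> * euclid_norm u)\<^sup>2"
    using orthogonal_alignment[OF pop(1,2) Vc dk(1) sin] by blast
  have "spec_norm (V - X * Q) \<le> 2 * \<delta>"
  proof (rule spec_norm_le)
    show "V - X * Q \<in> carrier_mat n (k - 1)"
      by (rule minus_carrier_mat[OF mult_carrier_mat[OF pop(1) orthogonal_matD(1)[OF Q]]])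
    fix u :: "real vec" assume u: "u \<in> carrier_vec (k - 1)"
    have "(2 * \<delta> * euclid_norm u)\<^sup>2 = 4 * (\<delta> * euclid_norm u)\<^sup>2" by (simp add: power_mult_distrib)
    then have "(euclid_norm ((V - X * Q) *\<^sub>v u))\<^sup>2 \<le> (2 * \<delta> * euclid_norm u)\<^sup>2"
      using al[OF u] zero_le_power2[of "\<delta> * euclid_norm u"] by linarith
    then show "euclid_norm ((V - X * Q) *\<^sub>v u) \<le> 2 * \<delta> * euclid_norm u"
      by (rule power2_le_imp_le) (use \<delta> in simp)
  qed (use k in simp)
  then show ?thesis using Q unfolding X_def by blast
qed

text \<open>Evaluates the perturbation bound at \<open>\<epsilon> = 4 r\<close> and
  \<open>\<theta> = 15 n p r\<close>. The noise term is at most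
  \<open>6/5 * 10/9 * 15 r = 20 r\<close>, where \<open>10/9\<close> bounds
  \<open>n / (n - 1)\<close>; the degree term is at most \<open>8 r * 5/2 = 20 r\<close>.\<close>

lemma noise_level_le:
  fixes r :: real
  assumes "0 \<le> r" "r \<le> 1 / 336" "10 \<le> n" "0 < p"
  shows "(1 + 4 * r)\<^sup>2 * (15 * (real n * p * r)) / (p * (real n - 1)) + 2 * (4 * r) * (2 + 4 * r) \<le> 40 * r"
proof -
  have "(1 + 4 * r)\<^sup>2 \<le> (1 + 4 * (1 / 336))\<^sup>2" using assms by (intro power_mono) auto
  then have "(1 + 4 * r)\<^sup>2 \<le> 6 / 5" by (simp add: power2_eq_square)
  then have "(1 + 4 * r)\<^sup>2 * (real n / (real n - 1)) \<le> 6 / 5 * (10 / 9)"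
    using assms by (intro mult_mono) (auto simp: field_simps)
  then have "(1 + 4 * r)\<^sup>2 * (real n / (real n - 1)) * (15 * r) \<le> 6 / 5 * (10 / 9) * (15 * r)"
    using assms by (intro mult_right_mono) auto
  moreover have "(1 + 4 * r)\<^sup>2 * (15 * (real n * p * r)) / (p * (real n - 1)) = (1 + 4 * r)\<^sup>2 * (real n / (real n - 1)) * (15 * r)"
    using assms by simp
  ultimately have 1: "(1 + 4 * r)\<^sup>2 * (15 * (real n * p * r)) / (p * (real n - 1)) \<le> 20 * r" by simp
  have "r * (2 + 4 * r) \<le> r * (5 / 2)" using assms by (intro mult_left_mono) auto
  then have 2: "2 * (4 * r) * (2 + 4 * r) \<le> 20 * r" by simp
  show ?thesis using add_mono[OF 1 2] by simp
qed

theorem mainTheorem4: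
  "\<exists>C c :: real. 0 < C \<and> C < 43 \<and> 0 < c \<and>
     (\<forall>(n::nat) (k::nat) (cl::nat \<Rightarrow> nat) (p::real) (\<eta>::real) (\<delta>::real) (R::real mat).
        n \<ge> 10 \<longrightarrow> k \<ge> 2 \<longrightarrow> valid_partition n k cl \<longrightarrow>
        0 \<le> \<eta> \<longrightarrow> \<eta> < 1/2 \<longrightarrow> p \<le> 1 \<longrightarrow>
        sqrt (aspect_ratio n k cl) > 1 - 1 / (4 * real k * (2 + sqrt (real k))) \<longrightarrow>
        0 < \<delta> \<longrightarrow> \<delta> < 1/2 \<longrightarrow>
        p > (2 * C * real k / (\<delta> * (1 - 2 * \<eta>)))^2 * ln (real n) / real n \<longrightarrow>
        bottom_eigvecs (Cbar_mat n k cl p \<eta>) (k - 1) R \<longrightarrow>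
        ssbm_prob n cl p \<eta>
          {A. \<forall>V. bottom_eigvecs (Lsym_signed A) (k - 1) V \<longrightarrow>
                (\<exists>Q. orthogonal_mat (k - 1) Q \<and>
                     spec_norm (V - Theta_mat n k cl * R * Q) \<le> 2 * \<delta>)}
        \<ge> 1 - 2 / real n - real n * exp (- (real n * p / c)))"
proof (rule exI[of _ 42], rule exI[of _ 1], intro conjI allI impI)
  fix n k :: nat and cl :: "nat \<Rightarrow> nat" and p \<eta> \<delta> :: real and R :: "real mat"
  assume n: "10 \<le> n" and k: "2 \<le> k" and P: "valid_partition n k cl" and \<eta>: "0 \<le> \<eta>" "\<eta> < 1/2" and p1: "p \<le> 1"
    and \<rho>: "sqrt (aspect_ratio n k cl) > 1 - 1 / (4 * real k * (2 + sqrt (real k)))"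
    and \<delta>: "0 < \<delta>" "\<delta> < 1/2"
    and p: "p > (2 * 42 * real k / (\<delta> * (1 - 2 * \<eta>)))^2 * ln (real n) / real n"
    and R: "bottom_eigvecs (Cbar_mat n k cl p \<eta>) (k - 1) R"
  let ?E = "{A. \<forall>V. bottom_eigvecs (Lsym_signed A) (k - 1) V \<longrightarrow>
      (\<exists>Q. orthogonal_mat (k - 1) Q \<and> spec_norm (V - Theta_mat n k cl * R * Q) \<le> 2 * \<delta>)}"
  \<comment> \<open>The hypothesis on \<open>p\<close> is \<open>r < b\<close> in disguise, and
    \<open>42 b\<close> is precisely the perturbation \<open>\<delta> (1 - 2 \<eta>) / (2 k)\<close>
    that \<open>spectral_alignment\<close> admits.\<close>
  define b where "b = \<delta> * (1 - 2 * \<eta>) / (84 * real k)"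
  define r where "r = sqrt (ln (real n) / (real n * p))"
  have ln2: "2 \<le> ln (real n)" by (rule two_le_ln[OF n])
  have b0: "0 < b" using \<delta> \<eta> k by (simp add: b_def)
  \<comment> \<open>From \<open>\<delta> (1 - 2 \<eta>) \<le> 1/2\<close> and
    \<open>k \<ge> 2\<close>, \<open>b \<le> (1/2) / 168 = 1/336\<close>; this makes
    \<open>r\<close> small enough for the numerical lemmas.\<close>
  have "\<delta> * (1 - 2 * \<eta>) \<le> 1/2 * 1" using \<delta> \<eta> by (intro mult_mono) auto
  then have "b \<le> (1/2) / (84 * 2)" unfolding b_def using k \<delta> \<eta> by (intro frac_le) auto
  then have b336: "b \<le> 1 / 336" by simp
  have "2 * 42 * real k / (\<delta> * (1 - 2 * \<eta>)) = 1 / b" by (simp add: b_def)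
  with p have pb: "(1 / b)\<^sup>2 * ln (real n) / real n < p" by simp
  have "0 < (1 / b)\<^sup>2 * ln (real n) / real n" using b0 ln2 n by simp
  then have p0: "0 < p" using pb by linarith
  have np: "0 < real n * p" using n p0 by simp
  have lnb: "ln (real n) \<le> b\<^sup>2 * (real n * p)"
    using pb b0 n by (simp add: field_simps power_divide)
  have r0: "0 \<le> r" using ln2 np by (simp add: r_def)
  have r2: "r\<^sup>2 = ln (real n) / (real n * p)" using ln2 np by (simp add: r_def)
  have "r\<^sup>2 \<le> b\<^sup>2" unfolding r2 using lnb np by (simp add: divide_le_eq)
  then have rb: "r \<le> b" by (rule power2_le_imp_le) (use b0 in simp)
  have "b\<^sup>2 \<le> (1 / 336)\<^sup>2" using b0 b336 by (intro power_mono) auto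
  then have "b\<^sup>2 * (real n * p) \<le> (1 / 336)\<^sup>2 * (real n * p)" using np by (intro mult_right_mono) auto
  then have big: "112896 * ln (real n) \<le> real n * p" using lnb by (simp add: power2_eq_square)
  have "sqrt (real n * p * ln (real n)) = sqrt ((real n * p)\<^sup>2 * r\<^sup>2)"
    unfolding r2 using np by (simp add: power2_eq_square)
  also have "\<dots> = real n * p * r" using np r0 by (simp add: real_sqrt_mult)
  finally have \<theta>: "sqrt (real n * p * ln (real n)) = real n * p * r" .
  have "1 - 2 / real n \<le> ssbm_prob n cl p \<eta> ?E"
  proof (rule good_event_prob[OF n p0 p1 \<eta>(1) _ big])
    show "\<eta> \<le> 1/2" using \<eta> by simp
    fix A assume A: "A \<in> signed_adj n"
      and W: "op_bound (noise n cl p \<eta> A) (15 * sqrt (real n * p * ln (real n)))"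
      and deg: "\<And>i. i < n \<Longrightarrow> \<bar>signed_degree A i - p * (real n - 1)\<bar> \<le> 4 * sqrt (ln (real n) / (real n * p)) * (p * (real n - 1))"
    let ?\<Delta> = "(1 + 4 * r)\<^sup>2 * (15 * (real n * p * r)) / (p * (real n - 1)) + 2 * (4 * r) * (2 + 4 * r)"
    have \<Delta>: "op_bound (Lsym_signed A - mean_Lsym n cl ((1 - 2 * \<eta>) / (real n - 1))) ?\<Delta>"
      using Lsym_perturbation[OF A _ p0 \<eta>(1) _ _ _ deg W, folded r_def] n \<eta> r0 rb b336 np by (simp add: \<theta>)
    have \<Delta>0: "0 \<le> ?\<Delta>" using r0 p0 n by simp
    have "?\<Delta> \<le> 40 * r" by (rule noise_level_le) (use r0 rb b336 n p0 in auto)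
    also have "\<dots> \<le> 40 * b" using rb by simp
    also have "\<dots> \<le> 42 * b" using b0 by simp
    also have "\<dots> = 1/2 * \<delta> * ((1 - 2 * \<eta>) / real k)" by (simp add: b_def)
    finally have \<Delta>1: "?\<Delta> \<le> 1/2 * \<delta> * ((1 - 2 * \<eta>) / real k)" .
    show "A \<in> ?E"
      using spectral_alignment[OF n k P \<eta> p0 \<rho> \<delta> \<Delta> \<Delta>0 \<Delta>1 signed_adj_carrier[OF A] R] by blast
  qed
  then show "1 - 2 / real n - real n * exp (- (real n * p / 1)) \<le> ssbm_prob n cl p \<eta> ?E"
    by (smt (verit) exp_ge_zero mult_nonneg_nonneg of_nat_0_le_iff)
qed simp_all

end
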